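(* Let $G_{v_0}$ be a forest with integer weights on all vertices except one unweighted vertex $v_0$, let $G=G_{v_0}\setminus\{v_0\}$, let $n\in\mathbb Z$ be such that $G_{v_0}(n)$ is negative definite, with corresponding Seifert framing $r=\Sigma^2$, and let $G_{v_0}(n)_{u_0}$ be $G_{v_0}(n)$ together with a new unweighted vertex $u_0$ adjacent only to $v_0$. Then the map $\mathrm{hocolim}\,\Phi$ extends to an isomorphism between $\mathbb{CFK}^\natural(G_{v_0}(n)_{u_0})$ and $\mathbb{XK}_{r}(\mathbb{CFK}^\natural(G_{v_0}))$; that is, for every $\mathrm{Spin}^c$ structure on $Y_{G_{v_0}(n)}$ it is an isomorphism of doubly filtered simplicial sets, and these isomorphisms commute with the flip maps.
   Context: **Plumbings.** For a weighted forest $H$, $X_H$ is the plumbing 4-manifold and $Y_H=\partial X_H$; vertices are identified with classes in $H_2(X_H;\mathbb Z)$. $G_{v_0}(n)$ is $G_{v_0}$ with $v_0$ given weight $n$. $\mathrm{Char}(H)\subset H^2(X_H;\mathbb Z)$ is the set of characteristic classes; classes $S\in H_2(X_H,Y_H;\mathbb Z)$ act by $k+S:=k+2PD[S]$. Orbits of $\mathrm{Char}(H)$ under $H_2(X_H;\mathbb Z)$ correspond to $\mathrm{Spin}^c(Y_H)$; $\mathrm{Char}(H,\mathfrak t)$ is the orbit of $\mathfrak t$. An unweighted vertex $v_0$ attached to $H$ defines a class in $H_2(X_H,Y_H;\mathbb Z)$ (boundary connected sum of disk fibers over the vertices adjacent to $v_0$), with boundary a knot $K\subset Y_H$; it acts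 on $\mathrm{Char}(H)$ by $k+v_0=k+2PD[v_0]$, taking $\mathrm{Char}(H,\mathfrak t)$ to $\mathrm{Char}(H,\mathfrak t+[K])$. **Knot lattice simplicial sets.** For $H$ negative definite, the cube $[k,E]$ ($k\in\mathrm{Char}(H,\mathfrak t)$, $E$ a set of vertices of $H$) is the convex hull of $\{k+\sum_{v\in I}v: I\subseteq E\}$; $h_U(k)=\frac{k^2+|V(H)|}{4}$, $h_U([k,E])$ is the minimum of $h_U$ over the vertices of the cube. $D_{H,\mathfrak t}$ is the category of these cubes, with a morphism $[k,E]\to[k',E']$ when $[k',E']$ is a face of $[k,E]$. $\mathbb{CF}^\natural(H,\mathfrak t)$ is the homotopy colimit over $D_{H,\mathfrak t}$ of the diagram $\mathbb{CFD}$ of single points of height $h_U([k,E])$. Given an unweighted vertex $v_0$ attached to $H$ (forming $H_{v_0}$), put $h_V([k,E])=h_U([k+v_0,E])$; $\mathbb{CFK}^\natural(H_{v_0},\mathfrak t)$ is the homotopy colimit over $D_{H,\mathfrak t}$ of points of double height $(h_U,h_V)$ (same underlying simplicial set and first height as $\mathbb{CF}^\natural(H,\mathfrak t)$), and the flip map $\Gamma\colon p_{2,!}\mathbb{CFK}^\natural(H_{v_0},\mathfrak t)\to p_{1,!}\mathbb{CFK}^\natural(H_{v_0},\mathfrak t+[K])$ is induced by $[k,E]\mapsto[k+v_0,E]$. $\mathbb{CFK}^\natural(H_{v_0})$ is the collection over all $\mathfrak t$ with $\Gamma$. Homotopy colimits are given by the usual Bousfield–Kan (simplicial bar) formula. **Surgery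 indexing.** $K=K_{G_{v_0}}\subset Y_G$. $\Sigma_0\in H_2(X_G;\mathbb Q)$ is the class with $\Sigma_0\cdot v=v_0\cdot v$ for all vertices $v$ of $G$; $\Sigma=v_0-\Sigma_0\in H_2(X_{G_{v_0}(n)};\mathbb Q)$, $r=\Sigma^2=n-\Sigma_0^2<0$. For $L\in\mathrm{Char}(G_{v_0}(n))$ let $\hat A(L)=\frac{L(\Sigma)+r}{2}$. Let $\mathcal A$ be the set of pairs $(\mathfrak t,i)$ for which some $L\in\mathrm{Char}(G_{v_0}(n))$ has $L|_G\in\mathrm{Char}(G,\mathfrak t)$ and $\hat A(L)=i$. $\mathrm{Spin}^c(Y_{G_{v_0}(n)})$ is $\mathcal A$ modulo $(\mathfrak t,i)\sim(\mathfrak t+[K],i+r)$, with classes $[\mathfrak t,i]$; the dual knot $\mu$ (represented by $u_0$) acts by $[\mathfrak t,i]+[\mu]=[\mathfrak t,i+1]$. $\mathcal I_{[\mathfrak t,i]}$ is the category with objects $(\mathfrak t',i',a),(\mathfrak t',i',b)$, $(\mathfrak t',i')$ in the class $[\mathfrak t,i]$, and non-identity morphisms $\lambda_{\mathfrak t',i'}\colon(\mathfrak t',i',a)\to(\mathfrak t',i',b)$, $\rho_{\mathfrak t',i'}\colon(\mathfrak t',i',a)\to(\mathfrak t'+[K],i'+r,b)$. **The surgery functor.** A (doubly) filtered simplicial set is a simplicial set with a (pair of) height function(s) on simplices such that faces have height at least that of the simplex. For heights $(h_1,h_2)$ on $X$, $p_{j,!}X$ remembers only $h_j$; $A_i^*X$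 has height $\min\{h_1,h_2+2i\}$; $[q]$ adds $q$ to the height; $\eta_1\colon A_i^*X\to p_{1,!}X$, $\eta_2\colon A_i^*X\to p_{2,!}X[2i]$ are the identity on underlying simplicial sets. Let $\mathrm{gr}_r(i)=\frac{(2i-r)^2+r}{4r}$. For $X=(X^{\mathfrak t})_{\mathfrak t\in\mathrm{Spin}^c(Y_G)}$ with flip maps $\Gamma^{\mathfrak t}\colon p_{2,!}X^{\mathfrak t}\to p_{1,!}X^{\mathfrak t+[K]}$, the diagram $\mathbb{XD}_r^{[\mathfrak t,i]}(X)$ on $\mathcal I_{[\mathfrak t,i]}$ sends $(\mathfrak t',i',a)\mapsto A_{i'}^*(X^{\mathfrak t'})[\mathrm{gr}_r(i')]$, $(\mathfrak t',i',b)\mapsto p_{1,!}(X^{\mathfrak t'})[\mathrm{gr}_r(i')]$, $\lambda_{\mathfrak t',i'}\mapsto\eta_1$, $\rho_{\mathfrak t',i'}\mapsto\Gamma^{\mathfrak t'}\circ\eta_2$ (shifted by $\mathrm{gr}_r(i')$). $\mathbb{XKD}_r^{[\mathfrak t,i]}(X)$ has the same underlying simplicial sets and maps, with first height at $(\mathfrak t',i',\cdot)$ that of $\mathbb{XD}_r^{[\mathfrak t,i]}(X)$ at $(\mathfrak t',i',\cdot)$ and second height that of $\mathbb{XD}_r^{[\mathfrak t,i+1]}(X)$ at $(\mathfrak t',i'+1,\cdot)$. $\mathbb{XK}_r(X)^{[\mathfrak t,i]}=\mathrm{hocolim}\,\mathbb{XKD}_r^{[\mathfrak t,i]}(X)$,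 with flip map $\tilde\Gamma\colon p_{2,!}\mathbb{XK}_r(X)^{[\mathfrak t,i]}\to p_{1,!}\mathbb{XK}_r(X)^{[\mathfrak t,i+1]}$ induced by the index shift $(\mathfrak t',i',\cdot)\mapsto(\mathfrak t',i'+1,\cdot)$ and the identity on underlying simplicial sets. **The map $\mathrm{hocolim}\,\Phi$.** Let $\mathbb{TB}^{[\mathfrak t,i]}$ be the diagram on $\mathcal I_{[\mathfrak t,i]}$ whose value at $(\mathfrak t',i',b)$ (resp. $(\mathfrak t',i',a)$) is the homotopy colimit of $\mathbb{CFD}$ over the cubes $[L,E]$ of $D_{G_{v_0}(n),[\mathfrak t,i]}$ with $v_0\notin E$ (resp. $v_0\in E$), $L|_G\in\mathrm{Char}(G,\mathfrak t')$, $\hat A(L)=i'$, with $\lambda,\rho$ induced by $[L,E\cup\{v_0\}]\mapsto[L,E]$ and $[L,E\cup\{v_0\}]\mapsto[L+v_0,E]$. Its homotopy colimit is $\mathbb{CF}^\natural(G_{v_0}(n),[\mathfrak t,i])$. $\Phi\colon\mathbb{TB}^{[\mathfrak t,i]}\to\mathbb{XD}_r^{[\mathfrak t,i]}(\mathbb{CFK}^\natural(G_{v_0}))$ is the natural isomorphism of diagrams of filtered simplicial sets induced by $[L,E]\mapsto[L|_G,E]$ at $(\cdot,\cdot,b)$ and $[L,E\cup\{v_0\}]\mapsto[L|_G,E]$ at $(\cdot,\cdot,a)$, so $\mathrm{hocolim}\,\Phi$ is an isomorphism of singly filtered simplicial sets from $\mathbb{CF}^\natural(G_{v_0}(n),[\mathfrak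 t,i])$ to $\mathrm{hocolim}\,\mathbb{XD}_r^{[\mathfrak t,i]}(\mathbb{CFK}^\natural(G_{v_0}))$. *)

theory Defs
  imports Complex_Main "HOL-Library.FuncSet" "HOL-Library.Product_Order"
begin

section \<open>Filtered simplicial sets\<close>

text \<open>
  Simplicial sets are presheaves on the simplex category. An arrow from \<open>[m]\<close> to \<open>[n]\<close> is a
  monotone map of \<open>{..m}\<close> into \<open>{..n}\<close>, made extensional so that equal arrows are equal functions;
  \<open>act X m n \<theta>\<close> is the induced operator from \<open>n\<close>-simplices to \<open>m\<close>-simplices.
  Heights take values in an ordered type: \<^typ>\<open>rat\<close> for filtered simplicial sets, and
  \<^typ>\<open>rat \<times> rat\<close> with the componentwise order for doubly filtered ones.
\<close>

definition simplex_arrows :: "nat \<Rightarrow> nat \<Rightarrow> (nat \<Rightarrow> nat) set" where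
  "simplex_arrows m n = {\<theta> \<in> {..m} \<rightarrow>\<^sub>E {..n}. mono_on {..m} \<theta>}"

record ('x, 'h) fsset =
  cells :: "nat \<Rightarrow> 'x set"
  act :: "nat \<Rightarrow> nat \<Rightarrow> (nat \<Rightarrow> nat) \<Rightarrow> 'x \<Rightarrow> 'x"
  ht :: "nat \<Rightarrow> 'x \<Rightarrow> 'h"

text \<open>
  The height condition is imposed for all simplicial operators, so that every superlevel set is a
  simplicial subset; since a simplex is a face of its degeneracies, this amounts to the condition on
  faces together with degeneracies preserving the height.
\<close>

definition filtered_sset :: "('x, 'h::order) fsset \<Rightarrow> bool" where
  "filtered_sset X \<longleftrightarrow>
     (\<forall>m n. \<forall>\<theta> \<in> simplex_arrows m n. \<forall>x \<in> cells X n.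
        act X m n \<theta> x \<in> cells X m \<and> ht X n x \<le> ht X m (act X m n \<theta> x)) \<and>
     (\<forall>n. \<forall>x \<in> cells X n. act X n n (\<lambda>j\<in>{..n}. j) x = x) \<and>
     (\<forall>l m n. \<forall>\<phi> \<in> simplex_arrows l m. \<forall>\<theta> \<in> simplex_arrows m n. \<forall>x \<in> cells X n.
        act X l n (compose {..l} \<theta> \<phi>) x = act X l m \<phi> (act X m n \<theta> x))"

definition filtered_map ::
  "('x, 'h::order) fsset \<Rightarrow> ('y, 'h) fsset \<Rightarrow> (nat \<Rightarrow> 'x \<Rightarrow> 'y) \<Rightarrow> bool" where
  "filtered_map X Y f \<longleftrightarrow>
     (\<forall>n. \<forall>x \<in> cells X n. f n x \<in> cells Y n \<and> ht X n x \<le> ht Y n (f n x)) \<and>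
     (\<forall>m n. \<forall>\<theta> \<in> simplex_arrows m n. \<forall>x \<in> cells X n.
        f m (act X m n \<theta> x) = act Y m n \<theta> (f n x))"

definition filtered_iso ::
  "('x, 'h::order) fsset \<Rightarrow> ('y, 'h) fsset \<Rightarrow> (nat \<Rightarrow> 'x \<Rightarrow> 'y) \<Rightarrow> bool" where
  "filtered_iso X Y f \<longleftrightarrow>
     filtered_sset X \<and> filtered_sset Y \<and> filtered_map X Y f \<and>
     (\<exists>g. filtered_map Y X g \<and>
        (\<forall>n. \<forall>x \<in> cells X n. g n (f n x) = x) \<and>
        (\<forall>n. \<forall>y \<in> cells Y n. f n (g n y) = y))"

definition with_ht :: "(nat \<Rightarrow> 'x \<Rightarrow> 'k) \<Rightarrow> ('x, 'h) fsset \<Rightarrow> ('x, 'k) fsset" where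
  "with_ht h X = \<lparr>cells = cells X, act = act X, ht = h\<rparr>"

definition p1 :: "('x, rat \<times> rat) fsset \<Rightarrow> ('x, rat) fsset" where
  "p1 X = with_ht (\<lambda>n x. fst (ht X n x)) X"

definition p2 :: "('x, rat \<times> rat) fsset \<Rightarrow> ('x, rat) fsset" where
  "p2 X = with_ht (\<lambda>n x. snd (ht X n x)) X"

definition A_star :: "rat \<Rightarrow> ('x, rat \<times> rat) fsset \<Rightarrow> ('x, rat) fsset" where
  "A_star i X = with_ht (\<lambda>n x. min (fst (ht X n x)) (snd (ht X n x) + 2 * i)) X"

definition ht_shift :: "('x, rat) fsset \<Rightarrow> rat \<Rightarrow> ('x, rat) fsset" where
  "ht_shift X q = with_ht (\<lambda>n x. ht X n x + q) X"

definition point :: "'h \<Rightarrow> (unit, 'h) fsset" where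
  "point h = \<lparr>cells = (\<lambda>n. UNIV), act = (\<lambda>m n \<theta> x. x), ht = (\<lambda>n x. h)\<rparr>"


section \<open>Homotopy colimits\<close>

record ('o, 'm) cat =
  ob :: "'o set"
  mor :: "'m set"
  src :: "'m \<Rightarrow> 'o"
  tgt :: "'m \<Rightarrow> 'o"
  ide :: "'o \<Rightarrow> 'm"
  cmp :: "'m \<Rightarrow> 'm \<Rightarrow> 'm"  \<comment> \<open>\<open>cmp C g f\<close> is \<open>g\<close> after \<open>f\<close>\<close>

record ('o, 'm, 'x, 'h) diagram =
  dob :: "'o \<Rightarrow> ('x, 'h) fsset"
  dmor :: "'m \<Rightarrow> nat \<Rightarrow> 'x \<Rightarrow> 'x"

definition tri :: "nat \<Rightarrow> (nat \<times> nat) set" where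
  "tri n = {(j, k). j \<le> k \<and> k \<le> n}"

text \<open>
  An \<open>n\<close>-simplex of the nerve is a functor from \<open>[n]\<close>, given by its values \<open>\<sigma> (j, k)\<close> on the
  arrows \<open>j \<le> k\<close> of \<open>[n]\<close>. Its \<open>j\<close>-th object is \<open>src C (\<sigma> (j, j))\<close>.
\<close>

definition nerve :: "('o, 'm) cat \<Rightarrow> nat \<Rightarrow> (nat \<times> nat \<Rightarrow> 'm) set" where
  "nerve C n = {\<sigma> \<in> extensional (tri n).
     (\<forall>p \<in> tri n. \<sigma> p \<in> mor C) \<and>
     (\<forall>j \<le> n. \<sigma> (j, j) \<in> ide C ` ob C) \<and>
     (\<forall>j k l. j \<le> k \<and> k \<le> l \<and> l \<le> n \<longrightarrow>
        tgt C (\<sigma> (j, k)) = src C (\<sigma> (k, l)) \<and> \<sigma> (j, l) = cmp C (\<sigma> (k, l)) (\<sigma> (j, k)))}"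

text \<open>
  The simplicial bar construction: the diagonal of the bisimplicial set which in degree \<open>n\<close> is the
  disjoint union of \<open>F d\<^sub>0\<close> over the chains \<open>d\<^sub>0 \<rightarrow> \<dots> \<rightarrow> d\<^sub>n\<close>. An operator \<open>\<theta>\<close> replaces
  the chain by its pullback, which starts at the object number \<open>\<theta> 0\<close>.
\<close>

definition hocolim ::
  "('o, 'm) cat \<Rightarrow> ('o, 'm, 'x, 'h) diagram \<Rightarrow> ((nat \<times> nat \<Rightarrow> 'm) \<times> 'x, 'h) fsset" where
  "hocolim C F = \<lparr>
     cells = (\<lambda>n. {(\<sigma>, x). \<sigma> \<in> nerve C n \<and> x \<in> cells (dob F (src C (\<sigma> (0, 0)))) n}),
     act = (\<lambda>m n \<theta> (\<sigma>, x).
       (\<lambda>(j, k)\<in>tri m. \<sigma> (\<theta> j, \<theta> k),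
        dmor F (\<sigma> (0, \<theta> 0)) m (act (dob F (src C (\<sigma> (0, 0)))) m n \<theta> x))),
     ht = (\<lambda>n (\<sigma>, x). ht (dob F (src C (\<sigma> (0, 0)))) n x)\<rparr>"

text \<open>
  The map of homotopy colimits over \<open>C\<close> and another category induced by a functor with arrow part
  \<open>T\<close> and a natural transformation with components \<open>g d\<close>, for objects \<open>d\<close> of \<open>C\<close>.
\<close>

definition hocolim_map ::
  "('o, 'm) cat \<Rightarrow> ('m \<Rightarrow> 'm2) \<Rightarrow> ('o \<Rightarrow> nat \<Rightarrow> 'x \<Rightarrow> 'y) \<Rightarrow>
   nat \<Rightarrow> (nat \<times> nat \<Rightarrow> 'm) \<times> 'x \<Rightarrow> (nat \<times> nat \<Rightarrow> 'm2) \<times> 'y" where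
  "hocolim_map C T g n = (\<lambda>(\<sigma>, x). (\<lambda>p\<in>tri n. T (\<sigma> p), g (src C (\<sigma> (0, 0))) n x))"


section \<open>Weighted forests and their plumbings\<close>

text \<open>Edges are two-element sets of vertices; \<open>wt H v = None\<close> means that \<open>v\<close> is unweighted.\<close>

record 'v wgraph =
  verts :: "'v set"
  edges :: "'v set set"
  wt :: "'v \<rightharpoonup> int"

definition cycle :: "'v wgraph \<Rightarrow> 'v list \<Rightarrow> bool" where
  "cycle H p \<longleftrightarrow> 3 \<le> length p \<and> distinct p \<and>
     (\<forall>i < length p. {p ! i, p ! (Suc i mod length p)} \<in> edges H)"

definition forest :: "'v wgraph \<Rightarrow> bool" where
  "forest H \<longleftrightarrow> finite (verts H) \<and> edges H \<subseteq> {{u, v} | u v. u \<in> verts H \<and> v \<in> verts H \<and> u \<noteq> v} \<and>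
     (\<nexists>p. cycle H p)"

definition delete_vertex :: "'v wgraph \<Rightarrow> 'v \<Rightarrow> 'v wgraph" where
  "delete_vertex H v = \<lparr>verts = verts H - {v}, edges = {e \<in> edges H. v \<notin> e}, wt = wt H |` (- {v})\<rparr>"

definition set_weight :: "'v wgraph \<Rightarrow> 'v \<Rightarrow> int \<Rightarrow> 'v wgraph" where
  "set_weight H v n = H\<lparr>wt := (wt H)(v \<mapsto> n)\<rparr>"

definition attach_vertex :: "'v wgraph \<Rightarrow> 'v \<Rightarrow> 'v \<Rightarrow> 'v wgraph" where
  "attach_vertex H v u = H\<lparr>verts := insert u (verts H), edges := insert {u, v} (edges H)\<rparr>"

text \<open>
  \<open>H\<^sub>2(X\<^sub>H)\<close> is free on the vertices, so its elements (with integral or rational coefficients) are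
  functions on the vertices, and \<open>H\<^sup>2(X\<^sub>H; \<int>)\<close> consists of the integer functions on the vertices
  (evaluations on the basis). Rational homology classes and cohomology classes are represented by
  functions vanishing off the vertices.
\<close>

definition intersection :: "'v wgraph \<Rightarrow> 'v \<Rightarrow> 'v \<Rightarrow> int" where
  "intersection H u v = (if u = v then the (wt H u) else if {u, v} \<in> edges H then 1 else 0)"

definition H2_rat :: "'v wgraph \<Rightarrow> ('v \<Rightarrow> rat) set" where
  "H2_rat H = {x. \<forall>v. v \<notin> verts H \<longrightarrow> x v = 0}"

definition form :: "'v wgraph \<Rightarrow> ('v \<Rightarrow> rat) \<Rightarrow> ('v \<Rightarrow> rat) \<Rightarrow> rat" where
  "form H x y = (\<Sum>u\<in>verts H. \<Sum>v\<in>verts H. x u * of_int (intersection H u v) * y v)"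

definition vertex_class :: "'v \<Rightarrow> 'v \<Rightarrow> 'a::zero_neq_one" where
  "vertex_class v w = (if w = v then 1 else 0)"

definition neg_def :: "'v wgraph \<Rightarrow> bool" where
  "neg_def H \<longleftrightarrow> (\<forall>x \<in> H2_rat H. x \<noteq> (\<lambda>v. 0) \<longrightarrow> form H x x < 0)"

definition characteristic :: "'v wgraph \<Rightarrow> ('v \<Rightarrow> int) set" where
  "characteristic H = {k. (\<forall>v \<in> verts H. even (k v - intersection H v v)) \<and> (\<forall>v. v \<notin> verts H \<longrightarrow> k v = 0)}"

definition PD :: "'v wgraph \<Rightarrow> ('v \<Rightarrow> int) \<Rightarrow> 'v \<Rightarrow> int" where
  "PD H S v = (if v \<in> verts H then \<Sum>u\<in>verts H. S u * intersection H u v else 0)"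

text \<open>
  The action \<open>k + S = k + 2 PD[S]\<close>, for \<open>S\<close> in \<open>H\<^sub>2(X\<^sub>H; \<int>)\<close> and for the relative class of an
  unweighted vertex \<open>v0\<close> attached to \<open>H\<close> (\<open>Hv0\<close> being \<open>H\<close> together with \<open>v0\<close>). That class meets
  each vertex adjacent to \<open>v0\<close> once.
\<close>

definition plus_class :: "'v wgraph \<Rightarrow> ('v \<Rightarrow> int) \<Rightarrow> ('v \<Rightarrow> int) \<Rightarrow> ('v \<Rightarrow> int)" where
  "plus_class H k S = (\<lambda>v. k v + 2 * PD H S v)"

definition PD_attached :: "'v wgraph \<Rightarrow> 'v \<Rightarrow> 'v \<Rightarrow> int" where
  "PD_attached Hv0 v0 v = (if v \<in> verts Hv0 - {v0} \<and> {v0, v} \<in> edges Hv0 then 1 else 0)"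

definition plus_attached :: "'v wgraph \<Rightarrow> 'v \<Rightarrow> ('v \<Rightarrow> int) \<Rightarrow> ('v \<Rightarrow> int)" where
  "plus_attached Hv0 v0 k = (\<lambda>v. k v + 2 * PD_attached Hv0 v0 v)"

text \<open>
  A \<open>Spin\<^sup>c\<close> structure on \<open>Y\<^sub>H\<close> is an orbit of \<open>H\<^sub>2(X\<^sub>H; \<int>)\<close> in \<open>characteristic H\<close>; hence
  \<open>Char(H, t)\<close> is \<open>t\<close> itself.
\<close>

definition orbit :: "'v wgraph \<Rightarrow> ('v \<Rightarrow> int) \<Rightarrow> ('v \<Rightarrow> int) set" where
  "orbit H k = {plus_class H k S | S. True}"

definition Spinc :: "'v wgraph \<Rightarrow> ('v \<Rightarrow> int) set set" where
  "Spinc H = orbit H ` characteristic H"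

text \<open>The square of a cohomology class is that of its rational Poincare dual.\<close>

definition PD_inverse :: "'v wgraph \<Rightarrow> ('v \<Rightarrow> int) \<Rightarrow> 'v \<Rightarrow> rat" where
  "PD_inverse H k = (THE x. x \<in> H2_rat H \<and> (\<forall>v \<in> verts H. form H x (vertex_class v) = of_int (k v)))"

definition square :: "'v wgraph \<Rightarrow> ('v \<Rightarrow> int) \<Rightarrow> rat" where
  "square H k = form H (PD_inverse H k) (PD_inverse H k)"


section \<open>Knot lattice simplicial sets\<close>

text \<open>
  For negative definite \<open>H\<close> the classes \<open>2 PD[v]\<close> are linearly independent, so the convex hull
  \<open>[k, E]\<close> of the \<open>k + \<Sum>\<^sub>v\<^sub>\<in>\<^sub>I v\<close>, \<open>I \<subseteq> E\<close>, determines and is encoded by the pair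
  \<open>(k, E)\<close>.
\<close>

type_synonym 'v cube = "('v \<Rightarrow> int) \<times> 'v set"

definition cube_vertex :: "'v wgraph \<Rightarrow> ('v \<Rightarrow> int) \<Rightarrow> 'v set \<Rightarrow> ('v \<Rightarrow> int)" where
  "cube_vertex H k I = plus_class H k (\<lambda>v. of_bool (v \<in> I))"

definition h_U_char :: "'v wgraph \<Rightarrow> ('v \<Rightarrow> int) \<Rightarrow> rat" where
  "h_U_char H k = (square H k + of_nat (card (verts H))) / 4"

definition h_U :: "'v wgraph \<Rightarrow> 'v cube \<Rightarrow> rat" where
  "h_U H = (\<lambda>(k, E). Min {h_U_char H (cube_vertex H k I) | I. I \<subseteq> E})"

definition face_of :: "'v wgraph \<Rightarrow> 'v cube \<Rightarrow> 'v cube \<Rightarrow> bool" where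
  "face_of H = (\<lambda>(k', E') (k, E). E' \<subseteq> E \<and> (\<exists>I \<subseteq> E - E'. k' = cube_vertex H k I))"

definition face_cat :: "'v wgraph \<Rightarrow> 'v cube set \<Rightarrow> ('v cube, 'v cube \<times> 'v cube) cat" where
  "face_cat H Q = \<lparr>
     ob = Q,
     mor = {(c, c'). c \<in> Q \<and> c' \<in> Q \<and> face_of H c' c},
     src = fst,
     tgt = snd,
     ide = (\<lambda>c. (c, c)),
     cmp = (\<lambda>g f. (fst f, snd g))\<rparr>"

definition cubes :: "'v wgraph \<Rightarrow> ('v \<Rightarrow> int) set \<Rightarrow> 'v cube set" where
  "cubes H t = {(k, E). k \<in> t \<and> E \<subseteq> verts H}"

definition D_cat :: "'v wgraph \<Rightarrow> ('v \<Rightarrow> int) set \<Rightarrow> ('v cube, 'v cube \<times> 'v cube) cat" where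
  "D_cat H t = face_cat H (cubes H t)"

definition point_diagram :: "('o \<Rightarrow> 'h) \<Rightarrow> ('o, 'm, unit, 'h) diagram" where
  "point_diagram h = \<lparr>dob = (\<lambda>c. point (h c)), dmor = (\<lambda>f n x. x)\<rparr>"

abbreviation CFD :: "'v wgraph \<Rightarrow> ('v cube, 'v cube \<times> 'v cube, unit, rat) diagram" where
  "CFD H \<equiv> point_diagram (h_U H)"

type_synonym 'v cube_cell = "(nat \<times> nat \<Rightarrow> 'v cube \<times> 'v cube) \<times> unit"

definition CF :: "'v wgraph \<Rightarrow> ('v \<Rightarrow> int) set \<Rightarrow> ('v cube_cell, rat) fsset" where
  "CF H t = hocolim (D_cat H t) (CFD H)"

definition h_V :: "'v wgraph \<Rightarrow> 'v \<Rightarrow> 'v cube \<Rightarrow> rat" where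
  "h_V Hv0 v0 = (\<lambda>(k, E). h_U (delete_vertex Hv0 v0) (plus_attached Hv0 v0 k, E))"

text \<open>
  A family of doubly filtered simplicial sets indexed by \<open>Spin\<^sup>c\<close> structures, with flip maps from
  the member at \<open>t\<close> to the member at \<open>t + [K]\<close>; \<open>cshift\<close> is the action of \<open>[K]\<close>.
\<close>

record ('t, 'x) coll =
  cidx :: "'t set"
  cshift :: "'t \<Rightarrow> 't"
  cob :: "'t \<Rightarrow> ('x, rat \<times> rat) fsset"
  cflip :: "'t \<Rightarrow> nat \<Rightarrow> 'x \<Rightarrow> 'x"

definition flip_collection :: "('t, 'x) coll \<Rightarrow> bool" where
  "flip_collection X \<longleftrightarrow> (\<forall>t \<in> cidx X. cshift X t \<in> cidx X \<and> filtered_sset (cob X t) \<and>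
     filtered_map (p2 (cob X t)) (p1 (cob X (cshift X t))) (cflip X t))"

definition flip_collection_iso ::
  "('s, 'x) coll \<Rightarrow> ('t, 'y) coll \<Rightarrow> ('s \<Rightarrow> 't) \<Rightarrow> ('s \<Rightarrow> nat \<Rightarrow> 'x \<Rightarrow> 'y) \<Rightarrow> bool" where
  "flip_collection_iso X Y \<phi> f \<longleftrightarrow> flip_collection X \<and> flip_collection Y \<and>
     bij_betw \<phi> (cidx X) (cidx Y) \<and>
     (\<forall>s \<in> cidx X.
        \<phi> (cshift X s) = cshift Y (\<phi> s) \<and>
        filtered_iso (cob X s) (cob Y (\<phi> s)) (f s) \<and>
        (\<forall>n. \<forall>x \<in> cells (cob X s) n.
           cflip Y (\<phi> s) n (f s n x) = f (cshift X s) n (cflip X s n x)))"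

definition CFK :: "'v wgraph \<Rightarrow> 'v \<Rightarrow> (('v \<Rightarrow> int) set, 'v cube_cell) coll" where
  "CFK Hv0 v0 = (let H = delete_vertex Hv0 v0 in \<lparr>
     cidx = Spinc H,
     cshift = (\<lambda>t. plus_attached Hv0 v0 ` t),
     cob = (\<lambda>t. hocolim (D_cat H t) (point_diagram (\<lambda>c. (h_U H c, h_V Hv0 v0 c)))),
     cflip = (\<lambda>t. hocolim_map (D_cat H t)
       (map_prod (map_prod (plus_attached Hv0 v0) id) (map_prod (plus_attached Hv0 v0) id))
       (\<lambda>c n x. x))\<rparr>)"


section \<open>The surgery indexing\<close>

text \<open>Below, \<open>Gv0\<close> has the unweighted vertex \<open>v0\<close> and \<open>G = delete_vertex Gv0 v0\<close>.\<close>

definition Sigma0 :: "'v wgraph \<Rightarrow> 'v \<Rightarrow> 'v \<Rightarrow> rat" where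
  "Sigma0 Gv0 v0 = (let G = delete_vertex Gv0 v0 in
     THE x. x \<in> H2_rat G \<and>
       (\<forall>v \<in> verts G. form G x (vertex_class v) = of_int (PD_attached Gv0 v0 v)))"

definition Sigma_class :: "'v wgraph \<Rightarrow> 'v \<Rightarrow> 'v \<Rightarrow> rat" where
  "Sigma_class Gv0 v0 = (\<lambda>w. vertex_class v0 w - Sigma0 Gv0 v0 w)"

definition seifert_framing :: "'v wgraph \<Rightarrow> 'v \<Rightarrow> int \<Rightarrow> rat" where
  "seifert_framing Gv0 v0 n =
     form (set_weight Gv0 v0 n) (Sigma_class Gv0 v0) (Sigma_class Gv0 v0)"

definition A_hat :: "'v wgraph \<Rightarrow> 'v \<Rightarrow> int \<Rightarrow> ('v \<Rightarrow> int) \<Rightarrow> rat" where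
  "A_hat Gv0 v0 n L =
     ((\<Sum>w\<in>verts Gv0. of_int (L w) * Sigma_class Gv0 v0 w) + seifert_framing Gv0 v0 n) / 2"

definition restrict_char :: "'v wgraph \<Rightarrow> ('v \<Rightarrow> int) \<Rightarrow> ('v \<Rightarrow> int)" where
  "restrict_char G L = (\<lambda>w. if w \<in> verts G then L w else 0)"

text \<open>The pairs \<open>(t, i)\<close> realized by some \<open>L\<close> in a given set of characteristic classes.\<close>

definition realized_pairs ::
  "'v wgraph \<Rightarrow> 'v \<Rightarrow> int \<Rightarrow> ('v \<Rightarrow> int) set \<Rightarrow> (('v \<Rightarrow> int) set \<times> rat) set" where
  "realized_pairs Gv0 v0 n s = (let G = delete_vertex Gv0 v0 in
     {(t, i). t \<in> Spinc G \<and> (\<exists>L \<in> s. restrict_char G L \<in> t \<and> A_hat Gv0 v0 n L = i)})"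

definition surgery_pairs :: "'v wgraph \<Rightarrow> 'v \<Rightarrow> int \<Rightarrow> (('v \<Rightarrow> int) set \<times> rat) set" where
  "surgery_pairs Gv0 v0 n = realized_pairs Gv0 v0 n (characteristic (set_weight Gv0 v0 n))"

text \<open>
  The equivalence relation on \<open>A\<close> generated by \<open>(t, i) \<sim> (t + [K], i + r)\<close>, where \<open>sh\<close> is the
  action of \<open>[K]\<close>.
\<close>

definition surgery_rel :: "('t \<times> rat) set \<Rightarrow> rat \<Rightarrow> ('t \<Rightarrow> 't) \<Rightarrow> (('t \<times> rat) \<times> ('t \<times> rat)) set" where
  "surgery_rel A r sh =
     (let R = {((t, i), (sh t, i + r)) | t i. (t, i) \<in> A \<and> (sh t, i + r) \<in> A} in (R \<union> R\<inverse>)\<^sup>*)"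


section \<open>The surgery functor\<close>

datatype side = Side_a | Side_b

type_synonym 't surgery_ob = "'t \<times> rat \<times> side"

datatype 't surgery_mor = Ident "'t surgery_ob" | Lam 't rat | Rho 't rat

definition surgery_cat ::
  "rat \<Rightarrow> ('t \<Rightarrow> 't) \<Rightarrow> ('t \<times> rat) set \<Rightarrow> ('t surgery_ob, 't surgery_mor) cat" where
  "surgery_cat r sh c = \<lparr>
     ob = {(t, i, z). (t, i) \<in> c},
     mor = {Ident (t, i, z) | t i z. (t, i) \<in> c} \<union> {Lam t i | t i. (t, i) \<in> c} \<union>
       {Rho t i | t i. (t, i) \<in> c},
     src = (\<lambda>f. case f of Ident d \<Rightarrow> d | Lam t i \<Rightarrow> (t, i, Side_a) | Rho t i \<Rightarrow> (t, i, Side_a)),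
     tgt = (\<lambda>f. case f of Ident d \<Rightarrow> d | Lam t i \<Rightarrow> (t, i, Side_b) | Rho t i \<Rightarrow> (sh t, i + r, Side_b)),
     ide = Ident,
     cmp = (\<lambda>g f. case f of Ident d \<Rightarrow> g | _ \<Rightarrow> f)\<rparr>"  \<comment> \<open>of two composable morphisms, one is an identity\<close>

definition gr :: "rat \<Rightarrow> rat \<Rightarrow> rat" where
  "gr r i = ((2 * i - r)\<^sup>2 + r) / (4 * r)"

definition XD_ob :: "rat \<Rightarrow> ('t, 'x) coll \<Rightarrow> 't surgery_ob \<Rightarrow> ('x, rat) fsset" where
  "XD_ob r X = (\<lambda>(t, i, z). case z of
     Side_a \<Rightarrow> ht_shift (A_star i (cob X t)) (gr r i)
   | Side_b \<Rightarrow> ht_shift (p1 (cob X t)) (gr r i))"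

text \<open>Since \<open>\<eta>\<^sub>1\<close> and \<open>\<eta>\<^sub>2\<close> are identities on simplices, only the flip map appears.\<close>

definition XD_mor :: "('t, 'x) coll \<Rightarrow> 't surgery_mor \<Rightarrow> nat \<Rightarrow> 'x \<Rightarrow> 'x" where
  "XD_mor X f = (case f of Ident d \<Rightarrow> (\<lambda>n x. x) | Lam t i \<Rightarrow> (\<lambda>n x. x) | Rho t i \<Rightarrow> cflip X t)"

definition XD :: "rat \<Rightarrow> ('t, 'x) coll \<Rightarrow> ('t surgery_ob, 't surgery_mor, 'x, rat) diagram" where
  "XD r X = \<lparr>dob = XD_ob r X, dmor = XD_mor X\<rparr>"

definition XKD ::
  "rat \<Rightarrow> ('t, 'x) coll \<Rightarrow> ('t surgery_ob, 't surgery_mor, 'x, rat \<times> rat) diagram" where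
  "XKD r X = \<lparr>
     dob = (\<lambda>(t, i, z). with_ht
       (\<lambda>n x. (ht (dob (XD r X) (t, i, z)) n x, ht (dob (XD r X) (t, i + 1, z)) n x)) (cob X t)),
     dmor = dmor (XD r X)\<rparr>"

text \<open>The dual knot \<open>\<mu>\<close> acts by \<open>[t, i] + [\<mu>] = [t, i + 1]\<close>.\<close>

definition mu_shift :: "('t \<times> rat) set \<Rightarrow> ('t \<times> rat) set" where
  "mu_shift c = (\<lambda>(t, i). (t, i + 1)) ` c"

definition index_shift :: "'t surgery_mor \<Rightarrow> 't surgery_mor" where
  "index_shift f = (case f of
     Ident (t, i, z) \<Rightarrow> Ident (t, i + 1, z) | Lam t i \<Rightarrow> Lam t (i + 1) | Rho t i \<Rightarrow> Rho t (i + 1))"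

definition XK ::
  "('t \<times> rat) set \<Rightarrow> rat \<Rightarrow> ('t, 'x) coll \<Rightarrow>
   (('t \<times> rat) set, (nat \<times> nat \<Rightarrow> 't surgery_mor) \<times> 'x) coll" where
  "XK A r X = \<lparr>
     cidx = A // surgery_rel A r (cshift X),
     cshift = mu_shift,
     cob = (\<lambda>c. hocolim (surgery_cat r (cshift X) c) (XKD r X)),
     cflip = (\<lambda>c. hocolim_map (surgery_cat r (cshift X) c) index_shift (\<lambda>d n x. x))\<rparr>"


section \<open>The map \<open>hocolim \<Phi>\<close>\<close>

text \<open>
  Throughout, \<open>s\<close> is a \<open>Spin\<^sup>c\<close> structure on \<open>Y\<^bsub>Gv0(n)\<^esub>\<close>, i.e. an orbit in \<open>characteristic (Gv0(n))\<close>; the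
  corresponding class \<open>[t, i]\<close> is \<open>realized_pairs Gv0 v0 n s\<close>.
\<close>

definition I_cat ::
  "'v wgraph \<Rightarrow> 'v \<Rightarrow> int \<Rightarrow> ('v \<Rightarrow> int) set \<Rightarrow>
   (('v \<Rightarrow> int) set surgery_ob, ('v \<Rightarrow> int) set surgery_mor) cat" where
  "I_cat Gv0 v0 n s = surgery_cat (seifert_framing Gv0 v0 n) (cshift (CFK Gv0 v0))
     (realized_pairs Gv0 v0 n s)"

definition TB_cat ::
  "'v wgraph \<Rightarrow> 'v \<Rightarrow> int \<Rightarrow> ('v \<Rightarrow> int) set \<Rightarrow> ('v \<Rightarrow> int) set surgery_ob \<Rightarrow>
   ('v cube, 'v cube \<times> 'v cube) cat" where
  "TB_cat Gv0 v0 n s = (\<lambda>(t, i, z). face_cat (set_weight Gv0 v0 n)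
     {(L, E) \<in> cubes (set_weight Gv0 v0 n) s.
        (v0 \<in> E \<longleftrightarrow> z = Side_a) \<and> restrict_char (delete_vertex Gv0 v0) L \<in> t \<and> A_hat Gv0 v0 n L = i})"

definition TB_cube_map ::
  "'v wgraph \<Rightarrow> 'v \<Rightarrow> int \<Rightarrow> ('v \<Rightarrow> int) set surgery_mor \<Rightarrow> 'v cube \<Rightarrow> 'v cube" where
  "TB_cube_map Gv0 v0 n f = (case f of
     Ident d \<Rightarrow> (\<lambda>c. c)
   | Lam t i \<Rightarrow> (\<lambda>(L, E). (L, E - {v0}))
   | Rho t i \<Rightarrow> (\<lambda>(L, E). (plus_class (set_weight Gv0 v0 n) L (vertex_class v0), E - {v0})))"

definition TB ::
  "'v wgraph \<Rightarrow> 'v \<Rightarrow> int \<Rightarrow> ('v \<Rightarrow> int) set \<Rightarrow>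
   (('v \<Rightarrow> int) set surgery_ob, ('v \<Rightarrow> int) set surgery_mor, 'v cube_cell, rat) diagram" where
  "TB Gv0 v0 n s = \<lparr>
     dob = (\<lambda>d. hocolim (TB_cat Gv0 v0 n s d) (CFD (set_weight Gv0 v0 n))),
     dmor = (\<lambda>f. hocolim_map (TB_cat Gv0 v0 n s (src (I_cat Gv0 v0 n s) f))
       (map_prod (TB_cube_map Gv0 v0 n f) (TB_cube_map Gv0 v0 n f)) (\<lambda>c n x. x))\<rparr>"

text \<open>
  The identification of \<open>hocolim TB\<close> with \<open>CF (Gv0(n)) s\<close>: a chain \<open>d\<^sub>0 \<rightarrow> \<dots> \<rightarrow> d\<^sub>n\<close> of indices
  and a chain \<open>c\<^sub>0 \<rightarrow> \<dots> \<rightarrow> c\<^sub>n\<close> of cubes in the category at \<open>d\<^sub>0\<close> go to the chain of cubes whose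
  \<open>j\<close>-th member is the image of \<open>c\<^sub>j\<close> under \<open>d\<^sub>0 \<rightarrow> d\<^sub>j\<close>.
\<close>

definition TB_hocolim_to_CF ::
  "'v wgraph \<Rightarrow> 'v \<Rightarrow> int \<Rightarrow> nat \<Rightarrow>
   (nat \<times> nat \<Rightarrow> ('v \<Rightarrow> int) set surgery_mor) \<times> 'v cube_cell \<Rightarrow> 'v cube_cell" where
  "TB_hocolim_to_CF Gv0 v0 n m = (\<lambda>(\<sigma>, (\<tau>, x)).
     (let c = (\<lambda>j. TB_cube_map Gv0 v0 n (\<sigma> (0, j)) (fst (\<tau> (j, j)))) in
      ((\<lambda>(j, k)\<in>tri m. (c j, c k)), x)))"

text \<open>On the cubes at \<open>(t, i, b)\<close>, where \<open>v0 \<notin> E\<close>, removing \<open>v0\<close> has no effect.\<close>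

definition Phi_cube_map :: "'v wgraph \<Rightarrow> 'v \<Rightarrow> 'v cube \<Rightarrow> 'v cube" where
  "Phi_cube_map Gv0 v0 = (\<lambda>(L, E). (restrict_char (delete_vertex Gv0 v0) L, E - {v0}))"

definition Phi ::
  "'v wgraph \<Rightarrow> 'v \<Rightarrow> int \<Rightarrow> ('v \<Rightarrow> int) set \<Rightarrow> ('v \<Rightarrow> int) set surgery_ob \<Rightarrow>
   nat \<Rightarrow> 'v cube_cell \<Rightarrow> 'v cube_cell" where
  "Phi Gv0 v0 n s d = hocolim_map (TB_cat Gv0 v0 n s d)
     (map_prod (Phi_cube_map Gv0 v0) (Phi_cube_map Gv0 v0)) (\<lambda>c m x. x)"

definition hocolim_Phi ::
  "'v wgraph \<Rightarrow> 'v \<Rightarrow> int \<Rightarrow> ('v \<Rightarrow> int) set \<Rightarrow> nat \<Rightarrow> 'v cube_cell \<Rightarrow>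
   (nat \<times> nat \<Rightarrow> ('v \<Rightarrow> int) set surgery_mor) \<times> 'v cube_cell" where
  "hocolim_Phi Gv0 v0 n s m y =
     hocolim_map (I_cat Gv0 v0 n s) id (Phi Gv0 v0 n s) m
       (inv_into (cells (hocolim (I_cat Gv0 v0 n s) (TB Gv0 v0 n s)) m)
          (TB_hocolim_to_CF Gv0 v0 n m) y)"

end

theory Submission
  imports Defs
begin

text \<open>
  The cubes \<open>[L, E]\<close> of \<open>Gv0(n)\<close> fall into classes according to the restriction of \<open>L\<close> to \<open>G\<close>, the number
  \<open>A_hat L\<close> and whether \<open>v0 \<in> E\<close>. Passing to a face can only remove \<open>v0\<close> from \<open>E\<close>, and then \<open>A_hat\<close>
  either stays the same or changes by \<open>r < 0\<close>; so a chain of cubes is the same thing as a chain in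
  the surgery category together with a chain of cubes in the class of its first object. This makes
  \<open>CF (Gv0(n))\<close> the homotopy colimit of \<open>TB\<close>.

  Since \<open>\<Sigma>\<close> is orthogonal to the vertices of \<open>G\<close>, the square of \<open>L\<close> is that of its restriction plus
  \<open>(2 A_hat L - r)\<^sup>2 / r\<close>, which turns the heights of cubes into those of the surgery diagram. Adding
  the class of \<open>u0\<close> to \<open>L\<close> leaves the restriction unchanged and raises \<open>A_hat L\<close> by one, so the second
  heights and the flip maps correspond to the shift of the index by one.
\<close>

section \<open>Filtered simplicial sets and homotopy colimits\<close>

text \<open>The homotopy colimit of a diagram of nerves is in general only weakly equivalent to the
  nerve of the total category. Here it is isomorphic to it: both kinds of moves between classes of
  cubes, deleting \<open>v0\<close> from \<open>E\<close> and doing so after adding the class of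
  \<open>v0\<close> to \<open>L\<close>, are bijections that preserve and reflect faces. A chain of
  cubes can therefore be transported back, in exactly one way, into the class of its first member.
  Since \<open>r \<noteq> 0\<close>, a face that loses \<open>v0\<close> tells through
  \<open>A_hat\<close> which of the two moves is involved. The obstacle is that
  \<open>hocolim_Phi\<close> is defined by inverting this identification with
  \<open>inv_into\<close>. So every cell is written as the image of a cell of the homotopy colimit
  of \<open>TB\<close>, all assertions are checked there, and the flip map is lifted there too.
  Heights cause no trouble in this passage: a cell has the height of its first cube, and the first
  cube is never moved.\<close>

lemma with_ht_simps [simp]:
  "cells (with_ht h X) = cells X" "act (with_ht h X) = act X" "ht (with_ht h X) = h"
  by (simp_all add: with_ht_def)

lemma filtered_ssetI:
  assumes "\<And>m n \<theta> x. \<theta> \<in> simplex_arrows m n \<Longrightarrow> x \<in> cells X n \<Longrightarrow> act X m n \<theta> x \<in> cells X m"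
    and "\<And>m n \<theta> x. \<theta> \<in> simplex_arrows m n \<Longrightarrow> x \<in> cells X n \<Longrightarrow> ht X n x \<le> ht X m (act X m n \<theta> x)"
    and "\<And>n x. x \<in> cells X n \<Longrightarrow> act X n n (\<lambda>j\<in>{..n}. j) x = x"
    and "\<And>l m n \<phi> \<theta> x. \<phi> \<in> simplex_arrows l m \<Longrightarrow> \<theta> \<in> simplex_arrows m n \<Longrightarrow> x \<in> cells X n \<Longrightarrow>
        act X l n (compose {..l} \<theta> \<phi>) x = act X l m \<phi> (act X m n \<theta> x)"
  shows "filtered_sset X"
  using assms unfolding filtered_sset_def by blast

lemma filtered_ssetD:
  assumes "filtered_sset X"
  shows "\<And>m n \<theta> x. \<theta> \<in> simplex_arrows m n \<Longrightarrow> x \<in> cells X n \<Longrightarrow> act X m n \<theta> x \<in> cells X m"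
    and "\<And>m n \<theta> x. \<theta> \<in> simplex_arrows m n \<Longrightarrow> x \<in> cells X n \<Longrightarrow> ht X n x \<le> ht X m (act X m n \<theta> x)"
    and "\<And>n x. x \<in> cells X n \<Longrightarrow> act X n n (\<lambda>j\<in>{..n}. j) x = x"
    and "\<And>l m n \<phi> \<theta> x. \<phi> \<in> simplex_arrows l m \<Longrightarrow> \<theta> \<in> simplex_arrows m n \<Longrightarrow> x \<in> cells X n \<Longrightarrow>
        act X l n (compose {..l} \<theta> \<phi>) x = act X l m \<phi> (act X m n \<theta> x)"
  using assms unfolding filtered_sset_def by blast+

lemma filtered_mapI:
  assumes "\<And>n x. x \<in> cells X n \<Longrightarrow> f n x \<in> cells Y n"
    and "\<And>n x. x \<in> cells X n \<Longrightarrow> ht X n x \<le> ht Y n (f n x)"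
    and "\<And>m n \<theta> x. \<theta> \<in> simplex_arrows m n \<Longrightarrow> x \<in> cells X n \<Longrightarrow>
        f m (act X m n \<theta> x) = act Y m n \<theta> (f n x)"
  shows "filtered_map X Y f"
  using assms unfolding filtered_map_def by blast

lemma filtered_mapD:
  assumes "filtered_map X Y f"
  shows "\<And>n x. x \<in> cells X n \<Longrightarrow> f n x \<in> cells Y n"
    and "\<And>n x. x \<in> cells X n \<Longrightarrow> ht X n x \<le> ht Y n (f n x)"
    and "\<And>m n \<theta> x. \<theta> \<in> simplex_arrows m n \<Longrightarrow> x \<in> cells X n \<Longrightarrow>
        f m (act X m n \<theta> x) = act Y m n \<theta> (f n x)"
  using assms unfolding filtered_map_def by blast+

text \<open>The inverse of a filtered bijection may lower heights; equality of heights is what makes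
  it filtered. Its naturality follows from that of \<open>f\<close> by cancelling
  \<open>f\<close>.\<close>

lemma filtered_isoI:
  assumes X: "filtered_sset X" and Y: "filtered_sset Y"
    and bij: "\<And>n. bij_betw (f n) (cells X n) (cells Y n)"
    and ht: "\<And>n x. x \<in> cells X n \<Longrightarrow> ht Y n (f n x) = ht X n x"
    and act: "\<And>m n \<theta> x. \<theta> \<in> simplex_arrows m n \<Longrightarrow> x \<in> cells X n \<Longrightarrow>
        f m (act X m n \<theta> x) = act Y m n \<theta> (f n x)"
  shows "filtered_iso X Y f"
proof -
  define g where "g n = inv_into (cells X n) (f n)" for n
  have f_in: "f n x \<in> cells Y n" if "x \<in> cells X n" for n x
    using bij_betwE[OF bij] that by blast
  have g_in: "g n y \<in> cells X n" if "y \<in> cells Y n" for n y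
    using bij_betwE[OF bij_betw_inv_into[OF bij]] that by (simp add: g_def)
  have fg: "f n (g n y) = y" if "y \<in> cells Y n" for n y
    using bij_betw_inv_into_right[OF bij that] by (simp add: g_def)
  have gf: "g n (f n x) = x" if "x \<in> cells X n" for n x
    using bij_betw_inv_into_left[OF bij that] by (simp add: g_def)
  have "filtered_map X Y f"
    by (intro filtered_mapI) (simp_all add: f_in ht act)
  moreover have "filtered_map Y X g"
  proof (intro filtered_mapI)
    fix m n \<theta> y assume \<theta>: "\<theta> \<in> simplex_arrows m n" and y: "y \<in> cells Y n"
    have "g m (act Y m n \<theta> y) = g m (f m (act X m n \<theta> (g n y)))"
      using act[OF \<theta> g_in[OF y]] fg[OF y] by simp
    then show "g m (act Y m n \<theta> y) = act X m n \<theta> (g n y)"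
      using gf filtered_ssetD(1)[OF X \<theta> g_in[OF y]] by simp
  next
    show "ht Y n y \<le> ht X n (g n y)" if "y \<in> cells Y n" for n y
      using ht[OF g_in[OF that]] fg[OF that] by simp
  qed (rule g_in)
  ultimately show ?thesis
    unfolding filtered_iso_def using X Y gf fg by blast
qed

lemma simplex_arrowsD:
  assumes "\<theta> \<in> simplex_arrows m n" "j \<le> k" "k \<le> m"
  shows "\<theta> j \<le> \<theta> k" "\<theta> k \<le> n"
proof -
  have "mono_on {..m} \<theta>" "\<theta> \<in> {..m} \<rightarrow> {..n}"
    using assms(1) by (auto simp: simplex_arrows_def)
  then show "\<theta> j \<le> \<theta> k" "\<theta> k \<le> n"
    using assms(2,3) by (auto simp: Pi_def intro: mono_onD)
qed

lemma mem_tri [simp]: "(j, k) \<in> tri n \<longleftrightarrow> j \<le> k \<and> k \<le> n"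
  by (simp add: tri_def)

text \<open>The degenerate triples \<open>j k k\<close> and \<open>j j k\<close> of the composition
  clause say that the arrow over \<open>j \<le> k\<close> ends at object \<open>k\<close> and starts
  at object \<open>j\<close>.\<close>

lemma nerveD:
  assumes "\<sigma> \<in> nerve C n" and jk: "j \<le> k" "k \<le> n"
  shows "\<sigma> (j, k) \<in> mor C"
    and "\<sigma> (j, j) \<in> ide C ` ob C"
    and "src C (\<sigma> (j, k)) = src C (\<sigma> (j, j))"
    and "tgt C (\<sigma> (j, k)) = src C (\<sigma> (k, k))"
    and "\<And>l. k \<le> l \<Longrightarrow> l \<le> n \<Longrightarrow> \<sigma> (j, l) = cmp C (\<sigma> (k, l)) (\<sigma> (j, k))"
    and "\<And>l. k \<le> l \<Longrightarrow> l \<le> n \<Longrightarrow> tgt C (\<sigma> (j, k)) = src C (\<sigma> (k, l))"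
proof -
  have D: "\<forall>p \<in> tri n. \<sigma> p \<in> mor C" "\<forall>j \<le> n. \<sigma> (j, j) \<in> ide C ` ob C"
    "\<And>j k l. j \<le> k \<and> k \<le> l \<and> l \<le> n \<longrightarrow>
        tgt C (\<sigma> (j, k)) = src C (\<sigma> (k, l)) \<and> \<sigma> (j, l) = cmp C (\<sigma> (k, l)) (\<sigma> (j, k))"
    using assms(1) unfolding nerve_def by blast+
  show "\<sigma> (j, k) \<in> mor C" using D(1) jk by simp
  show "\<sigma> (j, j) \<in> ide C ` ob C" using D(2) jk by simp
  show "tgt C (\<sigma> (j, k)) = src C (\<sigma> (k, k))" using D(3)[of j k k] jk by simp
  show "src C (\<sigma> (j, k)) = src C (\<sigma> (j, j))" using D(3)[of j j k] D(3)[of j j j] jk by simp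
  show "\<sigma> (j, l) = cmp C (\<sigma> (k, l)) (\<sigma> (j, k))" "tgt C (\<sigma> (j, k)) = src C (\<sigma> (k, l))"
    if "k \<le> l" "l \<le> n" for l
    using D(3)[of j k l] jk that by simp_all
qed

lemma nerve_extensional: "\<sigma> \<in> nerve C n \<Longrightarrow> \<sigma> \<in> extensional (tri n)"
  by (simp add: nerve_def)

lemma nerve_restrict: "\<sigma> \<in> nerve C n \<Longrightarrow> (\<lambda>p\<in>tri n. \<sigma> p) = \<sigma>"
  by (simp add: extensional_restrict nerve_extensional)

lemma nerve_pullback:
  assumes "\<sigma> \<in> nerve C n" "\<theta> \<in> simplex_arrows m n"
  shows "(\<lambda>(j, k)\<in>tri m. \<sigma> (\<theta> j, \<theta> k)) \<in> nerve C m"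
  unfolding nerve_def mem_Collect_eq
proof (intro conjI ballI allI impI)
  show "(\<lambda>(j, k)\<in>tri m. \<sigma> (\<theta> j, \<theta> k)) p \<in> mor C" if "p \<in> tri m" for p
    using that nerveD(1)[OF assms(1)] simplex_arrowsD[OF assms(2)]
    by (cases p) (auto)
  show "(\<lambda>(j, k)\<in>tri m. \<sigma> (\<theta> j, \<theta> k)) (j, j) \<in> ide C ` ob C" if "j \<le> m" for j
    using that nerveD(2)[OF assms(1) order_refl, of "\<theta> j"] simplex_arrowsD[OF assms(2), of j j]
    by simp
  fix j k l assume jkl: "j \<le> k \<and> k \<le> l \<and> l \<le> m"
  then have "\<theta> j \<le> \<theta> k" "\<theta> k \<le> \<theta> l" "\<theta> l \<le> n"
    using simplex_arrowsD[OF assms(2)] by auto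
  then show "tgt C ((\<lambda>(j, k)\<in>tri m. \<sigma> (\<theta> j, \<theta> k)) (j, k)) =
        src C ((\<lambda>(j, k)\<in>tri m. \<sigma> (\<theta> j, \<theta> k)) (k, l))"
    "(\<lambda>(j, k)\<in>tri m. \<sigma> (\<theta> j, \<theta> k)) (j, l) =
      cmp C ((\<lambda>(j, k)\<in>tri m. \<sigma> (\<theta> j, \<theta> k)) (k, l)) ((\<lambda>(j, k)\<in>tri m. \<sigma> (\<theta> j, \<theta> k)) (j, k))"
    using jkl nerveD(5,6)[OF assms(1), of "\<theta> j" "\<theta> k" "\<theta> l"] by auto
qed simp

text \<open>The functor laws are asked on cells only, as \<open>dmor\<close> is a total function.
  For instance, identity arrows act in \<open>TB\<close> by restriction to \<open>tri n\<close>,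
  which fixes a chain because chains are extensional.\<close>

definition filtered_diagram :: "('o, 'm) cat \<Rightarrow> ('o, 'm, 'x, 'h::order) diagram \<Rightarrow> bool" where
  "filtered_diagram C F \<longleftrightarrow>
     (\<forall>d \<in> ob C. filtered_sset (dob F d) \<and> src C (ide C d) = d \<and>
        (\<forall>n. \<forall>x \<in> cells (dob F d) n. dmor F (ide C d) n x = x)) \<and>
     (\<forall>f \<in> mor C. src C f \<in> ob C \<and> tgt C f \<in> ob C \<and>
        filtered_map (dob F (src C f)) (dob F (tgt C f)) (dmor F f)) \<and>
     (\<forall>f \<in> mor C. \<forall>g \<in> mor C. tgt C f = src C g \<longrightarrow>
        (\<forall>n. \<forall>x \<in> cells (dob F (src C f)) n. dmor F (cmp C g f) n x = dmor F g n (dmor F f n x)))"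

lemma filtered_diagramD:
  assumes "filtered_diagram C F"
  shows "\<And>d. d \<in> ob C \<Longrightarrow> filtered_sset (dob F d)"
    and "\<And>d. d \<in> ob C \<Longrightarrow> src C (ide C d) = d"
    and "\<And>d n x. d \<in> ob C \<Longrightarrow> x \<in> cells (dob F d) n \<Longrightarrow> dmor F (ide C d) n x = x"
    and "\<And>f. f \<in> mor C \<Longrightarrow> src C f \<in> ob C"
    and "\<And>f. f \<in> mor C \<Longrightarrow> tgt C f \<in> ob C"
    and "\<And>f. f \<in> mor C \<Longrightarrow> filtered_map (dob F (src C f)) (dob F (tgt C f)) (dmor F f)"
    and "\<And>f g n x. f \<in> mor C \<Longrightarrow> g \<in> mor C \<Longrightarrow> tgt C f = src C g \<Longrightarrow>
        x \<in> cells (dob F (src C f)) n \<Longrightarrow> dmor F (cmp C g f) n x = dmor F g n (dmor F f n x)"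
  using assms unfolding filtered_diagram_def by blast+

lemma cells_hocolim:
  "(\<sigma>, x) \<in> cells (hocolim C F) n \<longleftrightarrow> \<sigma> \<in> nerve C n \<and> x \<in> cells (dob F (src C (\<sigma> (0, 0)))) n"
  by (simp add: hocolim_def)

lemma act_hocolim:
  "act (hocolim C F) m n \<theta> (\<sigma>, x) = (\<lambda>(j, k)\<in>tri m. \<sigma> (\<theta> j, \<theta> k),
     dmor F (\<sigma> (0, \<theta> 0)) m (act (dob F (src C (\<sigma> (0, 0)))) m n \<theta> x))"
  by (simp add: hocolim_def)

lemma ht_hocolim: "ht (hocolim C F) n (\<sigma>, x) = ht (dob F (src C (\<sigma> (0, 0)))) n x"
  by (simp add: hocolim_def)

lemma hocolim_map_apply:
  "hocolim_map C T g n (\<sigma>, x) = (\<lambda>p\<in>tri n. T (\<sigma> p), g (src C (\<sigma> (0, 0))) n x)"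
  by (simp add: hocolim_map_def)

text \<open>An operator acts in the fibre of the old first object and then transports along
  \<open>\<sigma> (0, \<theta> 0)\<close>. Compatibility with composites rests on two facts: the
  transport is natural for the second operator, and \<open>\<sigma> (0, \<theta> (\<phi> 0))\<close>
  factors through object number \<open>\<theta> 0\<close>.\<close>

lemma filtered_sset_hocolim:
  assumes F: "filtered_diagram C F"
  shows "filtered_sset (hocolim C F)"
proof (rule filtered_ssetI)
  fix m n \<theta> y assume \<theta>: "\<theta> \<in> simplex_arrows m n" and y: "y \<in> cells (hocolim C F) n"
  obtain \<sigma> x where y_eq: "y = (\<sigma>, x)" by fastforce
  with y have \<sigma>: "\<sigma> \<in> nerve C n" and x: "x \<in> cells (dob F (src C (\<sigma> (0, 0)))) n"
    by (auto simp: cells_hocolim)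
  have le: "\<theta> 0 \<le> n" using simplex_arrowsD[OF \<theta>, of 0 0] by simp
  note N = nerveD(1-4)[OF \<sigma> le0 le]
  have F0: "filtered_sset (dob F (src C (\<sigma> (0, 0))))"
    using filtered_diagramD(1,4)[OF F] N by metis
  have map: "filtered_map (dob F (src C (\<sigma> (0, 0)))) (dob F (src C (\<sigma> (\<theta> 0, \<theta> 0)))) (dmor F (\<sigma> (0, \<theta> 0)))"
    using filtered_diagramD(6)[OF F N(1)] N by simp
  note ax = filtered_ssetD(1,2)[OF F0 \<theta> x]
  show "act (hocolim C F) m n \<theta> y \<in> cells (hocolim C F) m"
    using nerve_pullback[OF \<sigma> \<theta>] filtered_mapD(1)[OF map ax(1)]
    by (simp add: y_eq act_hocolim cells_hocolim)
  show "ht (hocolim C F) n y \<le> ht (hocolim C F) m (act (hocolim C F) m n \<theta> y)"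
    using filtered_mapD(2)[OF map ax(1)] ax(2)
    by (simp add: y_eq act_hocolim ht_hocolim)
next
  fix n y assume y: "y \<in> cells (hocolim C F) n"
  obtain \<sigma> x where y_eq: "y = (\<sigma>, x)" by fastforce
  with y have \<sigma>: "\<sigma> \<in> nerve C n" and x: "x \<in> cells (dob F (src C (\<sigma> (0, 0)))) n"
    by (auto simp: cells_hocolim)
  obtain d where d: "d \<in> ob C" "\<sigma> (0, 0) = ide C d"
    using nerveD(2)[OF \<sigma>, of 0 0] by auto
  have "(\<lambda>(j, k)\<in>tri n. \<sigma> ((\<lambda>j\<in>{..n}. j) j, (\<lambda>j\<in>{..n}. j) k)) = \<sigma>"
    using nerve_extensional[OF \<sigma>] by (intro ext) (auto simp: extensional_def restrict_def)
  moreover have "dmor F (\<sigma> (0, 0)) n x = x"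
    using filtered_diagramD(2,3)[OF F d(1)] x d(2) by simp
  ultimately show "act (hocolim C F) n n (\<lambda>j\<in>{..n}. j) y = y"
    using filtered_ssetD(3)[OF filtered_diagramD(1)[OF F d(1)], of x n] x d
      filtered_diagramD(2)[OF F d(1)]
    by (simp add: y_eq act_hocolim)
next
  fix l m n \<phi> \<theta> y
  assume \<phi>: "\<phi> \<in> simplex_arrows l m" and \<theta>: "\<theta> \<in> simplex_arrows m n"
    and y: "y \<in> cells (hocolim C F) n"
  obtain \<sigma> x where y_eq: "y = (\<sigma>, x)" by fastforce
  with y have \<sigma>: "\<sigma> \<in> nerve C n" and x: "x \<in> cells (dob F (src C (\<sigma> (0, 0)))) n"
    by (auto simp: cells_hocolim)
  have \<phi>0: "\<phi> 0 \<le> m" using simplex_arrowsD[OF \<phi>, of 0 0] by simp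
  have le: "\<theta> 0 \<le> \<theta> (\<phi> 0)" "\<theta> (\<phi> 0) \<le> n" "\<theta> 0 \<le> n"
    using simplex_arrowsD[OF \<theta>, of 0 "\<phi> 0"] \<phi>0 by auto
  have F0: "filtered_sset (dob F (src C (\<sigma> (0, 0))))"
    using filtered_diagramD(1,4)[OF F] nerveD(1)[OF \<sigma>, of 0 0] by simp
  note N1 = nerveD(1-4)[OF \<sigma> le0 le(3)] and N2 = nerveD(1-4)[OF \<sigma> le(1,2)]
  have map: "filtered_map (dob F (src C (\<sigma> (0, 0)))) (dob F (src C (\<sigma> (\<theta> 0, \<theta> 0)))) (dmor F (\<sigma> (0, \<theta> 0)))"
    using filtered_diagramD(6)[OF F N1(1)] N1 by simp
  note x1 = filtered_ssetD(1)[OF F0 \<theta> x]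
  note x2 = filtered_ssetD(1)[OF F0 \<phi> x1]
  have nat: "act (dob F (src C (\<sigma> (\<theta> 0, \<theta> 0)))) l m \<phi>
        (dmor F (\<sigma> (0, \<theta> 0)) m (act (dob F (src C (\<sigma> (0, 0)))) m n \<theta> x)) =
      dmor F (\<sigma> (0, \<theta> 0)) l (act (dob F (src C (\<sigma> (0, 0)))) l m \<phi> (act (dob F (src C (\<sigma> (0, 0)))) m n \<theta> x))"
    using filtered_mapD(3)[OF map \<phi> x1] by simp
  have comp: "dmor F (\<sigma> (0, \<theta> (\<phi> 0))) l z = dmor F (\<sigma> (\<theta> 0, \<theta> (\<phi> 0))) l (dmor F (\<sigma> (0, \<theta> 0)) l z)"
    if "z \<in> cells (dob F (src C (\<sigma> (0, 0)))) l" for z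
    using filtered_diagramD(7)[OF F N1(1) N2(1), of z l] that N1 N2
      nerveD(5)[OF \<sigma> le0 le(3,1,2)] by simp
  have "(\<lambda>(j, k)\<in>tri l. \<sigma> (compose {..l} \<theta> \<phi> j, compose {..l} \<theta> \<phi> k)) =
      (\<lambda>(j, k)\<in>tri l. (\<lambda>(j, k)\<in>tri m. \<sigma> (\<theta> j, \<theta> k)) (\<phi> j, \<phi> k))"
    using simplex_arrowsD[OF \<phi>] by (intro ext) (auto simp: restrict_def compose_def)
  then show "act (hocolim C F) l n (compose {..l} \<theta> \<phi>) y =
      act (hocolim C F) l m \<phi> (act (hocolim C F) m n \<theta> y)"
    using \<phi>0 filtered_ssetD(4)[OF F0 \<phi> \<theta> x] nat comp[OF x2]
    by (simp add: y_eq act_hocolim) (simp add: compose_def)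
qed

section \<open>Maps and bijections between homotopy colimits\<close>

definition functor_on ::
  "('o, 'm) cat \<Rightarrow> ('o2, 'm2) cat \<Rightarrow> ('o \<Rightarrow> 'o2) \<Rightarrow> ('m \<Rightarrow> 'm2) \<Rightarrow> bool" where
  "functor_on C D S T \<longleftrightarrow>
     (\<forall>d \<in> ob C. S d \<in> ob D \<and> T (ide C d) = ide D (S d)) \<and>
     (\<forall>f \<in> mor C. T f \<in> mor D \<and> src D (T f) = S (src C f) \<and> tgt D (T f) = S (tgt C f)) \<and>
     (\<forall>f \<in> mor C. \<forall>g \<in> mor C. tgt C f = src C g \<longrightarrow> T (cmp C g f) = cmp D (T g) (T f))"

lemma functor_onD:
  assumes "functor_on C D S T"
  shows "\<And>d. d \<in> ob C \<Longrightarrow> S d \<in> ob D"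
    and "\<And>d. d \<in> ob C \<Longrightarrow> T (ide C d) = ide D (S d)"
    and "\<And>f. f \<in> mor C \<Longrightarrow> T f \<in> mor D"
    and "\<And>f. f \<in> mor C \<Longrightarrow> src D (T f) = S (src C f)"
    and "\<And>f. f \<in> mor C \<Longrightarrow> tgt D (T f) = S (tgt C f)"
    and "\<And>f g. f \<in> mor C \<Longrightarrow> g \<in> mor C \<Longrightarrow> tgt C f = src C g \<Longrightarrow> T (cmp C g f) = cmp D (T g) (T f)"
  using assms unfolding functor_on_def by blast+

lemma functor_on_id: "functor_on C C id id"
  by (simp add: functor_on_def)

lemma functor_on_nerve:
  assumes T: "functor_on C D S T" and \<sigma>: "\<sigma> \<in> nerve C n"
  shows "(\<lambda>p\<in>tri n. T (\<sigma> p)) \<in> nerve D n"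
  unfolding nerve_def mem_Collect_eq
proof (intro conjI ballI allI impI)
  show "(\<lambda>p\<in>tri n. T (\<sigma> p)) p \<in> mor D" if "p \<in> tri n" for p
    using that nerveD(1)[OF \<sigma>] functor_onD(3)[OF T] by (cases p) auto
  show "(\<lambda>p\<in>tri n. T (\<sigma> p)) (j, j) \<in> ide D ` ob D" if "j \<le> n" for j
    using that nerveD(2)[OF \<sigma>, of j j] functor_onD(1,2)[OF T] by auto
  fix j k l assume jkl: "j \<le> k \<and> k \<le> l \<and> l \<le> n"
  then have m: "\<sigma> (j, k) \<in> mor C" "\<sigma> (k, l) \<in> mor C" "tgt C (\<sigma> (j, k)) = src C (\<sigma> (k, l))"
      "\<sigma> (j, l) = cmp C (\<sigma> (k, l)) (\<sigma> (j, k))"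
    using nerveD(1)[OF \<sigma>, of j k] nerveD(5,6)[OF \<sigma>, of j k l] nerveD(1)[OF \<sigma>, of k l] jkl
      order_trans[of k l n] by blast+
  then show "tgt D ((\<lambda>p\<in>tri n. T (\<sigma> p)) (j, k)) = src D ((\<lambda>p\<in>tri n. T (\<sigma> p)) (k, l))"
      "(\<lambda>p\<in>tri n. T (\<sigma> p)) (j, l) = cmp D ((\<lambda>p\<in>tri n. T (\<sigma> p)) (k, l)) ((\<lambda>p\<in>tri n. T (\<sigma> p)) (j, k))"
    using jkl functor_onD[OF T] by auto
qed simp

text \<open>Stated without heights, for maps such as the lift of the flip map to \<open>TB\<close>,
  which need not respect the single height there.\<close>

lemma cells_hocolim_map:
  assumes T: "functor_on C D S T"
    and F: "filtered_diagram C F"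
    and g: "\<And>d x. d \<in> ob C \<Longrightarrow> x \<in> cells (dob F d) n \<Longrightarrow> g d n x \<in> cells (dob F' (S d)) n"
    and y: "y \<in> cells (hocolim C F) n"
  shows "hocolim_map C T g n y \<in> cells (hocolim D F') n"
proof -
  obtain \<sigma> x where y_eq: "y = (\<sigma>, x)" by fastforce
  with y have \<sigma>: "\<sigma> \<in> nerve C n" and x: "x \<in> cells (dob F (src C (\<sigma> (0, 0)))) n"
    by (auto simp: cells_hocolim)
  have m: "\<sigma> (0, 0) \<in> mor C" using nerveD(1)[OF \<sigma>] by simp
  show ?thesis
    using functor_on_nerve[OF T \<sigma>] g[OF filtered_diagramD(4)[OF F m] x] functor_onD(4)[OF T m]
    by (simp add: y_eq hocolim_map_def cells_hocolim)
qed

lemma filtered_map_hocolim: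
  assumes T: "functor_on C D S T"
    and F: "filtered_diagram C F"
    and g: "\<And>d. d \<in> ob C \<Longrightarrow> filtered_map (dob F d) (dob F' (S d)) (g d)"
    and nat: "\<And>f n x. f \<in> mor C \<Longrightarrow> x \<in> cells (dob F (src C f)) n \<Longrightarrow>
        dmor F' (T f) n (g (src C f) n x) = g (tgt C f) n (dmor F f n x)"
  shows "filtered_map (hocolim C F) (hocolim D F') (hocolim_map C T g)"
proof (rule filtered_mapI)
  show "hocolim_map C T g n y \<in> cells (hocolim D F') n" if "y \<in> cells (hocolim C F) n" for n y
    using cells_hocolim_map[OF T F _ that] filtered_mapD(1)[OF g] by blast
next
  fix n y assume y: "y \<in> cells (hocolim C F) n"
  obtain \<sigma> x where y_eq: "y = (\<sigma>, x)" by fastforce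
  with y have \<sigma>: "\<sigma> \<in> nerve C n" and x: "x \<in> cells (dob F (src C (\<sigma> (0, 0)))) n"
    by (auto simp: cells_hocolim)
  have m: "\<sigma> (0, 0) \<in> mor C" using nerveD(1)[OF \<sigma>] by simp
  show "ht (hocolim C F) n y \<le> ht (hocolim D F') n (hocolim_map C T g n y)"
    using filtered_mapD(2)[OF g[OF filtered_diagramD(4)[OF F m]] x] functor_onD(4)[OF T m]
    by (simp add: y_eq hocolim_map_def ht_hocolim)
next
  fix m n \<theta> y assume \<theta>: "\<theta> \<in> simplex_arrows m n" and y: "y \<in> cells (hocolim C F) n"
  obtain \<sigma> x where y_eq: "y = (\<sigma>, x)" by fastforce
  with y have \<sigma>: "\<sigma> \<in> nerve C n" and x: "x \<in> cells (dob F (src C (\<sigma> (0, 0)))) n"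
    by (auto simp: cells_hocolim)
  have le: "\<theta> 0 \<le> n" using simplex_arrowsD[OF \<theta>, of 0 0] by simp
  note N = nerveD(1-4)[OF \<sigma> le0 le]
  have m0: "\<sigma> (0, 0) \<in> mor C" using nerveD(1)[OF \<sigma>] by simp
  note d0 = filtered_diagramD(4)[OF F m0]
  note ax = filtered_ssetD(1)[OF filtered_diagramD(1)[OF F d0] \<theta> x]
  have nat': "dmor F' (T (\<sigma> (0, \<theta> 0))) m (g (src C (\<sigma> (0, 0))) m (act (dob F (src C (\<sigma> (0, 0)))) m n \<theta> x)) =
      g (src C (\<sigma> (\<theta> 0, \<theta> 0))) m (dmor F (\<sigma> (0, \<theta> 0)) m (act (dob F (src C (\<sigma> (0, 0)))) m n \<theta> x))"
    using nat[OF N(1)] ax N(3,4) by simp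
  have "(\<lambda>p\<in>tri m. T ((\<lambda>(j, k)\<in>tri m. \<sigma> (\<theta> j, \<theta> k)) p)) =
      (\<lambda>(j, k)\<in>tri m. (\<lambda>p\<in>tri n. T (\<sigma> p)) (\<theta> j, \<theta> k))"
    using simplex_arrowsD[OF \<theta>] by (intro ext) (auto simp: restrict_def)
  then show "hocolim_map C T g m (act (hocolim C F) m n \<theta> y) =
      act (hocolim D F') m n \<theta> (hocolim_map C T g n y)"
    using le nat' filtered_mapD(3)[OF g[OF d0] \<theta> x] functor_onD(4)[OF T m0]
    by (simp add: y_eq hocolim_map_def act_hocolim)
qed

text \<open>The chain is recovered by \<open>T'\<close>, and its first object then selects the fibre
  in which \<open>g\<close> is inverted.\<close>

lemma bij_betw_hocolim_map:
  assumes T: "functor_on C D S T" and T': "functor_on D C S' T'"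
    and inv: "\<And>f. f \<in> mor C \<Longrightarrow> T' (T f) = f" "\<And>f. f \<in> mor D \<Longrightarrow> T (T' f) = f"
    and ob: "\<And>f. f \<in> mor C \<Longrightarrow> src C f \<in> ob C"
    and g: "\<And>d. d \<in> ob C \<Longrightarrow> bij_betw (g d n) (cells (dob F d) n) (cells (dob F' (S d)) n)"
  shows "bij_betw (hocolim_map C T g n) (cells (hocolim C F) n) (cells (hocolim D F') n)"
proof -
  have TT: "(\<lambda>p\<in>tri n. T' ((\<lambda>p\<in>tri n. T (\<sigma> p)) p)) = \<sigma>" if "\<sigma> \<in> nerve C n" for \<sigma>
    using nerveD(1)[OF that] inv(1)
    by (intro extensionalityI[of _ "tri n"] nerve_extensional[OF that]) auto
  have TT': "(\<lambda>p\<in>tri n. T ((\<lambda>p\<in>tri n. T' (\<sigma> p)) p)) = \<sigma>" if "\<sigma> \<in> nerve D n" for \<sigma>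
    using nerveD(1)[OF that] inv(2)
    by (intro extensionalityI[of _ "tri n"] nerve_extensional[OF that]) auto
  show ?thesis
    unfolding bij_betw_def
  proof (intro conjI inj_onI equalityI subsetI)
    fix y z assume y: "y \<in> cells (hocolim C F) n" and z: "z \<in> cells (hocolim C F) n"
      and eq: "hocolim_map C T g n y = hocolim_map C T g n z"
    obtain \<sigma> x \<tau> w where yz: "y = (\<sigma>, x)" "z = (\<tau>, w)" by fastforce
    with y z have \<sigma>: "\<sigma> \<in> nerve C n" "x \<in> cells (dob F (src C (\<sigma> (0, 0)))) n"
      and \<tau>: "\<tau> \<in> nerve C n" "w \<in> cells (dob F (src C (\<tau> (0, 0)))) n"
      by (auto simp: cells_hocolim)
    have st: "\<sigma> = \<tau>"
      using eq TT[OF \<sigma>(1)] TT[OF \<tau>(1)] by (simp add: yz hocolim_map_def)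
    have "src C (\<tau> (0, 0)) \<in> ob C" using ob nerveD(1)[OF \<tau>(1)] by simp
    then show "y = z"
      using eq st \<sigma>(2) \<tau>(2) g unfolding bij_betw_def inj_on_def
      by (auto simp add: yz hocolim_map_def)
  next
    fix z assume "z \<in> hocolim_map C T g n ` cells (hocolim C F) n"
    then obtain \<sigma> x where z: "z = hocolim_map C T g n (\<sigma>, x)"
      and \<sigma>: "\<sigma> \<in> nerve C n" and x: "x \<in> cells (dob F (src C (\<sigma> (0, 0)))) n"
      by (auto simp: cells_hocolim)
    have m: "\<sigma> (0, 0) \<in> mor C" using nerveD(1)[OF \<sigma>] by simp
    show "z \<in> cells (hocolim D F') n"
      using functor_on_nerve[OF T \<sigma>] functor_onD(4)[OF T m] bij_betwE[OF g[OF ob[OF m]]] x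
      by (simp add: z hocolim_map_def cells_hocolim)
  next
    fix z assume z: "z \<in> cells (hocolim D F') n"
    obtain \<tau> w where z_eq: "z = (\<tau>, w)" by fastforce
    with z have \<tau>: "\<tau> \<in> nerve D n" "w \<in> cells (dob F' (src D (\<tau> (0, 0)))) n"
      by (auto simp: cells_hocolim)
    define \<sigma> where "\<sigma> = (\<lambda>p\<in>tri n. T' (\<tau> p))"
    have \<sigma>: "\<sigma> \<in> nerve C n" unfolding \<sigma>_def by (rule functor_on_nerve[OF T' \<tau>(1)])
    have T\<sigma>: "(\<lambda>p\<in>tri n. T (\<sigma> p)) = \<tau>" unfolding \<sigma>_def by (rule TT'[OF \<tau>(1)])
    have m: "\<sigma> (0, 0) \<in> mor C" using nerveD(1)[OF \<sigma>] by simp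
    have "src D (\<tau> (0, 0)) = S (src C (\<sigma> (0, 0)))"
      using functor_onD(4)[OF T m] T\<sigma> by (metis le0 mem_tri order_refl restrict_apply)
    with \<tau>(2) obtain x where "x \<in> cells (dob F (src C (\<sigma> (0, 0)))) n" "w = g (src C (\<sigma> (0, 0))) n x"
      using bij_betw_imp_surj_on[OF g[OF ob[OF m]]] by (metis imageE)
    then have "(\<sigma>, x) \<in> cells (hocolim C F) n" "z = hocolim_map C T g n (\<sigma>, x)"
      using \<sigma> T\<sigma> by (auto simp: cells_hocolim hocolim_map_def z_eq)
    then show "z \<in> hocolim_map C T g n ` cells (hocolim C F) n" by blast
  qed
qed

section \<open>Forgetting one of two heights\<close>

definition map_diagram ::
  "(('x, 'h) fsset \<Rightarrow> ('x, 'k) fsset) \<Rightarrow> ('o, 'm, 'x, 'h) diagram \<Rightarrow> ('o, 'm, 'x, 'k) diagram" where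
  "map_diagram p F = \<lparr>dob = \<lambda>d. p (dob F d), dmor = dmor F\<rparr>"

lemma map_diagram_simps [simp]:
  "dob (map_diagram p F) d = p (dob F d)" "dmor (map_diagram p F) = dmor F"
  by (simp_all add: map_diagram_def)

lemma p_simps [simp]:
  "cells (p1 X) = cells X" "act (p1 X) = act X" "ht (p1 X) n x = fst (ht X n x)"
  "cells (p2 X) = cells X" "act (p2 X) = act X" "ht (p2 X) n x = snd (ht X n x)"
  by (simp_all add: p1_def p2_def)

text \<open>A cell of a homotopy colimit has the height of its fibre component, so a height can be
  forgotten fibrewise. This turns flip maps, which go from second to first heights, into maps of
  singly filtered diagrams.\<close>

lemma p1_hocolim: "p1 (hocolim C F) = hocolim C (map_diagram p1 F)"
  by (simp add: hocolim_def p1_def with_ht_def fun_eq_iff split: prod.splits)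

lemma p2_hocolim: "p2 (hocolim C F) = hocolim C (map_diagram p2 F)"
  by (simp add: hocolim_def p2_def with_ht_def fun_eq_iff split: prod.splits)

lemma map_diagram_point:
  "map_diagram p1 (point_diagram (\<lambda>c. (a c, b c))) = point_diagram a"
  "map_diagram p2 (point_diagram (\<lambda>c. (a c, b c))) = point_diagram b"
  by (simp_all add: map_diagram_def point_diagram_def p1_def p2_def with_ht_def point_def)

lemma filtered_sset_p2: "filtered_sset X \<Longrightarrow> filtered_sset (p2 X)"
  by (intro filtered_ssetI) (auto simp: filtered_ssetD less_eq_prod_def dest: filtered_ssetD(2))

lemma filtered_map_p2: "filtered_map X Y f \<Longrightarrow> filtered_map (p2 X) (p2 Y) f"
  by (intro filtered_mapI) (auto simp: filtered_mapD less_eq_prod_def dest: filtered_mapD(2))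

lemma filtered_diagram_p2: "filtered_diagram C F \<Longrightarrow> filtered_diagram C (map_diagram p2 F)"
  by (simp add: filtered_diagram_def filtered_sset_p2 filtered_map_p2)

section \<open>Negative definite intersection forms\<close>

lemma intersection_commute: "intersection H u v = intersection H v u"
  by (simp add: intersection_def insert_commute)

lemma form_commute: "form H x y = form H y x"
  unfolding form_def
  by (subst sum.swap) (simp add: intersection_commute mult.commute mult.left_commute)

lemma form_add_left: "form H (\<lambda>v. x v + y v) z = form H x z + form H y z"
  by (simp add: form_def distrib_right sum.distrib)

lemma form_diff_left: "form H (\<lambda>v. x v - y v) z = form H x z - form H y z"
  by (simp add: form_def left_diff_distrib sum_subtractf)

lemma form_scale_left: "form H (\<lambda>v. c * x v) z = c * form H x z"
  by (simp add: form_def sum_distrib_left mult.assoc)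

lemma form_add_right: "form H z (\<lambda>v. x v + y v) = form H z x + form H z y"
  by (simp add: form_commute[of H z] form_add_left)

lemma form_diff_right: "form H z (\<lambda>v. x v - y v) = form H z x - form H z y"
  by (simp add: form_commute[of H z] form_diff_left)

lemma form_scale_right: "form H z (\<lambda>v. c * x v) = c * form H z x"
  by (simp add: form_commute[of H z] form_scale_left)

lemma form_vertex_right:
  assumes "finite (verts H)" "v \<in> verts H"
  shows "form H x (vertex_class v) = (\<Sum>u\<in>verts H. x u * of_int (intersection H u v))"
proof -
  have "(\<Sum>w\<in>verts H. x u * of_int (intersection H u w) * vertex_class v w) =
      (\<Sum>w\<in>verts H. if w = v then x u * of_int (intersection H u w) else 0)" for u
    by (intro sum.cong) (auto simp: vertex_class_def)
  then show ?thesis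
    using assms by (simp add: form_def sum.delta)
qed

lemma form_expand:
  assumes "finite (verts H)"
  shows "form H x y = (\<Sum>v\<in>verts H. form H x (vertex_class v) * y v)"
proof -
  have "form H x y = (\<Sum>v\<in>verts H. \<Sum>u\<in>verts H. x u * of_int (intersection H u v) * y v)"
    unfolding form_def by (rule sum.swap)
  also have "\<dots> = (\<Sum>v\<in>verts H. form H x (vertex_class v) * y v)"
    by (intro sum.cong) (simp_all add: form_vertex_right[OF assms] sum_distrib_right)
  finally show ?thesis .
qed

text \<open>Evaluating a Poincare dual is taking an intersection number; this governs how
  \<open>A_hat\<close> changes when a class is added.\<close>

lemma sum_PD:
  "(\<Sum>w\<in>verts H. of_int (PD H S w) * y w) = form H (\<lambda>v. of_int (S v)) y"
  unfolding form_def
  by (subst sum.swap) (simp add: PD_def sum_distrib_right)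

text \<open>Used both for \<open>Gv0(n)\<close> and for \<open>G\<close>, whose form is the
  restriction of the former to classes without \<open>v0\<close> and hence negative definite
  too.\<close>

locale neg_def_graph =
  fixes H :: "'v wgraph"
  assumes finite_verts: "finite (verts H)"
    and negative: "neg_def H"
begin

text \<open>Gram--Schmidt: one vertex at a time, using its component orthogonal to the earlier ones.\<close>

lemma solve_on:
  assumes "finite S" "S \<subseteq> verts H"
  shows "\<exists>x. (\<forall>v. v \<notin> S \<longrightarrow> x v = 0) \<and> (\<forall>v\<in>S. form H x (vertex_class v) = k v)"
  using assms
proof (induction S arbitrary: k rule: finite_induct)
  case empty
  show ?case by (intro exI[of _ "\<lambda>v. 0"]) simp
next
  case (insert w S)
  obtain y where y: "\<And>v. v \<notin> S \<Longrightarrow> y v = 0"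
    "\<And>v. v \<in> S \<Longrightarrow> form H y (vertex_class v) = form H (vertex_class w) (vertex_class v)"
    using insert.IH[of "\<lambda>v. form H (vertex_class w) (vertex_class v)"] insert.prems by blast
  obtain x where x: "\<And>v. v \<notin> S \<Longrightarrow> x v = 0"
    "\<And>v. v \<in> S \<Longrightarrow> form H x (vertex_class v) = k v"
    using insert.IH[of k] insert.prems by blast
  define z where "z = (\<lambda>v. vertex_class w v - y v)"
  have zS: "form H z (vertex_class v) = 0" if "v \<in> S" for v
    using y(2)[OF that] by (simp add: z_def form_diff_left)
  \<comment> \<open>Since \<open>y\<close> lives on \<open>S\<close> and \<open>z\<close> is
    orthogonal to \<open>S\<close>, the pivot \<open>form H z (vertex_class w)\<close> equals
    \<open>form H z z\<close>. It is negative because \<open>z\<close> has coefficient 1 at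
    \<open>w\<close>.\<close>
  have "form H z y = (\<Sum>v\<in>verts H. form H z (vertex_class v) * y v)"
    by (rule form_expand[OF finite_verts])
  also have "\<dots> = 0"
    by (intro sum.neutral) (use zS y(1) in force)
  finally have zw: "form H z (vertex_class w) = form H z z"
    by (simp add: z_def form_diff_right)
  have "z w = 1" using y(1) insert.hyps by (simp add: z_def vertex_class_def)
  then have "z \<noteq> (\<lambda>v. 0)" by auto
  have zH: "z v = 0" if "v \<notin> insert w S" for v
    using that y(1) by (auto simp: z_def vertex_class_def)
  have "z v = 0" if "v \<notin> verts H" for v
    using that insert.prems zH[of v] by blast
  then have "z \<in> H2_rat H" by (simp add: H2_rat_def)
  with \<open>z \<noteq> (\<lambda>v. 0)\<close> have neg: "form H z (vertex_class w) < 0"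
    using negative zw by (simp add: neg_def_def)
  \<comment> \<open>Adding a multiple of \<open>z\<close> leaves the values prescribed on
    \<open>S\<close> alone; \<open>c\<close> corrects the remaining one at \<open>w\<close>.\<close>
  define c where "c = (k w - form H x (vertex_class w)) / form H z (vertex_class w)"
  have "form H (\<lambda>v. x v + c * z v) (vertex_class v) = k v" if "v \<in> insert w S" for v
  proof (cases "v = w")
    case True
    moreover have "c * form H z (vertex_class w) = k w - form H x (vertex_class w)"
      using neg by (simp add: c_def)
    ultimately show ?thesis by (simp add: form_add_left form_scale_left)
  next
    case False
    with that have "v \<in> S" by simp
    then show ?thesis using x(2) zS by (simp add: form_add_left form_scale_left)
  qed
  moreover have "x v + c * z v = 0" if "v \<notin> insert w S" for v
    using that x(1) zH by simp
  ultimately show ?case by (intro exI[of _ "\<lambda>v. x v + c * z v"]) blast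
qed

lemma dual_unique:
  assumes "x \<in> H2_rat H" "y \<in> H2_rat H"
    and "\<And>v. v \<in> verts H \<Longrightarrow> form H x (vertex_class v) = form H y (vertex_class v)"
  shows "x = y"
proof -
  define d where "d = (\<lambda>v. x v - y v)"
  have "form H d d = (\<Sum>v\<in>verts H. form H d (vertex_class v) * d v)"
    by (rule form_expand[OF finite_verts])
  also have "\<dots> = 0"
    by (intro sum.neutral) (use assms(3) in \<open>simp add: d_def form_diff_left\<close>)
  finally have "form H d d = 0" .
  moreover have "d \<in> H2_rat H" using assms(1,2) by (simp add: H2_rat_def d_def)
  ultimately have "d = (\<lambda>v. 0)" using negative by (auto simp: neg_def_def)
  then show ?thesis by (simp add: d_def fun_eq_iff)
qed

text \<open>Gives meaning to \<open>PD_inverse\<close> and \<open>Sigma0\<close>, both defined by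
  \<open>THE\<close>.\<close>

lemma dual_ex1:
  "\<exists>!x. x \<in> H2_rat H \<and> (\<forall>v \<in> verts H. form H x (vertex_class v) = k v)"
proof (rule ex_ex1I)
  show "\<exists>x. x \<in> H2_rat H \<and> (\<forall>v \<in> verts H. form H x (vertex_class v) = k v)"
    using solve_on[OF finite_verts order_refl, of k] by (auto simp: H2_rat_def)
qed (use dual_unique in metis)

lemma PD_inverse:
  shows PD_inverse_mem: "PD_inverse H k \<in> H2_rat H"
    and form_PD_inverse: "v \<in> verts H \<Longrightarrow> form H (PD_inverse H k) (vertex_class v) = of_int (k v)"
  using theI'[OF dual_ex1[of "\<lambda>v. of_int (k v)"]] by (auto simp: PD_inverse_def)

lemma PD_inverse_eqI:
  assumes "x \<in> H2_rat H" "\<And>v. v \<in> verts H \<Longrightarrow> form H x (vertex_class v) = of_int (k v)"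
  shows "PD_inverse H k = x"
  by (rule dual_unique) (use assms PD_inverse in auto)

end

section \<open>Cubes and their faces\<close>

lemma cube_vertex_empty [simp]: "cube_vertex H k {} = k"
  by (simp add: cube_vertex_def plus_class_def PD_def fun_eq_iff)

lemma PD_add: "PD H (\<lambda>v. S v + T v) = (\<lambda>v. PD H S v + PD H T v)"
  by (auto simp: PD_def distrib_right sum.distrib fun_eq_iff)

lemma PD_minus: "PD H (\<lambda>v. - S v) = (\<lambda>v. - PD H S v)"
  by (auto simp: PD_def sum_negf fun_eq_iff)

lemma plus_class_add: "plus_class H (plus_class H k S) T = plus_class H k (\<lambda>v. S v + T v)"
  by (simp add: plus_class_def PD_add algebra_simps)

lemma plus_class_minus: "plus_class H (plus_class H k S) (\<lambda>v. - S v) = k"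
  by (simp add: plus_class_def PD_minus)

text \<open>Indicator functions of disjoint sets add up. For a face of a face the disjointness is
  automatic: one displacement avoids \<open>E'\<close>, the other lies in it.\<close>

lemma cube_vertex_Un:
  assumes "I \<inter> J = {}"
  shows "cube_vertex H (cube_vertex H k I) J = cube_vertex H k (I \<union> J)"
proof -
  have "(\<lambda>v. of_bool (v \<in> I) + of_bool (v \<in> J) :: int) = (\<lambda>v. of_bool (v \<in> I \<union> J))"
    using assms by (auto simp: fun_eq_iff)
  then show ?thesis by (simp add: cube_vertex_def plus_class_add)
qed

lemma cube_vertex_plus_class:
  "cube_vertex H (plus_class H k S) I = plus_class H (cube_vertex H k I) S"
  by (simp add: cube_vertex_def plus_class_add add.commute)

lemma cube_vertex_insert:
  assumes "v \<notin> I"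
  shows "cube_vertex H k (insert v I) = plus_class H (cube_vertex H k I) (vertex_class v)"
proof -
  have "(\<lambda>w. of_bool (w \<in> insert v I) :: int) = (\<lambda>w. of_bool (w \<in> I) + vertex_class v w)"
    using assms by (auto simp: fun_eq_iff vertex_class_def)
  then show ?thesis by (simp add: cube_vertex_def plus_class_add)
qed

lemma cube_vertex_plus_attached:
  "cube_vertex H (plus_attached Hv0 v0 k) I = plus_attached Hv0 v0 (cube_vertex H k I)"
  by (simp add: cube_vertex_def plus_class_def plus_attached_def fun_eq_iff)

lemma orbit_self: "k \<in> orbit H k"
  unfolding orbit_def by (rule CollectI, rule exI[of _ "\<lambda>v. 0"]) (auto simp: plus_class_def PD_def fun_eq_iff)

lemma plus_class_orbit: "k \<in> orbit H l \<Longrightarrow> plus_class H k S \<in> orbit H l"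
  by (auto simp: orbit_def plus_class_add)

lemma cube_vertex_orbit: "k \<in> orbit H l \<Longrightarrow> cube_vertex H k I \<in> orbit H l"
  by (simp add: cube_vertex_def plus_class_orbit)

lemma orbit_eq: 
  assumes "k \<in> orbit H l"
  shows "orbit H k = orbit H l"
proof
  obtain S where k: "k = plus_class H l S" using assms by (auto simp: orbit_def)
  show "orbit H k \<subseteq> orbit H l" by (auto simp: orbit_def k plus_class_add)
  have "l = plus_class H k (\<lambda>v. - S v)" by (simp add: k plus_class_minus)
  then show "orbit H l \<subseteq> orbit H k" by (auto simp: orbit_def plus_class_add)
qed

lemma orbit_Spinc: "t \<in> Spinc H \<Longrightarrow> k \<in> t \<Longrightarrow> orbit H k = t"
  by (auto simp: Spinc_def orbit_eq)

lemma characteristic_plus_class: 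
  "k \<in> characteristic H \<Longrightarrow> plus_class H k S \<in> characteristic H"
  by (auto simp: characteristic_def plus_class_def PD_def)

lemma Spinc_characteristic: "t \<in> Spinc H \<Longrightarrow> k \<in> t \<Longrightarrow> k \<in> characteristic H"
  by (auto simp: Spinc_def orbit_def characteristic_plus_class)

lemma Spinc_plus_class: "t \<in> Spinc H \<Longrightarrow> k \<in> t \<Longrightarrow> plus_class H k S \<in> t"
  by (auto simp: Spinc_def plus_class_orbit)

lemma Spinc_cube_vertex: "t \<in> Spinc H \<Longrightarrow> k \<in> t \<Longrightarrow> cube_vertex H k I \<in> t"
  by (simp add: cube_vertex_def Spinc_plus_class)

lemma Spinc_nonempty: "t \<in> Spinc H \<Longrightarrow> \<exists>k. k \<in> t"
  using orbit_self by (auto simp: Spinc_def)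

lemma orbit_in_Spinc: "k \<in> characteristic H \<Longrightarrow> orbit H k \<in> Spinc H"
  by (simp add: Spinc_def)

lemma face_of_refl: "face_of H c c"
  by (cases c) (auto simp: face_of_def intro: exI[of _ "{}"])

lemma face_ofI:
  assumes "E' \<subseteq> E" "J \<subseteq> E - E'" "k' = cube_vertex H k J"
  shows "face_of H (k', E') (k, E)"
  using assms by (auto simp: face_of_def)

lemma face_of_trans:
  assumes "face_of H c'' c'" "face_of H c' c"
  shows "face_of H c'' c"
proof -
  obtain k E k' E' k'' E'' where c: "c = (k, E)" "c' = (k', E')" "c'' = (k'', E'')"
    by (metis surj_pair)
  from assms obtain I J where I: "E' \<subseteq> E" "I \<subseteq> E - E'" "k' = cube_vertex H k I"
    and J: "E'' \<subseteq> E'" "J \<subseteq> E' - E''" "k'' = cube_vertex H k' J"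
    by (auto simp: face_of_def c)
  have "I \<inter> J = {}" using I J by blast
  then have "k'' = cube_vertex H k (I \<union> J)" using I J by (simp add: cube_vertex_Un)
  moreover have "E'' \<subseteq> E" "I \<union> J \<subseteq> E - E''" using I J by auto
  ultimately show ?thesis unfolding face_of_def c prod.case by blast
qed

text \<open>The vertices of a face are among those of the cube, so its minimum runs over a smaller
  nonempty set.\<close>

lemma h_U_face:
  assumes "face_of H c' c" "finite (snd c)"
  shows "h_U H c \<le> h_U H c'"
proof -
  obtain k E k' E' where c: "c = (k, E)" "c' = (k', E')" by (metis surj_pair)
  from assms obtain I where I: "E' \<subseteq> E" "I \<subseteq> E - E'" "k' = cube_vertex H k I"
    by (auto simp: face_of_def c)
  have "{h_U_char H (cube_vertex H k' J) | J. J \<subseteq> E'} \<subseteq> {h_U_char H (cube_vertex H k J) | J. J \<subseteq> E}"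
  proof clarify
    fix J assume J: "J \<subseteq> E'"
    have "I \<inter> J = {}" using I J by blast
    then have "cube_vertex H k' J = cube_vertex H k (I \<union> J)" using I by (simp add: cube_vertex_Un)
    moreover have "I \<union> J \<subseteq> E" using I J by blast
    ultimately show "\<exists>J'. h_U_char H (cube_vertex H k' J) = h_U_char H (cube_vertex H k J') \<and> J' \<subseteq> E"
      by metis
  qed
  moreover have "finite {h_U_char H (cube_vertex H k J) | J. J \<subseteq> E}"
    using assms(2) by (simp add: c setcompr_eq_image finite_Collect_subsets)
  moreover have "{h_U_char H (cube_vertex H k' J) | J. J \<subseteq> E'} \<noteq> {}" by blast
  ultimately show ?thesis
    unfolding h_U_def c by (simp add: Min_antimono)
qed

lemma face_of_plus_attached:
  assumes "face_of H (k', E') (k, E)"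
  shows "face_of H (plus_attached Hv0 v0 k', E') (plus_attached Hv0 v0 k, E)"
  using assms by (auto simp: face_of_def cube_vertex_plus_attached)

lemma face_cat_simps [simp]:
  "ob (face_cat H Q) = Q"
  "mor (face_cat H Q) = {(c, c'). c \<in> Q \<and> c' \<in> Q \<and> face_of H c' c}"
  "src (face_cat H Q) = fst"
  "tgt (face_cat H Q) = snd"
  "ide (face_cat H Q) = (\<lambda>c. (c, c))"
  "cmp (face_cat H Q) = (\<lambda>g f. (fst f, snd g))"
  by (simp_all add: face_cat_def)

lemma face_nerveD:
  assumes "\<tau> \<in> nerve (face_cat H Q) m" and jk: "j \<le> k" "k \<le> m"
  shows "\<tau> (j, k) = (fst (\<tau> (j, j)), fst (\<tau> (k, k)))"
    and "fst (\<tau> (j, j)) \<in> Q" "fst (\<tau> (k, k)) \<in> Q"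
    and "face_of H (fst (\<tau> (k, k))) (fst (\<tau> (j, j)))"
proof -
  have eq: "fst (\<tau> (j, k)) = fst (\<tau> (j, j))" "snd (\<tau> (j, k)) = fst (\<tau> (k, k))"
    using nerveD(3,4)[OF assms] by simp_all
  then show "\<tau> (j, k) = (fst (\<tau> (j, j)), fst (\<tau> (k, k)))" by (simp add: prod_eq_iff)
  have "\<tau> (j, k) \<in> mor (face_cat H Q)" by (rule nerveD(1)[OF assms])
  then show "fst (\<tau> (j, j)) \<in> Q" "fst (\<tau> (k, k)) \<in> Q" "face_of H (fst (\<tau> (k, k))) (fst (\<tau> (j, j)))"
    by (simp_all add: case_prod_beta eq)
qed

text \<open>There is at most one arrow between two cubes, so a chain is determined by its objects
  \<open>fst (\<tau> (j, j))\<close>.\<close>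

lemma face_nerve_eq:
  assumes "\<tau> \<in> nerve (face_cat H Q) m"
  shows "\<tau> = (\<lambda>(j, k)\<in>tri m. (fst (\<tau> (j, j)), fst (\<tau> (k, k))))"
proof (rule extensionalityI[of _ "tri m"])
  fix p assume p: "p \<in> tri m"
  obtain j k where "p = (j, k)" by fastforce
  with p show "\<tau> p = (\<lambda>(j, k)\<in>tri m. (fst (\<tau> (j, j)), fst (\<tau> (k, k)))) p"
    using face_nerveD(1)[OF assms, of j k] by simp
qed (simp_all add: nerve_extensional[OF assms])

lemma face_nerveI:
  assumes "\<And>j. j \<le> m \<Longrightarrow> c j \<in> Q"
    and "\<And>j k. j \<le> k \<Longrightarrow> k \<le> m \<Longrightarrow> face_of H (c k) (c j)"
  shows "(\<lambda>(j, k)\<in>tri m. (c j, c k)) \<in> nerve (face_cat H Q) m"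
  using assms by (auto simp: nerve_def)

lemma point_simps [simp]:
  "cells (point h) n = UNIV" "act (point h) m n \<theta> x = x" "ht (point h) n x = h"
  by (simp_all add: point_def)

lemma point_diagram_simps [simp]:
  "dob (point_diagram h) c = point (h c)" "dmor (point_diagram h) f n x = x"
  by (simp_all add: point_diagram_def)

lemma filtered_sset_point [simp]: "filtered_sset (point h)"
  by (rule filtered_ssetI) simp_all

lemma filtered_diagram_point:
  assumes "\<And>c c'. c \<in> Q \<Longrightarrow> c' \<in> Q \<Longrightarrow> face_of H c' c \<Longrightarrow> h c \<le> h c'"
  shows "filtered_diagram (face_cat H Q) (point_diagram h)"
  using assms by (auto simp: filtered_diagram_def intro!: filtered_mapI)

lemma functor_on_face_cat:
  assumes "\<And>c. c \<in> Q \<Longrightarrow> \<phi> c \<in> Q'"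
    and "\<And>c c'. c \<in> Q \<Longrightarrow> c' \<in> Q \<Longrightarrow> face_of H c' c \<Longrightarrow> face_of H' (\<phi> c') (\<phi> c)"
  shows "functor_on (face_cat H Q) (face_cat H' Q') \<phi> (map_prod \<phi> \<phi>)"
  using assms by (auto simp: functor_on_def)

lemma filtered_map_face_hocolim:
  assumes "\<And>c. c \<in> Q \<Longrightarrow> \<phi> c \<in> Q'"
    and "\<And>c c'. c \<in> Q \<Longrightarrow> c' \<in> Q \<Longrightarrow> face_of H c' c \<Longrightarrow> face_of H' (\<phi> c') (\<phi> c)"
    and "\<And>c c'. c \<in> Q \<Longrightarrow> c' \<in> Q \<Longrightarrow> face_of H c' c \<Longrightarrow> h c \<le> h c'"
    and "\<And>c. c \<in> Q \<Longrightarrow> h c \<le> h' (\<phi> c)"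
  shows "filtered_map (hocolim (face_cat H Q) (point_diagram h))
    (hocolim (face_cat H' Q') (point_diagram h'))
    (hocolim_map (face_cat H Q) (map_prod \<phi> \<phi>) (\<lambda>c n x. x))"
  using assms
  by (intro filtered_map_hocolim[OF functor_on_face_cat] filtered_diagram_point filtered_mapI) auto

text \<open>Faces have to be reflected as well as preserved, so that the inverse bijection of cubes
  is again a functor. The heights \<open>h\<close> and \<open>h'\<close> are unrelated because cells
  do not see them.\<close>

lemma bij_betw_face_hocolim:
  assumes \<phi>: "bij_betw \<phi> Q Q'"
    and face: "\<And>c c'. c \<in> Q \<Longrightarrow> c' \<in> Q \<Longrightarrow> face_of H' (\<phi> c') (\<phi> c) \<longleftrightarrow> face_of H c' c"
  shows "bij_betw (hocolim_map (face_cat H Q) (map_prod \<phi> \<phi>) (\<lambda>c n x. x) n)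
    (cells (hocolim (face_cat H Q) (point_diagram h)) n)
    (cells (hocolim (face_cat H' Q') (point_diagram h')) n)"
proof -
  define \<psi> where "\<psi> = inv_into Q \<phi>"
  have \<psi>: "\<psi> c \<in> Q" "\<phi> (\<psi> c) = c" if "c \<in> Q'" for c
    using bij_betwE[OF bij_betw_inv_into[OF \<phi>]] bij_betw_inv_into_right[OF \<phi>] that
    by (auto simp: \<psi>_def)
  have \<phi>': "\<phi> c \<in> Q'" "\<psi> (\<phi> c) = c" if "c \<in> Q" for c
    using bij_betwE[OF \<phi>] bij_betw_inv_into_left[OF \<phi>] that by (auto simp: \<psi>_def)
  have face': "face_of H (\<psi> c') (\<psi> c)" if "c \<in> Q'" "c' \<in> Q'" "face_of H' c' c" for c c'
    using face[of "\<psi> c" "\<psi> c'"] \<psi> that by simp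
  show ?thesis
  proof (rule bij_betw_hocolim_map)
    show "functor_on (face_cat H Q) (face_cat H' Q') \<phi> (map_prod \<phi> \<phi>)"
      using \<phi>' face by (intro functor_on_face_cat) auto
    show "functor_on (face_cat H' Q') (face_cat H Q) \<psi> (map_prod \<psi> \<psi>)"
      using \<psi> face' by (intro functor_on_face_cat) auto
  qed (use \<phi>' \<psi> in \<open>auto simp: bij_betw_def inj_on_def\<close>)
qed

section \<open>Collections with flip maps\<close>

lemma orbit_plus_attached:
  "orbit H (plus_attached Hv0 v0 k) = plus_attached Hv0 v0 ` orbit H k"
proof -
  have "plus_class H (plus_attached Hv0 v0 k) S = plus_attached Hv0 v0 (plus_class H k S)" for S
    by (simp add: plus_class_def plus_attached_def fun_eq_iff)
  then show ?thesis by (auto simp: orbit_def)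
qed

lemma plus_attached_Spinc:
  assumes "t \<in> Spinc (delete_vertex Hv0 v0)"
  shows "plus_attached Hv0 v0 ` t \<in> Spinc (delete_vertex Hv0 v0)"
proof -
  obtain k where k: "k \<in> characteristic (delete_vertex Hv0 v0)" "t = orbit (delete_vertex Hv0 v0) k"
    using assms by (auto simp: Spinc_def)
  have "plus_attached Hv0 v0 k \<in> characteristic (delete_vertex Hv0 v0)"
    using k(1) by (auto simp: characteristic_def plus_attached_def PD_attached_def delete_vertex_def)
  then show ?thesis by (simp add: k(2) Spinc_def flip: orbit_plus_attached)
qed

lemma CFK_simps:
  "cidx (CFK Hv0 v0) = Spinc (delete_vertex Hv0 v0)"
  "cshift (CFK Hv0 v0) t = plus_attached Hv0 v0 ` t"
  "cob (CFK Hv0 v0) t = hocolim (D_cat (delete_vertex Hv0 v0) t)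
     (point_diagram (\<lambda>c. (h_U (delete_vertex Hv0 v0) c, h_V Hv0 v0 c)))"
  "cflip (CFK Hv0 v0) t = hocolim_map (D_cat (delete_vertex Hv0 v0) t)
     (map_prod (map_prod (plus_attached Hv0 v0) id) (map_prod (plus_attached Hv0 v0) id))
     (\<lambda>c n x. x)"
  by (simp_all add: CFK_def Let_def)

lemma h_V_map: "h_V Hv0 v0 c = h_U (delete_vertex Hv0 v0) (map_prod (plus_attached Hv0 v0) id c)"
  by (cases c) (simp add: h_V_def)

lemma face_of_map_attached:
  "face_of H c' c \<Longrightarrow>
    face_of H (map_prod (plus_attached Hv0 v0) id c') (map_prod (plus_attached Hv0 v0) id c)"
  by (cases c; cases c') (simp add: face_of_plus_attached)

lemma cubes_finite: "finite (verts H) \<Longrightarrow> c \<in> cubes H t \<Longrightarrow> finite (snd c)"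
  by (auto simp: cubes_def dest: finite_subset)

text \<open>\<open>h_V\<close> of a cube is \<open>h_U\<close> of its translate, and the flip map is
  this translation; so it carries the second height exactly to the first.\<close>

lemma flip_collection_CFK:
  assumes fin: "finite (verts Hv0)"
  shows "flip_collection (CFK Hv0 v0)"
  unfolding flip_collection_def
proof (intro ballI conjI)
  let ?H = "delete_vertex Hv0 v0"
  let ?\<phi> = "map_prod (plus_attached Hv0 v0) id"
  have finH: "finite (verts ?H)" using fin by (simp add: delete_vertex_def)
  fix t assume t: "t \<in> cidx (CFK Hv0 v0)"
  show "cshift (CFK Hv0 v0) t \<in> cidx (CFK Hv0 v0)"
    using t by (simp add: CFK_simps plus_attached_Spinc)
  have U: "h_U ?H c \<le> h_U ?H c'" if "c \<in> cubes ?H t" "face_of ?H c' c" for c c'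
    using h_U_face[OF that(2)] cubes_finite[OF finH that(1)] by simp
  have V: "h_V Hv0 v0 c \<le> h_V Hv0 v0 c'" if "c \<in> cubes ?H t" "face_of ?H c' c" for c c'
    using h_U_face[OF face_of_map_attached[OF that(2)], of Hv0 v0] cubes_finite[OF finH that(1)]
    by (simp add: h_V_map)
  show "filtered_sset (cob (CFK Hv0 v0) t)"
    unfolding CFK_simps D_cat_def
    using U V by (intro filtered_sset_hocolim filtered_diagram_point) (simp add: less_eq_prod_def)
  show "filtered_map (p2 (cob (CFK Hv0 v0) t)) (p1 (cob (CFK Hv0 v0) (cshift (CFK Hv0 v0) t)))
     (cflip (CFK Hv0 v0) t)"
    unfolding CFK_simps D_cat_def p1_hocolim p2_hocolim map_diagram_point
  proof (rule filtered_map_face_hocolim)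
    show "?\<phi> c \<in> cubes ?H (plus_attached Hv0 v0 ` t)" if "c \<in> cubes ?H t" for c
      using that by (auto simp: cubes_def)
  qed (use V in \<open>simp_all add: face_of_map_attached h_V_map\<close>)
qed

text \<open>The term \<open>2 * i\<close> is the one added to the second height in
  \<open>A_star i\<close>. Thus the two entries of the minimum, shifted by \<open>gr r i\<close>,
  become a first height shifted by \<open>gr r i\<close> and a second height shifted by
  \<open>gr r (i + r)\<close>, as needed at the targets of \<open>Lam\<close> and
  \<open>Rho\<close>.\<close>

lemma gr_add:
  assumes "r \<noteq> 0"
  shows "gr r (i + r) = gr r i + 2 * i"
  using assms by (simp add: gr_def field_simps power2_eq_square)

lemma surgery_cat_simps [simp]:
  "ob (surgery_cat r sh c) = {(t, i, z). (t, i) \<in> c}"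
  "src (surgery_cat r sh c) (Ident d) = d"
  "src (surgery_cat r sh c) (Lam t i) = (t, i, Side_a)"
  "src (surgery_cat r sh c) (Rho t i) = (t, i, Side_a)"
  "tgt (surgery_cat r sh c) (Ident d) = d"
  "tgt (surgery_cat r sh c) (Lam t i) = (t, i, Side_b)"
  "tgt (surgery_cat r sh c) (Rho t i) = (sh t, i + r, Side_b)"
  "ide (surgery_cat r sh c) = Ident"
  "cmp (surgery_cat r sh c) g (Ident d) = g"
  "cmp (surgery_cat r sh c) g (Lam t i) = Lam t i"
  "cmp (surgery_cat r sh c) g (Rho t i) = Rho t i"
  by (simp_all add: surgery_cat_def)

lemma mor_surgery_cat [simp]:
  "Ident (t, i, z) \<in> mor (surgery_cat r sh c) \<longleftrightarrow> (t, i) \<in> c"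
  "Lam t i \<in> mor (surgery_cat r sh c) \<longleftrightarrow> (t, i) \<in> c"
  "Rho t i \<in> mor (surgery_cat r sh c) \<longleftrightarrow> (t, i) \<in> c"
  by (auto simp: surgery_cat_def)

lemma surgery_mor_cases:
  assumes "f \<in> mor (surgery_cat r sh c)"
  obtains (Ident) t i z where "f = Ident (t, i, z)" "(t, i) \<in> c"
    | (Lam) t i where "f = Lam t i" "(t, i) \<in> c"
    | (Rho) t i where "f = Rho t i" "(t, i) \<in> c"
  using assms by (auto simp: surgery_cat_def)

lemma XD_ob_simps [simp]:
  "cells (XD_ob r X (t, i, z)) = cells (cob X t)"
  "act (XD_ob r X (t, i, z)) = act (cob X t)"
  "ht (XD_ob r X (t, i, Side_a)) n x =
    min (fst (ht (cob X t) n x)) (snd (ht (cob X t) n x) + 2 * i) + gr r i"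
  "ht (XD_ob r X (t, i, Side_b)) n x = fst (ht (cob X t) n x) + gr r i"
  by (cases z; simp add: XD_ob_def ht_shift_def A_star_def)+

lemma XKD_simps [simp]:
  "cells (dob (XKD r X) (t, i, z)) = cells (cob X t)"
  "act (dob (XKD r X) (t, i, z)) = act (cob X t)"
  "ht (dob (XKD r X) (t, i, z)) n x = (ht (XD_ob r X (t, i, z)) n x, ht (XD_ob r X (t, i + 1, z)) n x)"
  "dmor (XKD r X) (Ident d) = (\<lambda>n x. x)"
  "dmor (XKD r X) (Lam t i) = (\<lambda>n x. x)"
  "dmor (XKD r X) (Rho t i) = cflip X t"
  by (simp_all add: XKD_def XD_def XD_mor_def)

lemma XK_simps [simp]:
  "cidx (XK A r X) = A // surgery_rel A r (cshift X)"
  "cshift (XK A r X) = mu_shift"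
  "cob (XK A r X) c = hocolim (surgery_cat r (cshift X) c) (XKD r X)"
  "cflip (XK A r X) c = hocolim_map (surgery_cat r (cshift X) c) index_shift (\<lambda>d n x. x)"
  by (simp_all add: XK_def)

text \<open>Both heights come from \<open>XD\<close>, at the indices \<open>i\<close> and
  \<open>i + 1\<close>. \<open>Lam\<close> does not lower them because a minimum is at most its
  first entry; \<open>Rho\<close> does not because it is at most its second entry, which the flip
  map carries below a first height.\<close>

lemma filtered_diagram_XKD:
  fixes X :: "('t, 'x) coll"
  assumes X: "flip_collection X" and r: "r \<noteq> 0"
    and c: "\<And>t i. (t, i) \<in> c \<Longrightarrow> t \<in> cidx X \<and> (cshift X t, i + r) \<in> c"
  shows "filtered_diagram (surgery_cat r (cshift X) c) (XKD r X)"
proof -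
  have fs: "filtered_sset (cob X t)" and flip: "filtered_map (p2 (cob X t)) (p1 (cob X (cshift X t))) (cflip X t)"
    if "(t, i) \<in> c" for t i
    using X c[OF that] by (auto simp: flip_collection_def)
  have fst_mono: "fst (ht (cob X t) n x) \<le> fst (ht (cob X t) m (act (cob X t) m n \<theta> x))"
    and snd_mono: "snd (ht (cob X t) n x) \<le> snd (ht (cob X t) m (act (cob X t) m n \<theta> x))"
    if "(t, i) \<in> c" "\<theta> \<in> simplex_arrows m n" "x \<in> cells (cob X t) n" for t i m n \<theta> x
    using filtered_ssetD(2)[OF fs[OF that(1)] that(2,3)] by (auto simp: less_eq_prod_def)
  have obj: "filtered_sset (dob (XKD r X) (t, i, z))" if "(t, i) \<in> c" for t i z
  proof (rule filtered_ssetI)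
    fix m n \<theta> x assume \<theta>: "\<theta> \<in> simplex_arrows m n" and x: "x \<in> cells (dob (XKD r X) (t, i, z)) n"
    then show "act (dob (XKD r X) (t, i, z)) m n \<theta> x \<in> cells (dob (XKD r X) (t, i, z)) m"
      using filtered_ssetD(1)[OF fs[OF that]] by simp
    show "ht (dob (XKD r X) (t, i, z)) n x \<le>
        ht (dob (XKD r X) (t, i, z)) m (act (dob (XKD r X) (t, i, z)) m n \<theta> x)"
      using fst_mono[OF that \<theta>, of x] snd_mono[OF that \<theta>, of x] x
      by (cases z) (auto simp: less_eq_prod_def min_le_iff_disj)
  qed (use filtered_ssetD(3,4)[OF fs[OF that]] in simp_all)
  have map: "filtered_map (dob (XKD r X) (src (surgery_cat r (cshift X) c) f))
      (dob (XKD r X) (tgt (surgery_cat r (cshift X) c) f)) (dmor (XKD r X) f)"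
    if "f \<in> mor (surgery_cat r (cshift X) c)" for f
    using that
  proof (cases rule: surgery_mor_cases)
    case (Ident t i z)
    then show ?thesis by (intro filtered_mapI) simp_all
  next
    case (Lam t i)
    then show ?thesis by (intro filtered_mapI) (simp_all add: less_eq_prod_def)
  next
    case (Rho t i)
    \<comment> \<open>The second equation serves the second height: the target index
      \<open>i + r + 1\<close> has to be read as \<open>(i + 1) + r\<close>.\<close>
    have g: "gr r (i + r) = gr r i + 2 * i" "gr r (i + r + 1) = gr r (i + 1) + 2 * (i + 1)"
      using gr_add[OF r, of i] gr_add[OF r, of "i + 1"] by (simp_all add: algebra_simps)
    show ?thesis
    proof (intro filtered_mapI)
      fix n x assume "x \<in> cells (dob (XKD r X) (src (surgery_cat r (cshift X) c) f)) n"
      then have x: "x \<in> cells (cob X t) n" by (simp add: Rho)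
      show "dmor (XKD r X) f n x \<in> cells (dob (XKD r X) (tgt (surgery_cat r (cshift X) c) f)) n"
        using filtered_mapD(1)[OF flip[OF Rho(2)]] x by (simp add: Rho)
      have "snd (ht (cob X t) n x) \<le> fst (ht (cob X (cshift X t)) n (cflip X t n x))"
        using filtered_mapD(2)[OF flip[OF Rho(2)], of x n] x by simp
      then show "ht (dob (XKD r X) (src (surgery_cat r (cshift X) c) f)) n x \<le>
          ht (dob (XKD r X) (tgt (surgery_cat r (cshift X) c) f)) n (dmor (XKD r X) f n x)"
        by (simp add: Rho less_eq_prod_def g min_le_iff_disj)
    next
      fix m n \<theta> x assume \<theta>: "\<theta> \<in> simplex_arrows m n"
        and x: "x \<in> cells (dob (XKD r X) (src (surgery_cat r (cshift X) c) f)) n"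
      then show "dmor (XKD r X) f m (act (dob (XKD r X) (src (surgery_cat r (cshift X) c) f)) m n \<theta> x) =
          act (dob (XKD r X) (tgt (surgery_cat r (cshift X) c) f)) m n \<theta> (dmor (XKD r X) f n x)"
        using filtered_mapD(3)[OF flip[OF Rho(2)] \<theta>, of x] by (simp add: Rho)
    qed
  qed
  have ends: "src (surgery_cat r (cshift X) c) f \<in> ob (surgery_cat r (cshift X) c)"
      "tgt (surgery_cat r (cshift X) c) f \<in> ob (surgery_cat r (cshift X) c)"
    if "f \<in> mor (surgery_cat r (cshift X) c)" for f
    using that by (cases rule: surgery_mor_cases; use c in auto)+
  have comp: "dmor (XKD r X) (cmp (surgery_cat r (cshift X) c) g f) n x = dmor (XKD r X) g n (dmor (XKD r X) f n x)"
    if f: "f \<in> mor (surgery_cat r (cshift X) c)" and g: "g \<in> mor (surgery_cat r (cshift X) c)"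
      and eq: "tgt (surgery_cat r (cshift X) c) f = src (surgery_cat r (cshift X) c) g" for f g n x
    using f
  proof (cases rule: surgery_mor_cases)
    case (Lam t i)
    \<comment> \<open>\<open>Lam\<close> and \<open>Rho\<close> end on the b-side, where only
      identities start, so \<open>g\<close> is an identity.\<close>
    show ?thesis using g by (cases rule: surgery_mor_cases) (use Lam eq in auto)
  next
    case (Rho t i)
    show ?thesis using g by (cases rule: surgery_mor_cases) (use Rho eq in auto)
  qed simp
  show ?thesis
    unfolding filtered_diagram_def using obj map ends comp by auto
qed

lemma functor_on_index_shift:
  "functor_on (surgery_cat r sh c) (surgery_cat r sh (mu_shift c))
    (\<lambda>(t, i, z). (t, i + 1, z)) index_shift"
proof -
  have mem: "(t, i + 1) \<in> mu_shift c" if "(t, i) \<in> c" for t i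
    using that by (force simp: mu_shift_def)
  show ?thesis
    unfolding functor_on_def
  proof (intro conjI ballI impI)
    fix f assume f: "f \<in> mor (surgery_cat r sh c)"
    then show "index_shift f \<in> mor (surgery_cat r sh (mu_shift c))"
      "src (surgery_cat r sh (mu_shift c)) (index_shift f) =
        (case src (surgery_cat r sh c) f of (t, i, z) \<Rightarrow> (t, i + 1, z))"
      "tgt (surgery_cat r sh (mu_shift c)) (index_shift f) =
        (case tgt (surgery_cat r sh c) f of (t, i, z) \<Rightarrow> (t, i + 1, z))"
      by (cases rule: surgery_mor_cases; simp add: index_shift_def mem)+
    fix g assume g: "g \<in> mor (surgery_cat r sh c)"
    show "index_shift (cmp (surgery_cat r sh c) g f) =
        cmp (surgery_cat r sh (mu_shift c)) (index_shift g) (index_shift f)"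
      using f by (cases rule: surgery_mor_cases) (simp_all add: index_shift_def)
  qed (auto simp: index_shift_def mem)
qed

text \<open>The second height at index \<open>i\<close> is by construction the first height at
  \<open>i + 1\<close>, so the index shift matches them exactly. That classes are closed under the
  two shifts depends on the indexing and is therefore a hypothesis.\<close>

lemma flip_collection_XK:
  assumes X: "flip_collection X" and r: "r \<noteq> 0"
    and cl: "\<And>c t i. c \<in> A // surgery_rel A r (cshift X) \<Longrightarrow> (t, i) \<in> c \<Longrightarrow>
      t \<in> cidx X \<and> (cshift X t, i + r) \<in> c"
    and sh: "\<And>c. c \<in> A // surgery_rel A r (cshift X) \<Longrightarrow> mu_shift c \<in> A // surgery_rel A r (cshift X)"
  shows "flip_collection (XK A r X)"
  unfolding flip_collection_def XK_simps
proof (intro ballI conjI)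
  fix c assume c: "c \<in> A // surgery_rel A r (cshift X)"
  show "mu_shift c \<in> A // surgery_rel A r (cshift X)" by (rule sh[OF c])
  have F: "filtered_diagram (surgery_cat r (cshift X) c) (XKD r X)"
    by (rule filtered_diagram_XKD[OF X r cl[OF c]])
  then show "filtered_sset (hocolim (surgery_cat r (cshift X) c) (XKD r X))"
    by (rule filtered_sset_hocolim)
  show "filtered_map (p2 (hocolim (surgery_cat r (cshift X) c) (XKD r X)))
      (p1 (hocolim (surgery_cat r (cshift X) (mu_shift c)) (XKD r X)))
      (hocolim_map (surgery_cat r (cshift X) c) index_shift (\<lambda>d n x. x))"
    unfolding p1_hocolim p2_hocolim
  proof (rule filtered_map_hocolim[OF functor_on_index_shift filtered_diagram_p2[OF F]])
    fix d assume "d \<in> ob (surgery_cat r (cshift X) c)"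
    then obtain t i z where d: "d = (t, i, z)" by auto
    show "filtered_map (dob (map_diagram p2 (XKD r X)) d)
        (dob (map_diagram p1 (XKD r X)) (case d of (t, i, z) \<Rightarrow> (t, i + 1, z))) (\<lambda>n x. x)"
      by (intro filtered_mapI) (simp_all add: d)
  next
    fix f n x assume "f \<in> mor (surgery_cat r (cshift X) c)"
    then show "dmor (map_diagram p1 (XKD r X)) (index_shift f) n x = dmor (map_diagram p2 (XKD r X)) f n x"
      by (cases rule: surgery_mor_cases) (simp_all add: index_shift_def)
  qed
qed

section \<open>The surgery indexing\<close>

lemma Min_shift:
  fixes f :: "'b \<Rightarrow> rat"
  assumes "finite A" "A \<noteq> {}"
  shows "Min ((\<lambda>x. f x + c) ` A) = Min (f ` A) + c"
  using assms by (simp add: Min_add_commute)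

locale surgery =
  fixes Gv0 :: "'v wgraph" and v0 :: 'v and n :: int
  assumes forest: "forest Gv0"
    and v0: "v0 \<in> verts Gv0"
    and neg_def_Gn: "neg_def (set_weight Gv0 v0 n)"
begin

abbreviation "G \<equiv> delete_vertex Gv0 v0"
abbreviation "Gn \<equiv> set_weight Gv0 v0 n"
abbreviation "r \<equiv> seifert_framing Gv0 v0 n"
abbreviation "\<Sigma> \<equiv> Sigma_class Gv0 v0"
abbreviation "\<Sigma>\<^sub>0 \<equiv> Sigma0 Gv0 v0"
abbreviation "ah \<equiv> A_hat Gv0 v0 n"
abbreviation "res \<equiv> restrict_char G"
abbreviation "addK \<equiv> plus_attached Gv0 v0"

section \<open>Orthogonal splitting of the form of \<open>Gv0(n)\<close> along
  \<open>\<Sigma>\<close>\<close>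

lemma verts_Gn [simp]: "verts Gn = verts Gv0"
  by (simp add: set_weight_def)

lemma verts_G [simp]: "verts G = verts Gv0 - {v0}"
  by (simp add: delete_vertex_def)

lemma finite_verts [simp]: "finite (verts Gv0)"
  using forest by (simp add: forest_def)

lemma intersection_G:
  assumes "u \<noteq> v0" "v \<noteq> v0"
  shows "intersection G u v = intersection Gn u v"
  using assms by (auto simp: intersection_def delete_vertex_def set_weight_def restrict_map_def)

lemma intersection_v0:
  assumes "v \<in> verts G"
  shows "intersection Gn v0 v = PD_attached Gv0 v0 v"
  using assms by (auto simp: intersection_def PD_attached_def set_weight_def)

lemma PD_attached_v0 [simp]: "PD_attached Gv0 v0 v0 = 0"
  by (simp add: PD_attached_def)

lemma sum_verts: "(\<Sum>v\<in>verts Gv0. f v) = f v0 + (\<Sum>v\<in>verts G. f v)"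
  using v0 by (simp add: sum.remove)

lemma form_Gn_G:
  assumes "x v0 = 0" "y v0 = 0"
  shows "form Gn x y = form G x y"
  using assms by (simp add: form_def sum_verts intersection_G)

sublocale Gn: neg_def_graph Gn
  by unfold_locales (use neg_def_Gn in simp_all)

sublocale G: neg_def_graph G
proof unfold_locales
  show "neg_def G"
    unfolding neg_def_def
  proof (intro ballI impI)
    fix x assume x: "x \<in> H2_rat G" "x \<noteq> (\<lambda>v. 0)"
    then have "x \<in> H2_rat Gn" "x v0 = 0" by (auto simp: H2_rat_def)
    then show "form G x x < 0"
      using x(2) neg_def_Gn form_Gn_G[of x x] by (auto simp: neg_def_def)
  qed
qed simp

lemma Sigma0:
  shows Sigma0_mem: "\<Sigma>\<^sub>0 \<in> H2_rat G"
    and form_Sigma0: "v \<in> verts G \<Longrightarrow> form G \<Sigma>\<^sub>0 (vertex_class v) = of_int (PD_attached Gv0 v0 v)"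
  using theI'[OF G.dual_ex1[of "\<lambda>v. of_int (PD_attached Gv0 v0 v)"]]
  by (auto simp: Sigma0_def Let_def)

lemma Sigma0_v0 [simp]: "\<Sigma>\<^sub>0 v0 = 0"
  using Sigma0_mem by (simp add: H2_rat_def)

lemma Sigma_v0 [simp]: "\<Sigma> v0 = 1"
  by (simp add: Sigma_class_def vertex_class_def)

lemma Sigma_G: "v \<noteq> v0 \<Longrightarrow> \<Sigma> v = - \<Sigma>\<^sub>0 v"
  by (simp add: Sigma_class_def vertex_class_def)

lemma Sigma_mem: "\<Sigma> \<in> H2_rat Gn"
  using Sigma0_mem v0 by (auto simp: H2_rat_def Sigma_class_def vertex_class_def)

lemma form_vertex_class:
  assumes "u \<in> verts Gv0" "v \<in> verts Gv0"
  shows "form Gn (vertex_class u) (vertex_class v) = of_int (intersection Gn u v)"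
proof -
  have "form Gn (vertex_class u) (vertex_class v) =
      (\<Sum>w\<in>verts Gv0. if w = u then of_int (intersection Gn w v) else 0)"
    using form_vertex_right[of Gn v "vertex_class u"] assms
    by (simp only: verts_Gn finite_verts) (intro sum.cong; simp add: vertex_class_def)
  then show ?thesis using assms by simp
qed

text \<open>\<open>\<Sigma>\<^sub>0\<close> was chosen to pair with the vertices of \<open>G\<close>
  as \<open>v0\<close> does, so their difference pairs to zero.\<close>

lemma form_Sigma_G:
  assumes "v \<in> verts G"
  shows "form Gn \<Sigma> (vertex_class v) = 0"
proof -
  have "form Gn \<Sigma>\<^sub>0 (vertex_class v) = of_int (PD_attached Gv0 v0 v)"
    using form_Gn_G[of "\<Sigma>\<^sub>0" "vertex_class v"] form_Sigma0[OF assms] assms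
    by (auto simp: vertex_class_def)
  moreover have "form Gn (vertex_class v0) (vertex_class v) = of_int (PD_attached Gv0 v0 v)"
    using form_vertex_class[of v0 v] intersection_v0[OF assms] v0 assms by simp
  ultimately show ?thesis
    using assms by (simp add: Sigma_class_def form_diff_left)
qed

text \<open>By orthogonality only the coefficient at \<open>v0\<close> counts. The factor is found
  by inserting \<open>\<Sigma>\<close> itself, whose coefficient at \<open>v0\<close> is 1 and whose
  square is \<open>r\<close>.\<close>

lemma form_Sigma: "form Gn \<Sigma> x = x v0 * r"
proof -
  have *: "form Gn \<Sigma> x = form Gn \<Sigma> (vertex_class v0) * x v0" for x
    using form_expand[of Gn \<Sigma> x] by (simp add: sum_verts form_Sigma_G)
  show ?thesis using *[of x] *[of \<Sigma>] by (simp add: seifert_framing_def)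
qed

lemma r_neg: "r < 0"
proof -
  have "\<Sigma> \<noteq> (\<lambda>v. 0)" using Sigma_v0 by (metis zero_neq_one)
  then show ?thesis
    using neg_def_Gn Sigma_mem by (simp add: seifert_framing_def neg_def_def)
qed

lemma r_nonzero: "r \<noteq> 0"
  using r_neg by simp

text \<open>The class \<open>2 PD[S]\<close> evaluates on \<open>\<Sigma>\<close> to twice the
  intersection number of \<open>S\<close> and \<open>\<Sigma>\<close>, that is, to twice
  \<open>S v0 * r\<close>; \<open>A_hat\<close> takes half of it.\<close>

lemma A_hat_plus_class: "ah (plus_class Gn L S) = ah L + of_int (S v0) * r"
proof -
  have "(\<Sum>w\<in>verts Gv0. of_int (PD Gn S w) * \<Sigma> w) = of_int (S v0) * r"
    using sum_PD[of Gn S \<Sigma>] form_Sigma[of "\<lambda>v. of_int (S v)"] by (simp add: form_commute)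
  then have "(\<Sum>w\<in>verts Gv0. of_int (plus_class Gn L S w) * \<Sigma> w) =
      (\<Sum>w\<in>verts Gv0. of_int (L w) * \<Sigma> w) + 2 * (of_int (S v0) * r)"
    by (simp add: plus_class_def distrib_right sum.distrib mult.assoc flip: sum_distrib_left)
  then show ?thesis by (simp add: A_hat_def)
qed

lemma A_hat_cube_vertex: "ah (cube_vertex Gn L I) = ah L + (if v0 \<in> I then r else 0)"
  by (simp add: cube_vertex_def A_hat_plus_class)

lemma A_hat_v0: "ah (plus_class Gn L (vertex_class v0)) = ah L + r"
  by (simp add: A_hat_plus_class vertex_class_def)

text \<open>The part of \<open>S\<close> supported on \<open>G\<close> acts as usual; the
  coefficient at \<open>v0\<close> reaches \<open>G\<close> only through the edges at
  \<open>v0\<close>, as a multiple of the relative class of \<open>v0\<close>.\<close>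

lemma restrict_plus_class:
  "res (plus_class Gn L S) =
    (\<lambda>v. plus_class G (res L) S v + 2 * (S v0 * PD_attached Gv0 v0 v))"
proof
  fix v
  show "res (plus_class Gn L S) v = plus_class G (res L) S v + 2 * (S v0 * PD_attached Gv0 v0 v)"
  proof (cases "v \<in> verts G")
    case True
    then have "PD Gn S v = PD G S v + S v0 * PD_attached Gv0 v0 v"
      using intersection_v0[OF True] by (simp add: PD_def sum_verts intersection_G)
    then show ?thesis using True by (simp add: restrict_char_def plus_class_def)
  next
    case False
    then have "PD_attached Gv0 v0 v = 0" by (auto simp: PD_attached_def)
    then show ?thesis using False by (auto simp: restrict_char_def plus_class_def PD_def)
  qed
qed

lemma restrict_plus_class_G: 
  "S v0 = 0 \<Longrightarrow> res (plus_class Gn L S) = plus_class G (res L) S"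
  by (simp add: restrict_plus_class)

lemma restrict_cube_vertex: 
  "v0 \<notin> I \<Longrightarrow> res (cube_vertex Gn L I) = cube_vertex G (res L) I"
  by (simp add: cube_vertex_def restrict_plus_class_G)

lemma restrict_v0: "res (plus_class Gn L (vertex_class v0)) = addK (res L)"
proof -
  have "PD G (vertex_class v0) = (\<lambda>v. 0)"
    by (auto simp: PD_def vertex_class_def fun_eq_iff intro!: sum.neutral)
  then show ?thesis
    unfolding restrict_plus_class by (simp add: plus_attached_def plus_class_def vertex_class_def)
qed

text \<open>The restriction misses only the value at \<open>v0\<close>, and \<open>A_hat\<close> is
  affine in that value with slope 1/2 since \<open>\<Sigma> v0 = 1\<close>.\<close>

lemma char_eqI:
  assumes "\<And>v. v \<notin> verts Gv0 \<Longrightarrow> L v = L' v" "res L = res L'" "ah L = ah L'"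
  shows "L = L'"
proof
  fix v
  have G: "L v = L' v" if "v \<in> verts G" for v
    using fun_cong[OF assms(2), of v] that by (simp add: restrict_char_def)
  then have "(\<Sum>w\<in>verts G. of_int (L w) * \<Sigma> w) = (\<Sum>w\<in>verts G. of_int (L' w) * \<Sigma> w)"
    by (intro sum.cong) auto
  then have "L v0 = L' v0"
    using assms(3) by (simp add: A_hat_def sum_verts)
  then show "L v = L' v" using G assms(1) by (cases "v = v0"; cases "v \<in> verts Gv0") auto
qed

lemma square_split: "square Gn L = square G (res L) + (2 * ah L - r)\<^sup>2 / r"
proof -
  define a where "a = PD_inverse G (res L)"
  \<comment> \<open>The numerator is the value of \<open>L\<close> on \<open>\<Sigma>\<close> and
    \<open>r\<close> is the square of \<open>\<Sigma>\<close>, so \<open>s\<close> is the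
    coefficient of the orthogonal projection of the dual of \<open>L\<close> to
    \<open>\<Sigma>\<close>.\<close>
  define s where "s = (2 * ah L - r) / r"
  have a: "a \<in> H2_rat G" "a v0 = 0" using G.PD_inverse_mem[of "res L"] by (auto simp: a_def H2_rat_def)
  have ah: "2 * ah L - r = of_int (L v0) - (\<Sum>v\<in>verts G. of_int (L v) * \<Sigma>\<^sub>0 v)"
    by (simp add: A_hat_def sum_verts Sigma_G sum_negf diff_divide_distrib add_divide_distrib)
  have aS: "form Gn a \<Sigma> = 0" using form_Sigma[of a] a(2) by (simp add: form_commute)
  have "PD_inverse Gn L = (\<lambda>v. a v + s * \<Sigma> v)"
  proof (rule Gn.PD_inverse_eqI)
    show "(\<lambda>v. a v + s * \<Sigma> v) \<in> H2_rat Gn"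
      using a(1) Sigma_mem by (auto simp: H2_rat_def)
    fix v assume v: "v \<in> verts Gn"
    show "form Gn (\<lambda>v. a v + s * \<Sigma> v) (vertex_class v) = of_int (L v)"
    proof (cases "v = v0")
      case True
      \<comment> \<open>At \<open>v0\<close> the splitting
        \<open>v0 = \<Sigma> + \<Sigma>\<^sub>0\<close> is used: \<open>a\<close> is orthogonal to
        \<open>\<Sigma>\<close> and contributes the value of \<open>L\<close> on
        \<open>\<Sigma>\<^sub>0\<close>, while \<open>s * \<Sigma>\<close> contributes the value on
        \<open>\<Sigma>\<close>.\<close>
      have "vertex_class v0 = (\<lambda>v. \<Sigma> v + \<Sigma>\<^sub>0 v)"
        by (simp add: Sigma_class_def fun_eq_iff)
      then have "form Gn a (vertex_class v0) = form Gn a \<Sigma>\<^sub>0"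
        using aS by (simp add: form_add_right)
      also have "\<dots> = form G a \<Sigma>\<^sub>0" using a by (simp add: form_Gn_G)
      also have "\<dots> = (\<Sum>v\<in>verts G. form G a (vertex_class v) * \<Sigma>\<^sub>0 v)"
        by (rule form_expand) simp
      also have "\<dots> = (\<Sum>v\<in>verts G. of_int (L v) * \<Sigma>\<^sub>0 v)"
        by (intro sum.cong) (simp_all add: a_def G.form_PD_inverse restrict_char_def)
      finally have "form Gn a (vertex_class v0) = (\<Sum>v\<in>verts G. of_int (L v) * \<Sigma>\<^sub>0 v)" .
      moreover have "s * form Gn \<Sigma> (vertex_class v0) = 2 * ah L - r"
        using r_neg by (simp add: s_def form_Sigma vertex_class_def)
      ultimately show ?thesis
        using True ah by (simp add: form_add_left form_scale_left)
    next
      case False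
      with v have vG: "v \<in> verts G" by simp
      have "form Gn a (vertex_class v) = form G a (vertex_class v)"
        using a False by (simp add: form_Gn_G vertex_class_def)
      then show ?thesis
        using vG G.form_PD_inverse[OF vG, of "res L"]
        by (simp add: form_add_left form_scale_left form_Sigma_G a_def restrict_char_def)
    qed
  qed
  then have "square Gn L = form Gn a a + s * s * r"
    using aS form_commute[of Gn a \<Sigma>]
    by (simp add: square_def form_add_left form_add_right form_scale_left form_scale_right form_Sigma)
  also have "form Gn a a = square G (res L)"
    using a by (simp add: form_Gn_G square_def a_def)
  also have "s * s * r = (2 * ah L - r)\<^sup>2 / r"
    using r_neg unfolding s_def power2_eq_square by simp
  finally show ?thesis .
qed

text \<open>This is where \<open>gr\<close> comes from: its squared term is the extra square, and
  the summand 1/4 (the \<open>+ r\<close> in its numerator) is due to the additional vertex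
  \<open>v0\<close>.\<close>

lemma h_U_char_split: "h_U_char Gn L = h_U_char G (res L) + gr r (ah L)"
proof -
  have "card (verts Gv0) = Suc (card (verts G))"
    using card_Suc_Diff1[OF finite_verts v0] by simp
  then have "h_U_char Gn L = h_U_char G (res L) + ((2 * ah L - r)\<^sup>2 / r + 1) / 4"
    by (simp add: h_U_char_def square_split field_simps)
  also have "((2 * ah L - r)\<^sup>2 / r + 1) / 4 = gr r (ah L)"
    using r_neg by (simp add: gr_def field_simps)
  finally show ?thesis .
qed

text \<open>No vertex of the cube uses \<open>v0\<close>, so \<open>A_hat\<close> is constant on it
  and \<open>gr\<close> comes out of the minimum.\<close>

lemma h_U_side_b:
  assumes "v0 \<notin> E" "finite E"
  shows "h_U Gn (L, E) = h_U G (res L, E) + gr r (ah L)"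
proof -
  have "h_U_char Gn (cube_vertex Gn L I) = h_U_char G (cube_vertex G (res L) I) + gr r (ah L)"
    if "I \<in> Pow E" for I
  proof -
    have "v0 \<notin> I" using that assms(1) by auto
    then show ?thesis by (simp add: h_U_char_split restrict_cube_vertex A_hat_cube_vertex)
  qed
  then have "(\<lambda>I. h_U_char Gn (cube_vertex Gn L I)) ` Pow E =
      (\<lambda>I. h_U_char G (cube_vertex G (res L) I) + gr r (ah L)) ` Pow E"
    by (rule image_cong[OF refl])
  moreover have "Min ((\<lambda>I. h_U_char G (cube_vertex G (res L) I) + gr r (ah L)) ` Pow E) =
      Min ((\<lambda>I. h_U_char G (cube_vertex G (res L) I)) ` Pow E) + gr r (ah L)"
    using assms(2) by (intro Min_shift) auto
  ultimately show ?thesis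
    by (simp add: h_U_def setcompr_eq_image Pow_def)
qed

text \<open>The vertices of the cube are those of its two facets transverse to \<open>v0\<close>, at
  \<open>L\<close> and at \<open>L + v0\<close>. Each facet is covered by \<open>h_U_side_b\<close>;
  on the second one \<open>A_hat\<close> has grown by \<open>r\<close>, and \<open>gr_add\<close>
  turns this into the summand \<open>2 * ah L\<close>.\<close>

lemma h_U_side_a:
  assumes "v0 \<in> E" "finite E"
  shows "h_U Gn (L, E) =
    min (h_U G (res L, E - {v0})) (h_V Gv0 v0 (res L, E - {v0}) + 2 * ah L) + gr r (ah L)"
proof -
  let ?f = "\<lambda>L I. h_U_char Gn (cube_vertex Gn L I)"
  let ?L' = "plus_class Gn L (vertex_class v0)"
  have "Pow E = Pow (E - {v0}) \<union> insert v0 ` Pow (E - {v0})"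
    using assms(1) Pow_insert[of v0 "E - {v0}"] by (simp add: insert_absorb)
  moreover have "?f L ` insert v0 ` Pow (E - {v0}) = ?f ?L' ` Pow (E - {v0})"
    unfolding image_image
  proof (intro image_cong refl)
    fix I assume "I \<in> Pow (E - {v0})"
    then have "v0 \<notin> I" by auto
    then show "?f L (insert v0 I) = ?f ?L' I"
      by (simp add: cube_vertex_insert cube_vertex_plus_class)
  qed
  ultimately have "?f L ` Pow E = ?f L ` Pow (E - {v0}) \<union> ?f ?L' ` Pow (E - {v0})"
    by (simp add: image_Un)
  moreover have "Min (?f L ` Pow (E - {v0}) \<union> ?f ?L' ` Pow (E - {v0})) =
      min (Min (?f L ` Pow (E - {v0}))) (Min (?f ?L' ` Pow (E - {v0})))"
    by (rule Min_Un) (use assms(2) in auto)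
  ultimately have "h_U Gn (L, E) = min (h_U Gn (L, E - {v0})) (h_U Gn (?L', E - {v0}))"
    by (simp add: h_U_def setcompr_eq_image Pow_def)
  then show ?thesis
    using assms(2) by (simp add: h_U_side_b h_V_def restrict_v0 A_hat_v0 gr_add[OF r_nonzero] min_def)
qed

section \<open>\<open>Spin\<^sup>c\<close> structures of the surgery as classes of pairs\<close>

abbreviation "rp \<equiv> realized_pairs Gv0 v0 n"
abbreviation "X\<^sub>0 \<equiv> CFK Gv0 v0"

definition pair_of :: "('v \<Rightarrow> int) \<Rightarrow> ('v \<Rightarrow> int) set \<times> rat" where
  "pair_of L = (orbit G (res L), ah L)"

lemma restrict_characteristic:
  assumes "L \<in> characteristic Gn"
  shows "res L \<in> characteristic G"
  using assms by (auto simp: characteristic_def restrict_char_def intersection_G)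

text \<open>The restriction of \<open>L\<close> lies in exactly one orbit, so the pair realized by
  \<open>L\<close> is a function of \<open>L\<close>.\<close>

lemma realized_pairs_eq:
  assumes "s \<subseteq> characteristic Gn"
  shows "rp s = pair_of ` s"
proof -
  have "(t \<in> Spinc G \<and> res L \<in> t) \<longleftrightarrow> t = orbit G (res L)" if "L \<in> s" for t L
    using orbit_Spinc[of t G "res L"] orbit_self[of "res L" G]
      orbit_in_Spinc[OF restrict_characteristic, of L] assms that by auto
  then show ?thesis
    by (auto simp: realized_pairs_def Let_def pair_of_def)
qed

lemma Spinc_subset: "s \<in> Spinc Gn \<Longrightarrow> s \<subseteq> characteristic Gn"
  using Spinc_characteristic by blast

lemma surgery_pairs_eq: "surgery_pairs Gv0 v0 n = pair_of ` characteristic Gn"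
  by (simp add: surgery_pairs_def realized_pairs_eq)

lemma pair_of_mem: "s \<in> Spinc Gn \<Longrightarrow> L \<in> s \<Longrightarrow> pair_of L \<in> rp s"
  using realized_pairs_eq[OF Spinc_subset] by simp

lemma pair_of_v0:
  "pair_of (plus_class Gn L (vertex_class v0)) = (cshift X\<^sub>0 (fst (pair_of L)), snd (pair_of L) + r)"
  by (simp add: pair_of_def restrict_v0 A_hat_v0 orbit_plus_attached CFK_simps)

lemma realized_shift:
  assumes s: "s \<in> Spinc Gn" and "(t, i) \<in> rp s"
  shows "t \<in> cidx X\<^sub>0" "(cshift X\<^sub>0 t, i + r) \<in> rp s"
proof -
  obtain L where L: "L \<in> s" "pair_of L = (t, i)"
    using assms realized_pairs_eq[OF Spinc_subset[OF s]] by force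
  then show "(cshift X\<^sub>0 t, i + r) \<in> rp s"
    using pair_of_mem[OF s Spinc_plus_class[OF s L(1)], of "vertex_class v0"] by (simp add: pair_of_v0)
  show "t \<in> cidx X\<^sub>0"
    using L restrict_characteristic[of L] Spinc_subset[OF s]
    by (auto simp: pair_of_def CFK_simps intro: orbit_in_Spinc)
qed

lemma lift_exists:
  assumes s: "s \<in> Spinc Gn" and ti: "(t, i) \<in> rp s" and k: "k \<in> t"
  shows "\<exists>L\<in>s. res L = k \<and> ah L = i"
proof -
  obtain L where L: "L \<in> s" "t = orbit G (res L)" "ah L = i"
    using ti realized_pairs_eq[OF Spinc_subset[OF s]] by (auto simp: pair_of_def)
  then obtain S where S: "k = plus_class G (res L) S"
    using k by (auto simp: orbit_def)
  \<comment> \<open>The value of \<open>S\<close> at \<open>v0\<close> is invisible in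
    \<open>G\<close> but would change \<open>A_hat\<close>; setting it to zero keeps both
    coordinates under control.\<close>
  define S' where "S' = S(v0 := 0)"
  have "PD G S' = PD G S"
    by (auto simp: PD_def S'_def fun_eq_iff intro!: sum.cong)
  then have "res (plus_class Gn L S') = k"
    unfolding S by (subst restrict_plus_class_G) (simp_all add: S'_def plus_class_def)
  moreover have "ah (plus_class Gn L S') = i"
    using L(3) by (simp add: A_hat_plus_class S'_def)
  ultimately show ?thesis using Spinc_plus_class[OF s L(1)] by blast
qed

lemma char_eq:
  assumes "L \<in> characteristic Gn" "L' \<in> characteristic Gn" "res L = res L'" "ah L = ah L'"
  shows "L = L'"
  by (rule char_eqI) (use assms in \<open>auto simp: characteristic_def\<close>)

text \<open>A common pair can be realized in both orbits by classes with the same restriction and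
  the same \<open>A_hat\<close>; such classes are equal, and hence so are their orbits.\<close>

lemma realized_disjoint:
  assumes s: "s \<in> Spinc Gn" and s': "s' \<in> Spinc Gn" and p: "p \<in> rp s" "p \<in> rp s'"
  shows "s = s'"
proof -
  obtain L where L: "L \<in> s" "p = (orbit G (res L), ah L)"
    using p(1) realized_pairs_eq[OF Spinc_subset[OF s]] by (auto simp: pair_of_def)
  then obtain L' where L': "L' \<in> s'" "res L' = res L" "ah L' = ah L"
    using lift_exists[OF s', of "orbit G (res L)" "ah L" "res L"] p(2) orbit_self by auto
  have "L' = L"
    by (rule char_eq) (use L L' Spinc_subset[OF s] Spinc_subset[OF s'] in auto)
  then show ?thesis using orbit_Spinc[OF s L(1)] orbit_Spinc[OF s' L'(1)] by simp
qed

abbreviation "rel \<equiv> surgery_rel (surgery_pairs Gv0 v0 n) r (cshift X\<^sub>0)"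

lemma rel_v0:
  assumes "L \<in> characteristic Gn"
  shows "(pair_of L, pair_of (plus_class Gn L (vertex_class v0))) \<in> rel"
    and "(pair_of (plus_class Gn L (vertex_class v0)), pair_of L) \<in> rel"
proof -
  obtain t i where ti: "pair_of L = (t, i)" by fastforce
  then have eq: "pair_of (plus_class Gn L (vertex_class v0)) = (cshift X\<^sub>0 t, i + r)"
    by (simp add: pair_of_v0)
  have "(t, i) \<in> surgery_pairs Gv0 v0 n"
    unfolding surgery_pairs_eq ti[symmetric] by (rule imageI[OF assms])
  moreover have "(cshift X\<^sub>0 t, i + r) \<in> surgery_pairs Gv0 v0 n"
    unfolding surgery_pairs_eq eq[symmetric] by (rule imageI[OF characteristic_plus_class[OF assms]])
  ultimately have "((t, i), (cshift X\<^sub>0 t, i + r)) \<in> {((t, i), (cshift X\<^sub>0 t, i + r)) | t i.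
      (t, i) \<in> surgery_pairs Gv0 v0 n \<and> (cshift X\<^sub>0 t, i + r) \<in> surgery_pairs Gv0 v0 n}"
    by blast
  then show "(pair_of L, pair_of (plus_class Gn L (vertex_class v0))) \<in> rel"
    "(pair_of (plus_class Gn L (vertex_class v0)), pair_of L) \<in> rel"
    unfolding surgery_rel_def Let_def eq ti by (blast intro: r_into_rtrancl)+
qed

text \<open>Negative multiples are reached because the generating relation is symmetrized; hence the
  induction over integers in both directions.\<close>

lemma rel_multiple:
  assumes "L \<in> characteristic Gn"
  shows "(pair_of L, pair_of (plus_class Gn L (\<lambda>v. m * vertex_class v0 v))) \<in> rel"
proof (induction m rule: int_induct[of _ 0])
  case base
  have "plus_class Gn L (\<lambda>v. 0 * vertex_class v0 v) = L"
    by (auto simp: plus_class_def PD_def)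
  then show ?case by (simp add: surgery_rel_def Let_def)
next
  case (step1 m)
  have "plus_class Gn L (\<lambda>v. (m + 1) * vertex_class v0 v) =
      plus_class Gn (plus_class Gn L (\<lambda>v. m * vertex_class v0 v)) (vertex_class v0)"
    by (simp add: plus_class_add distrib_right)
  then show ?case
    using step1(2) rel_v0(1)[OF characteristic_plus_class[OF assms, of "\<lambda>v. m * vertex_class v0 v"]]
    unfolding surgery_rel_def Let_def by (simp only: rtrancl_trans)
next
  case (step2 m)
  have "plus_class Gn L (\<lambda>v. m * vertex_class v0 v) =
      plus_class Gn (plus_class Gn L (\<lambda>v. (m - 1) * vertex_class v0 v)) (vertex_class v0)"
    by (simp add: plus_class_add left_diff_distrib)
  then show ?case
    using step2(2) rel_v0(2)[OF characteristic_plus_class[OF assms, of "\<lambda>v. (m - 1) * vertex_class v0 v"]]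
    unfolding surgery_rel_def Let_def by (simp only: rtrancl_trans)
qed

lemma realized_class:
  assumes s: "s \<in> Spinc Gn" and p: "p \<in> rp s"
  shows "rel `` {p} = rp s"
proof
  let ?A = "surgery_pairs Gv0 v0 n"
  define R where "R = {((t, i), (cshift X\<^sub>0 t, i + r)) | t i. (t, i) \<in> ?A \<and> (cshift X\<^sub>0 t, i + r) \<in> ?A}"
  have rel: "rel = (R \<union> R\<inverse>)\<^sup>*" by (simp add: surgery_rel_def Let_def R_def)
  show "rel `` {p} \<subseteq> rp s"
  proof
    fix q assume "q \<in> rel `` {p}"
    then have "(p, q) \<in> (R \<union> R\<inverse>)\<^sup>*" by (simp add: rel)
    then show "q \<in> rp s"
    proof (induction rule: rtrancl_induct)
      case (step y z)
      consider t i where "y = (t, i)" "z = (cshift X\<^sub>0 t, i + r)"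
        | t i where "z = (t, i)" "y = (cshift X\<^sub>0 t, i + r)" "(t, i) \<in> ?A"
        using step(2) by (auto simp: R_def)
      then show ?case
      proof cases
        case 1
        then show ?thesis using realized_shift(2)[OF s] step(3) by simp
      next
        case 2
        then obtain L where L: "L \<in> characteristic Gn" "z = pair_of L"
          by (auto simp: surgery_pairs_eq)
        \<comment> \<open>For a backward step, \<open>z\<close> is placed in the orbit
          \<open>s'\<close> of some class realizing it. Its shift \<open>y\<close> then lies in the
          sets of pairs of both \<open>s'\<close> and \<open>s\<close>, which forces them to
          agree.\<close>
        define s' where "s' = orbit Gn L"
        have s': "s' \<in> Spinc Gn" "L \<in> s'" 
          using L(1) by (auto simp: s'_def orbit_in_Spinc orbit_self)
        have z: "z \<in> rp s'" using L(2) pair_of_mem[OF s'] by simp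
        then have "y \<in> rp s'" using realized_shift(2)[OF s'(1)] 2 by simp
        then have "s' = s" using realized_disjoint[OF s'(1) s] step(3) by simp
        then show ?thesis using z by simp
      qed
    qed (rule p)
  qed
  show "rp s \<subseteq> rel `` {p}"
  proof
    fix q assume "q \<in> rp s"
    then obtain L' where L': "L' \<in> s" "q = pair_of L'"
      using realized_pairs_eq[OF Spinc_subset[OF s]] by auto
    obtain L where L: "L \<in> s" "p = pair_of L"
      using p realized_pairs_eq[OF Spinc_subset[OF s]] by auto
    have "L' \<in> orbit Gn L" using orbit_Spinc[OF s L(1)] L'(1) by simp
    then obtain S where S: "L' = plus_class Gn L S" by (auto simp: orbit_def)
    \<comment> \<open>\<open>S\<close> is split into its multiple of \<open>v0\<close>, which moves
      the pair by generators of the relation, and a part \<open>T\<close> without \<open>v0\<close>,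
      which does not move the pair at all.\<close>
    define M where "M = plus_class Gn L (\<lambda>v. S v0 * vertex_class v0 v)"
    define T where "T = (\<lambda>v. S v - S v0 * vertex_class v0 v)"
    have M: "M \<in> s" using Spinc_plus_class[OF s L(1)] by (simp add: M_def)
    have T: "T v0 = 0" by (simp add: T_def vertex_class_def)
    have "L' = plus_class Gn M T" by (simp add: S M_def T_def plus_class_add)
    then have "pair_of L' = pair_of M"
      using orbit_eq[OF plus_class_orbit[OF orbit_self], of G "res M" T] T
      by (simp add: pair_of_def restrict_plus_class_G A_hat_plus_class)
    then show "q \<in> rel `` {p}"
      using rel_multiple[of L "S v0"] L L'(2) Spinc_subset[OF s] by (auto simp: M_def)
  qed
qed

lemma realized_pairs_quotient:
  assumes s: "s \<in> Spinc Gn"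
  shows "rp s \<in> surgery_pairs Gv0 v0 n // rel"
proof -
  obtain L where L: "L \<in> s" using Spinc_nonempty[OF s] by blast
  have "rp s = rel `` {pair_of L}" using realized_class[OF s pair_of_mem[OF s L]] by simp
  moreover have "pair_of L \<in> surgery_pairs Gv0 v0 n"
    using Spinc_subset[OF s] L by (auto simp: surgery_pairs_eq)
  ultimately show ?thesis by (auto simp: quotient_def)
qed

text \<open>Injectivity is disjointness of the sets of pairs; for surjectivity a class is the set of
  pairs of the orbit of any \<open>L\<close> realizing one of its members.\<close>

lemma bij_betw_realized_pairs:
  "bij_betw rp (Spinc Gn) (surgery_pairs Gv0 v0 n // rel)"
proof (intro bij_betw_imageI inj_onI)
  fix s s' assume "s \<in> Spinc Gn" "s' \<in> Spinc Gn" "rp s = rp s'"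
  then show "s = s'"
    using realized_disjoint[of s s'] Spinc_nonempty pair_of_mem by metis
next
  show "rp ` Spinc Gn = surgery_pairs Gv0 v0 n // rel"
  proof (intro equalityI subsetI)
    fix c assume "c \<in> surgery_pairs Gv0 v0 n // rel"
    then obtain L where L: "L \<in> characteristic Gn" "c = rel `` {pair_of L}"
      by (auto simp: quotient_def surgery_pairs_eq)
    have s: "orbit Gn L \<in> Spinc Gn" by (rule orbit_in_Spinc[OF L(1)])
    then have "c = rp (orbit Gn L)"
      using L(2) realized_class[OF s pair_of_mem[OF s orbit_self]] by simp
    then show "c \<in> rp ` Spinc Gn" using s by blast
  qed (auto simp: realized_pairs_quotient)
qed

text \<open>The action of the relative class of \<open>u0\<close>, expressed without
  \<open>u0\<close>: that class meets only \<open>v0\<close>, once.\<close>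

definition add_mu :: "('v \<Rightarrow> int) \<Rightarrow> ('v \<Rightarrow> int)" where
  "add_mu L = (\<lambda>v. L v + 2 * vertex_class v0 v)"

lemma restrict_add_mu [simp]: "res (add_mu L) = res L"
  by (auto simp: restrict_char_def add_mu_def vertex_class_def fun_eq_iff)

lemma A_hat_add_mu [simp]: "ah (add_mu L) = ah L + 1"
proof -
  have "(\<Sum>w\<in>verts G. of_int (add_mu L w) * \<Sigma> w) = (\<Sum>w\<in>verts G. of_int (L w) * \<Sigma> w)"
    by (intro sum.cong) (auto simp: add_mu_def vertex_class_def)
  then show ?thesis by (simp add: A_hat_def sum_verts add_mu_def vertex_class_def field_simps)
qed

lemma realized_pairs_add_mu:
  assumes "s \<in> Spinc Gn" "add_mu ` s \<in> Spinc Gn"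
  shows "rp (add_mu ` s) = mu_shift (rp s)"
  using realized_pairs_eq[OF Spinc_subset[OF assms(1)]] realized_pairs_eq[OF Spinc_subset[OF assms(2)]]
  by (simp add: mu_shift_def image_image pair_of_def)

section \<open>The diagram of cubes over the surgery category\<close>

abbreviation "I \<equiv> I_cat Gv0 v0 n"
abbreviation "move \<equiv> TB_cube_map Gv0 v0 n"
abbreviation "\<Phi>\<^sub>c \<equiv> Phi_cube_map Gv0 v0"

text \<open>As a function on cubes this makes visible that the classes occurring in
  \<open>TB\<close> form a partition.\<close>

definition cube_index :: "'v cube \<Rightarrow> ('v \<Rightarrow> int) set surgery_ob" where
  "cube_index = (\<lambda>(L, E). (orbit G (res L), ah L, if v0 \<in> E then Side_a else Side_b))"

definition index_cubes ::
  "('v \<Rightarrow> int) set \<Rightarrow> ('v \<Rightarrow> int) set surgery_ob \<Rightarrow> 'v cube set" where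
  "index_cubes s d = {c \<in> cubes Gn s. cube_index c = d}"

lemma I_eq: "I s = surgery_cat r (cshift X\<^sub>0) (rp s)"
  by (simp add: I_cat_def)

lemma move_simps [simp]:
  "move (Ident d) c = c"
  "move (Lam t i) (L, E) = (L, E - {v0})"
  "move (Rho t i) (L, E) = (plus_class Gn L (vertex_class v0), E - {v0})"
  by (simp_all add: TB_cube_map_def)

lemma TB_cat_eq:
  assumes s: "s \<in> Spinc Gn" and d: "d \<in> ob (I s)"
  shows "TB_cat Gv0 v0 n s d = face_cat Gn (index_cubes s d)"
proof -
  obtain t i z where d_eq: "d = (t, i, z)" and ti: "(t, i) \<in> rp s"
    using d by (auto simp: I_eq)
  have t: "t \<in> Spinc G" using realized_shift(1)[OF s ti] by (simp add: CFK_simps)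
  have "res L \<in> t \<longleftrightarrow> orbit G (res L) = t" for L
    using orbit_Spinc[OF t, of "res L"] orbit_self[of "res L" G] by auto
  moreover have "(v0 \<in> E \<longleftrightarrow> z = Side_a) \<longleftrightarrow> (if v0 \<in> E then Side_a else Side_b) = z" for E
    by (cases z) auto
  ultimately show ?thesis
    unfolding TB_cat_def d_eq index_cubes_def cube_index_def prod.case
    by (intro arg_cong[of _ _ "face_cat Gn"]) auto
qed

lemma cubes_plus_class:
  "s \<in> Spinc Gn \<Longrightarrow> (L, E) \<in> cubes Gn s \<Longrightarrow> (plus_class Gn L S, E - E') \<in> cubes Gn s"
  by (auto simp: cubes_def Spinc_plus_class)

lemma cube_index_mem:
  assumes "s \<in> Spinc Gn" "(L, E) \<in> cubes Gn s"
  shows "(orbit G (res L), ah L) \<in> rp s"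
  using pair_of_mem[OF assms(1), of L] assms(2) by (simp add: pair_of_def cubes_def)

text \<open>If \<open>v0\<close> is in both sets or in neither, the displacement avoids
  \<open>v0\<close>. It then preserves \<open>A_hat\<close> and acts on the restriction by a class
  of \<open>G\<close>.\<close>

lemma face_same_side:
  assumes "face_of Gn (L', E') (L, E)" "v0 \<in> E \<longleftrightarrow> v0 \<in> E'"
  shows "orbit G (res L') = orbit G (res L)" "ah L' = ah L"
proof -
  obtain J where J: "J \<subseteq> E - E'" "L' = cube_vertex Gn L J"
    using assms(1) by (auto simp: face_of_def)
  have "v0 \<notin> J" using J(1) assms(2) by auto
  then show "ah L' = ah L" "orbit G (res L') = orbit G (res L)"
    using J(2) orbit_eq[OF cube_vertex_orbit[OF orbit_self], of G "res L" J]
    by (simp_all add: A_hat_cube_vertex restrict_cube_vertex)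
qed

lemma move_mem:
  assumes s: "s \<in> Spinc Gn" and f: "f \<in> mor (I s)" and c: "c \<in> index_cubes s (src (I s) f)"
  shows "move f c \<in> index_cubes s (tgt (I s) f)"
proof -
  obtain L E where LE: "c = (L, E)" by fastforce
  from f have "f \<in> mor (surgery_cat r (cshift X\<^sub>0) (rp s))" by (simp add: I_eq)
  then show ?thesis
  proof (cases rule: surgery_mor_cases)
    case (Ident t i z)
    then show ?thesis using c by (simp add: I_eq)
  next
    case (Lam t i)
    then show ?thesis
      using c by (auto simp: I_eq LE index_cubes_def cube_index_def cubes_def)
  next
    case (Rho t i)
    then show ?thesis
      using c cubes_plus_class[OF s, of L E "vertex_class v0" "{v0}"] pair_of_v0[of L]
      by (auto simp: I_eq LE index_cubes_def cube_index_def pair_of_def)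
  qed
qed

text \<open>\<open>Lam\<close> and \<open>Rho\<close> pass to the two facets opposite each other in
  direction \<open>v0\<close>, with displacements \<open>{}\<close> and \<open>{v0}\<close>.\<close>

lemma move_face:
  assumes f: "f \<in> mor (I s)" and c: "c \<in> index_cubes s (src (I s) f)"
  shows "face_of Gn (move f c) c"
proof -
  obtain L E where LE: "c = (L, E)" by fastforce
  have V: "cube_vertex Gn L {v0} = plus_class Gn L (vertex_class v0)"
    using cube_vertex_insert[of v0 "{}" Gn L] by simp
  from f have "f \<in> mor (surgery_cat r (cshift X\<^sub>0) (rp s))" by (simp add: I_eq)
  then show ?thesis
  proof (cases rule: surgery_mor_cases)
    case (Ident t i z)
    then show ?thesis by (simp add: face_of_refl)
  next
    case (Lam t i)
    then show ?thesis by (auto simp: LE face_of_def intro!: exI[of _ "{}"])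
  next
    case (Rho t i)
    then have "v0 \<in> E" using c by (auto simp: I_eq LE index_cubes_def cube_index_def split: if_splits)
    then show ?thesis using V by (auto simp: Rho LE face_of_def intro!: exI[of _ "{v0}"])
  qed
qed

lemma move_cmp:
  assumes f: "f \<in> mor (I s)" and g: "g \<in> mor (I s)" and fg: "tgt (I s) f = src (I s) g"
  shows "move (cmp (I s) g f) c = move g (move f c)"
proof -
  obtain L E where LE: "c = (L, E)" by fastforce
  from f have f': "f \<in> mor (surgery_cat r (cshift X\<^sub>0) (rp s))" by (simp add: I_eq)
  from g have g': "g \<in> mor (surgery_cat r (cshift X\<^sub>0) (rp s))" by (simp add: I_eq)
  from f' show ?thesis
  proof (cases rule: surgery_mor_cases)
    case (Ident t i z)
    then show ?thesis by (simp add: I_eq)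
  next
    case (Lam t i)
    from g' show ?thesis by (cases rule: surgery_mor_cases) (use Lam fg in \<open>auto simp: I_eq LE\<close>)
  next
    case (Rho t i)
    from g' show ?thesis by (cases rule: surgery_mor_cases) (use Rho fg in \<open>auto simp: I_eq LE\<close>)
  qed
qed

lemma move_mono:
  assumes f: "f \<in> mor (I s)" and c: "c \<in> index_cubes s (src (I s) f)" "c' \<in> index_cubes s (src (I s) f)"
    and face: "face_of Gn c' c"
  shows "face_of Gn (move f c') (move f c)"
proof -
  obtain L E L' E' where LE: "c = (L, E)" "c' = (L', E')" by fastforce
  obtain J where J: "E' \<subseteq> E" "J \<subseteq> E - E'" "L' = cube_vertex Gn L J"
    using face by (auto simp: face_of_def LE)
  from f have "f \<in> mor (surgery_cat r (cshift X\<^sub>0) (rp s))" by (simp add: I_eq)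
  then show ?thesis
  proof (cases rule: surgery_mor_cases)
    case (Ident t i z)
    then show ?thesis using face by simp
  next
    case (Lam t i)
    \<comment> \<open>Both cubes contain the direction \<open>v0\<close>, so deleting it from both
      leaves the difference \<open>E - E'\<close>, and hence the displacement \<open>J\<close>,
      admissible.\<close>
    then have "v0 \<in> E'" using c by (auto simp: I_eq LE index_cubes_def cube_index_def split: if_splits)
    then have "E' - {v0} \<subseteq> E - {v0}" "J \<subseteq> (E - {v0}) - (E' - {v0})" using J by auto
    then show ?thesis using J(3) by (auto simp: Lam LE face_of_def)
  next
    case (Rho t i)
    then have "v0 \<in> E'" using c by (auto simp: I_eq LE index_cubes_def cube_index_def split: if_splits)
    then have "E' - {v0} \<subseteq> E - {v0}" "J \<subseteq> (E - {v0}) - (E' - {v0})" using J by auto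
    then show ?thesis using J(3) by (auto simp: Rho LE face_of_def cube_vertex_plus_class)
  qed
qed

lemma mor_ends:
  assumes s: "s \<in> Spinc Gn" and f: "f \<in> mor (I s)"
  shows "src (I s) f \<in> ob (I s)" "tgt (I s) f \<in> ob (I s)"
proof -
  from f have "f \<in> mor (surgery_cat r (cshift X\<^sub>0) (rp s))" by (simp add: I_eq)
  then show "src (I s) f \<in> ob (I s)" "tgt (I s) f \<in> ob (I s)"
    by (cases rule: surgery_mor_cases; use realized_shift(2)[OF s] in \<open>auto simp: I_eq\<close>)+
qed

lemma TB_simps:
  assumes s: "s \<in> Spinc Gn"
  shows "d \<in> ob (I s) \<Longrightarrow>
      dob (TB Gv0 v0 n s) d = hocolim (face_cat Gn (index_cubes s d)) (CFD Gn)"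
    and "f \<in> mor (I s) \<Longrightarrow>
      dmor (TB Gv0 v0 n s) f = hocolim_map (face_cat Gn (index_cubes s (src (I s) f)))
        (map_prod (move f) (move f)) (\<lambda>c n x. x)"
  using TB_cat_eq[OF s] mor_ends[OF s] by (simp_all add: TB_def)

lemma h_U_index_cubes:
  assumes "c \<in> index_cubes s d" "face_of Gn c' c"
  shows "h_U Gn c \<le> h_U Gn c'"
  using h_U_face[OF assms(2)] cubes_finite[of Gn c s] assms(1) by (simp add: index_cubes_def)

text \<open>Moves do not lower heights because they pass to faces, and \<open>h_U\<close> is
  monotone in faces.\<close>

lemma filtered_diagram_TB:
  assumes s: "s \<in> Spinc Gn"
  shows "filtered_diagram (I s) (TB Gv0 v0 n s)"
  unfolding filtered_diagram_def
proof (intro conjI ballI allI impI)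
  fix d assume d: "d \<in> ob (I s)"
  show "filtered_sset (dob (TB Gv0 v0 n s) d)"
    unfolding TB_simps(1)[OF s d]
    by (intro filtered_sset_hocolim filtered_diagram_point h_U_index_cubes)
  show "src (I s) (ide (I s) d) = d" by (simp add: I_eq)
  fix m x assume x: "x \<in> cells (dob (TB Gv0 v0 n s) d) m"
  obtain \<tau> u where x_eq: "x = (\<tau>, u)" by (rule prod.exhaust)
  have "\<tau> \<in> nerve (face_cat Gn (index_cubes s d)) m"
    using x by (simp add: x_eq TB_simps(1)[OF s d] cells_hocolim)
  moreover have "move (Ident d) = id" by (simp add: fun_eq_iff)
  moreover have "Ident d \<in> mor (I s)" using d by (auto simp: I_eq)
  ultimately show "dmor (TB Gv0 v0 n s) (ide (I s) d) m x = x"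
    using TB_simps(2)[OF s, of "Ident d"] nerve_restrict
    by (simp add: x_eq hocolim_map_apply I_eq map_prod.id)
next
  fix f assume f: "f \<in> mor (I s)"
  note ends = mor_ends[OF s f]
  show "src (I s) f \<in> ob (I s)" "tgt (I s) f \<in> ob (I s)" by (fact ends)+
  show "filtered_map (dob (TB Gv0 v0 n s) (src (I s) f)) (dob (TB Gv0 v0 n s) (tgt (I s) f))
      (dmor (TB Gv0 v0 n s) f)"
    unfolding TB_simps(1)[OF s ends(1)] TB_simps(1)[OF s ends(2)] TB_simps(2)[OF s f]
    by (rule filtered_map_face_hocolim)
      (auto intro: move_mem[OF s f] move_mono[OF f] h_U_index_cubes move_face[OF f])
  fix g m x assume g: "g \<in> mor (I s)" and fg: "tgt (I s) f = src (I s) g"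
    and x: "x \<in> cells (dob (TB Gv0 v0 n s) (src (I s) f)) m"
  obtain \<tau> u where x_eq: "x = (\<tau>, u)" by (rule prod.exhaust)
  have fg': "cmp (I s) g f \<in> mor (I s)"
  proof -
    from f have "f \<in> mor (surgery_cat r (cshift X\<^sub>0) (rp s))" by (simp add: I_eq)
    then show ?thesis using f g by (cases rule: surgery_mor_cases) (simp_all add: I_eq)
  qed
  have "move (cmp (I s) g f) = move g \<circ> move f"
    using move_cmp[OF f g fg] by (simp add: fun_eq_iff)
  then show "dmor (TB Gv0 v0 n s) (cmp (I s) g f) m x =
      dmor (TB Gv0 v0 n s) g m (dmor (TB Gv0 v0 n s) f m x)"
    by (simp add: TB_simps(2)[OF s f] TB_simps(2)[OF s g] TB_simps(2)[OF s fg'] x_eq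
        hocolim_map_apply restrict_def fun_eq_iff map_prod_def split: prod.splits)
qed

section \<open>Chains of cubes as chains of indices with cubes over the first index\<close>

lemma cells_hocolim_TB:
  assumes s: "s \<in> Spinc Gn"
  shows "(\<sigma>, \<tau>, u) \<in> cells (hocolim (I s) (TB Gv0 v0 n s)) m \<longleftrightarrow>
    \<sigma> \<in> nerve (I s) m \<and> \<tau> \<in> nerve (face_cat Gn (index_cubes s (src (I s) (\<sigma> (0, 0))))) m"
proof -
  have "src (I s) (\<sigma> (0, 0)) \<in> ob (I s)" if "\<sigma> \<in> nerve (I s) m"
    using mor_ends(1)[OF s nerveD(1)[OF that]] by simp
  then show ?thesis by (auto simp: cells_hocolim TB_simps(1)[OF s])
qed

text \<open>Member number \<open>j\<close> of the chain of cubes in \<open>CF\<close>: all cubes of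
  \<open>\<tau>\<close> lie over the first index and have to be moved along the chain.\<close>

abbreviation "image_cube \<sigma> \<tau> j \<equiv> move (\<sigma> (0, j)) (fst (\<tau> (j, j)))"

lemma TB_hocolim_to_CF_apply:
  "TB_hocolim_to_CF Gv0 v0 n m (\<sigma>, \<tau>, u) =
    (\<lambda>(j, k)\<in>tri m. (image_cube \<sigma> \<tau> j, image_cube \<sigma> \<tau> k), u)"
  by (simp add: TB_hocolim_to_CF_def Let_def)

text \<open>Reads off from a cube and one of its faces the arrow between their indices. When
  \<open>v0\<close> is lost, an unchanged \<open>A_hat\<close> means the facet at \<open>L\<close>,
  a changed one the facet at \<open>L + v0\<close>.\<close>

definition cube_arrow :: "'v cube \<Rightarrow> 'v cube \<Rightarrow> ('v \<Rightarrow> int) set surgery_mor" where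
  "cube_arrow = (\<lambda>(L, E) (L', E').
     if v0 \<in> E \<and> v0 \<notin> E'
     then if ah L' = ah L then Lam (orbit G (res L)) (ah L) else Rho (orbit G (res L)) (ah L)
     else Ident (cube_index (L, E)))"

text \<open>The preimage of the second cube under the move along \<open>cube_arrow\<close>: it takes
  a member of a chain back to the class of the first one.\<close>

definition cube_lift :: "'v cube \<Rightarrow> 'v cube \<Rightarrow> 'v cube" where
  "cube_lift = (\<lambda>(L, E) (L', E').
     if v0 \<in> E \<and> v0 \<notin> E'
     then (if ah L' = ah L then L' else plus_class Gn L' (\<lambda>v. - vertex_class v0 v), insert v0 E')
     else (L', E'))"

text \<open>One half of the bijection: index and cube can be read off from a moved cube. For
  \<open>Rho\<close> the decisive point is \<open>r \<noteq> 0\<close>, which keeps it apart from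
  \<open>Lam\<close>.\<close>

lemma arrow_lift_move:
  assumes f: "f \<in> mor (I s)"
    and c: "c \<in> index_cubes s (src (I s) f)" "c' \<in> index_cubes s (src (I s) f)"
  shows "cube_arrow c (move f c') = f" "cube_lift c (move f c') = c'"
proof -
  obtain L E L' E' where LE: "c = (L, E)" "c' = (L', E')" by fastforce
  have "f \<in> mor (surgery_cat r (cshift X\<^sub>0) (rp s))" using f by (simp add: I_eq)
  then have "cube_arrow c (move f c') = f \<and> cube_lift c (move f c') = c'"
  proof (cases rule: surgery_mor_cases)
    case (Ident t i z)
    then show ?thesis
      using c by (auto simp: I_eq LE index_cubes_def cube_index_def cube_arrow_def cube_lift_def split: if_splits)
  next
    case (Lam t i)
    then show ?thesis
      using c by (auto simp: I_eq LE index_cubes_def cube_index_def cube_arrow_def cube_lift_def split: if_splits)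
  next
    case (Rho t i)
    then show ?thesis
      using c r_neg
      by (auto simp: I_eq LE index_cubes_def cube_index_def cube_arrow_def cube_lift_def
          A_hat_v0 plus_class_minus split: if_splits)
  qed
  then show "cube_arrow c (move f c') = f" "cube_lift c (move f c') = c'" by simp_all
qed

text \<open>The alternative is whether the displacement contains \<open>v0\<close>; in the second
  case \<open>J\<close> is the displacement without it.\<close>

lemma face_cases [consumes 3, case_names Lam Rho]:
  assumes "face_of Gn (L', E') (L, E)" "v0 \<in> E" "v0 \<notin> E'"
  obtains (Lam) J where "v0 \<notin> J" "E' \<subseteq> E" "J \<subseteq> E - insert v0 E'" "L' = cube_vertex Gn L J"
      "ah L' = ah L"
    | (Rho) J where "v0 \<notin> J" "E' \<subseteq> E" "J \<subseteq> E - insert v0 E'"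
      "L' = plus_class Gn (cube_vertex Gn L J) (vertex_class v0)" "ah L' \<noteq> ah L"
proof -
  obtain J where J: "E' \<subseteq> E" "J \<subseteq> E - E'" "L' = cube_vertex Gn L J"
    using assms(1) by (auto simp: face_of_def)
  show thesis
  proof (cases "v0 \<in> J")
    case True
    then have "L' = plus_class Gn (cube_vertex Gn L (J - {v0})) (vertex_class v0)"
      using cube_vertex_insert[of v0 "J - {v0}" Gn L] J(3) by (simp add: insert_absorb)
    moreover have "ah L' \<noteq> ah L" using True J(3) r_neg by (simp add: A_hat_cube_vertex)
    moreover have "J - {v0} \<subseteq> E - insert v0 E'" using J(2) by auto
    ultimately show thesis using Rho[of "J - {v0}"] J(1) by simp
  next
    case False
    moreover have "J \<subseteq> E - insert v0 E'" using J(2) False by auto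
    ultimately show thesis using Lam[of J] J by (simp add: A_hat_cube_vertex)
  qed
qed

text \<open>The other half of the bijection: every face arises by a move from a cube with the same
  index as \<open>c\<close>.\<close>

lemma arrow_lift:
  assumes s: "s \<in> Spinc Gn" and c: "c \<in> cubes Gn s" "c' \<in> cubes Gn s" and face: "face_of Gn c' c"
  shows "cube_arrow c c' \<in> mor (I s)"
    and "src (I s) (cube_arrow c c') = cube_index c"
    and "tgt (I s) (cube_arrow c c') = cube_index c'"
    and "cube_lift c c' \<in> index_cubes s (cube_index c)"
    and "move (cube_arrow c c') (cube_lift c c') = c'"
proof -
  obtain L E L' E' where LE: "c = (L, E)" "c' = (L', E')" by fastforce
  have E': "E' \<subseteq> E" using face by (auto simp: face_of_def LE)
  have ti: "(orbit G (res L), ah L) \<in> rp s" using cube_index_mem[OF s] c(1) by (simp add: LE)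
  have verts: "E' \<subseteq> verts Gn" "L' \<in> s" using c(2) by (auto simp: LE cubes_def)
  have "cube_arrow c c' \<in> mor (I s) \<and> src (I s) (cube_arrow c c') = cube_index c \<and>
      tgt (I s) (cube_arrow c c') = cube_index c' \<and> cube_lift c c' \<in> index_cubes s (cube_index c) \<and>
      move (cube_arrow c c') (cube_lift c c') = c'"
  proof (cases "v0 \<in> E \<and> v0 \<notin> E'")
    case True
    have orb: "orbit G (res (cube_vertex Gn L J)) = orbit G (res L)" if "v0 \<notin> J" for J
      using orbit_eq[OF cube_vertex_orbit[OF orbit_self], of G "res L" J] that
      by (simp add: restrict_cube_vertex)
    have "face_of Gn (L', E') (L, E)" "v0 \<in> E" "v0 \<notin> E'" using face True by (simp_all add: LE)
    then show ?thesis
    proof (cases rule: face_cases)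
      case (Lam J)
      then show ?thesis
        using True ti verts v0 orb[OF Lam(1)]
        by (auto simp: LE cube_arrow_def cube_lift_def cube_index_def I_eq index_cubes_def cubes_def)
    next
      case (Rho J)
      have unshift: "plus_class Gn L' (\<lambda>v. - vertex_class v0 v) = cube_vertex Gn L J"
        unfolding Rho(4) by (rule plus_class_minus)
      have "cube_vertex Gn L J \<in> s" using Spinc_cube_vertex[OF s] c(1) by (simp add: LE cubes_def)
      moreover have "ah (cube_vertex Gn L J) = ah L" using Rho(1) by (simp add: A_hat_cube_vertex)
      moreover have "(orbit G (res L'), ah L') = (cshift X\<^sub>0 (orbit G (res L)), ah L + r)"
        using pair_of_v0[of "cube_vertex Gn L J"] orb[OF Rho(1)] Rho(1)
        by (simp add: pair_of_def Rho(4) A_hat_cube_vertex)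
      ultimately show ?thesis
        using True ti verts v0 orb[OF Rho(1)] Rho(4,5) unshift
        by (auto simp: LE cube_arrow_def cube_lift_def cube_index_def I_eq index_cubes_def cubes_def)
    qed
  next
    case False
    then have "cube_index c' = cube_index c"
      using face_same_side[of L' E' L E] face E' by (auto simp: LE cube_index_def)
    moreover have "cube_arrow c c' = Ident (cube_index c)" "cube_lift c c' = c'"
      using False by (auto simp: LE cube_arrow_def cube_lift_def)
    ultimately show ?thesis using ti c(2) by (auto simp: I_eq index_cubes_def LE cube_index_def)
  qed
  then show "cube_arrow c c' \<in> mor (I s)"
    and "src (I s) (cube_arrow c c') = cube_index c"
    and "tgt (I s) (cube_arrow c c') = cube_index c'"
    and "cube_lift c c' \<in> index_cubes s (cube_index c)"
    and "move (cube_arrow c c') (cube_lift c c') = c'"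
    by simp_all
qed

text \<open>The direction \<open>v0\<close> is lost at most once. The step that keeps its status
  gives an identity and does not change \<open>A_hat\<close>, so the other arrow is the
  composite.\<close>

lemma arrow_cmp:
  assumes "face_of Gn c' c" "face_of Gn c'' c'"
  shows "cube_arrow c c'' = cmp (I s) (cube_arrow c' c'') (cube_arrow c c')"
proof -
  obtain L E L' E' L'' E'' where LE: "c = (L, E)" "c' = (L', E')" "c'' = (L'', E'')"
    by (metis surj_pair)
  have sub: "E' \<subseteq> E" "E'' \<subseteq> E'" using assms by (auto simp: face_of_def LE)
  show ?thesis
    using face_same_side[of L' E' L E] face_same_side[of L'' E'' L' E'] assms sub
    by (cases "v0 \<in> E"; cases "v0 \<in> E'"; cases "v0 \<in> E''")
      (auto simp: LE cube_arrow_def cube_index_def I_eq)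
qed

text \<open>Ensures that a chain of faces stays one after being taken back to the first class. The
  cases are whether and where \<open>v0\<close> is lost on the way from \<open>c\<close> to
  \<open>c''\<close>.\<close>

lemma lift_mono:
  assumes "face_of Gn c' c" "face_of Gn c'' c'"
  shows "face_of Gn (cube_lift c c'') (cube_lift c c')"
proof -
  obtain L E L' E' L'' E'' where LE: "c = (L, E)" "c' = (L', E')" "c'' = (L'', E'')"
    by (metis surj_pair)
  have sub: "E' \<subseteq> E" "E'' \<subseteq> E'" using assms by (auto simp: face_of_def LE)
  consider "v0 \<notin> E \<or> v0 \<in> E''" | "v0 \<in> E" "v0 \<in> E'" "v0 \<notin> E''" | "v0 \<in> E" "v0 \<notin> E'"
    using sub by blast
  then show ?thesis
  proof cases
    case 1
    then have "cube_lift c c'' = c''" "cube_lift c c' = c'"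
      using sub by (auto simp: LE cube_lift_def)
    then show ?thesis using assms(2) by simp
  next
    \<comment> \<open>Lost in the second step: \<open>c'\<close> is its own lift, and restoring
      \<open>v0\<close> in \<open>c''\<close> removes it from the displacement.\<close>
    case 2
    have ah: "ah L' = ah L" using face_same_side(2)[of L' E' L E] assms(1) 2 by (simp add: LE)
    have "face_of Gn (L'', E'') (L', E')" using assms(2) by (simp add: LE)
    from this 2(2,3) show ?thesis
    proof (cases rule: face_cases)
      case (Lam J)
      have "cube_lift (L, E) (L'', E'') = (L'', insert v0 E'')" "cube_lift (L, E) (L', E') = (L', E')"
        using 2 ah Lam(5) by (simp_all add: cube_lift_def)
      then show ?thesis
        using face_ofI[of "insert v0 E''" E' J L'' Gn L'] 2(2) Lam(2-4) by (simp add: LE)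
    next
      case (Rho J)
      have "plus_class Gn L'' (\<lambda>v. - vertex_class v0 v) = cube_vertex Gn L' J"
        unfolding Rho(4) by (rule plus_class_minus)
      then have "cube_lift (L, E) (L'', E'') = (cube_vertex Gn L' J, insert v0 E'')"
          "cube_lift (L, E) (L', E') = (L', E')"
        using 2 ah Rho(5) by (simp_all add: cube_lift_def)
      then show ?thesis
        using face_ofI[of "insert v0 E''" E' J _ Gn L'] 2(2) Rho(2,3) by (simp add: LE)
    qed
  next
    \<comment> \<open>Lost in the first step: \<open>A_hat\<close> agrees on \<open>c'\<close> and
      \<open>c''\<close>, so both lifts undo the same move, and this translation commutes with the
      displacement.\<close>
    case 3
    then have v0: "v0 \<notin> E''" using sub by auto
    have ah: "ah L'' = ah L'" using face_same_side(2)[of L'' E'' L' E'] assms(2) 3 v0 by (simp add: LE)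
    obtain J where J: "J \<subseteq> E' - E''" "L'' = cube_vertex Gn L' J"
      using assms(2) by (auto simp: face_of_def LE)
    have "insert v0 E'' \<subseteq> insert v0 E'" "J \<subseteq> insert v0 E' - insert v0 E''" using J(1) sub 3 by auto
    then show ?thesis
      using 3 v0 ah face_ofI[of "insert v0 E''" "insert v0 E'" J _ Gn]
      by (simp add: LE cube_lift_def J(2) flip: cube_vertex_plus_class)
  qed
qed

lemma image_cube:
  assumes s: "s \<in> Spinc Gn" and \<sigma>: "\<sigma> \<in> nerve (I s) m"
    and \<tau>: "\<tau> \<in> nerve (face_cat Gn (index_cubes s (src (I s) (\<sigma> (0, 0))))) m"
    and jk: "j \<le> k" "k \<le> m"
  shows "image_cube \<sigma> \<tau> j \<in> index_cubes s (src (I s) (\<sigma> (j, k)))"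
    and "face_of Gn (image_cube \<sigma> \<tau> k) (image_cube \<sigma> \<tau> j)"
    and "cube_arrow (image_cube \<sigma> \<tau> j) (image_cube \<sigma> \<tau> k) = \<sigma> (j, k)"
    and "cube_lift (fst (\<tau> (0, 0))) (image_cube \<sigma> \<tau> j) = fst (\<tau> (j, j))"
proof -
  have jm: "j \<le> m" using jk by simp
  note N = nerveD(1,3)[OF \<sigma> le0 jm]
  have tgt: "tgt (I s) (\<sigma> (0, j)) = src (I s) (\<sigma> (j, k))" by (rule nerveD(6)[OF \<sigma> le0 jm jk])
  have cmp: "\<sigma> (0, k) = cmp (I s) (\<sigma> (j, k)) (\<sigma> (0, j))" by (rule nerveD(5)[OF \<sigma> le0 jm jk])
  have jk_mor: "\<sigma> (j, k) \<in> mor (I s)" by (rule nerveD(1)[OF \<sigma> jk])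
  have mem: "fst (\<tau> (i, i)) \<in> index_cubes s (src (I s) (\<sigma> (0, j)))" if "i \<le> m" for i
    using face_nerveD(2)[OF \<tau> order_refl that] N(2) by simp
  have face: "face_of Gn (fst (\<tau> (k, k))) (fst (\<tau> (j, j)))" by (rule face_nerveD(4)[OF \<tau> jk])
  show j: "image_cube \<sigma> \<tau> j \<in> index_cubes s (src (I s) (\<sigma> (j, k)))"
    using move_mem[OF s N(1) mem[OF jm]] tgt by simp
  have k: "move (\<sigma> (0, j)) (fst (\<tau> (k, k))) \<in> index_cubes s (src (I s) (\<sigma> (j, k)))"
    using move_mem[OF s N(1) mem[OF jk(2)]] tgt by simp
  \<comment> \<open>Both cubes are first brought to index \<open>j\<close>; there they are related
    by a face, and only cube \<open>k\<close> is moved on.\<close>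
  have eq: "image_cube \<sigma> \<tau> k = move (\<sigma> (j, k)) (move (\<sigma> (0, j)) (fst (\<tau> (k, k))))"
    unfolding cmp by (rule move_cmp[OF N(1) jk_mor tgt])
  show "face_of Gn (image_cube \<sigma> \<tau> k) (image_cube \<sigma> \<tau> j)"
    unfolding eq
    by (rule face_of_trans[OF move_face[OF jk_mor k] move_mono[OF N(1) mem[OF jm] mem[OF jk(2)] face]])
  show "cube_arrow (image_cube \<sigma> \<tau> j) (image_cube \<sigma> \<tau> k) = \<sigma> (j, k)"
    unfolding eq by (rule arrow_lift_move(1)[OF jk_mor j k])
  show "cube_lift (fst (\<tau> (0, 0))) (image_cube \<sigma> \<tau> j) = fst (\<tau> (j, j))"
    by (rule arrow_lift_move(2)[OF N(1) mem[OF le0] mem[OF jm]])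
qed

text \<open>The first cube stays put because \<open>\<sigma> (0, 0)\<close> is an identity; hence
  the identification with \<open>CF\<close> preserves heights.\<close>

lemma image_cube_0:
  assumes "\<sigma> \<in> nerve (I s) m"
  shows "image_cube \<sigma> \<tau> 0 = fst (\<tau> (0, 0))"
  using nerveD(2)[OF assms order_refl le0] by (auto simp: I_eq)

text \<open>The height \<open>h\<close> is left open, since cells do not depend on it, so that the
  target may also be the doubly filtered set of \<open>u0\<close>.\<close>

lemma bij_betw_TB_hocolim_to_CF:
  assumes s: "s \<in> Spinc Gn"
  shows "bij_betw (TB_hocolim_to_CF Gv0 v0 n m)
    (cells (hocolim (I s) (TB Gv0 v0 n s)) m) (cells (hocolim (D_cat Gn s) (point_diagram h)) m)"
proof -
  \<comment> \<open>The inverse: the arrows come from pairs of cubes in the chain, and each cube is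
    lifted to the class of cube number 0.\<close>
  define decompose where "decompose = (\<lambda>(\<kappa> :: nat \<times> nat \<Rightarrow> 'v cube \<times> 'v cube, u :: unit).
    (\<lambda>(j, k)\<in>tri m. cube_arrow (fst (\<kappa> (j, j))) (fst (\<kappa> (k, k))),
     \<lambda>(j, k)\<in>tri m. (cube_lift (fst (\<kappa> (0, 0))) (fst (\<kappa> (j, j))), cube_lift (fst (\<kappa> (0, 0))) (fst (\<kappa> (k, k)))),
     u))"
  have dest: "\<exists>\<sigma> \<tau> u. y = (\<sigma>, \<tau>, u) \<and> \<sigma> \<in> nerve (I s) m \<and>
      \<tau> \<in> nerve (face_cat Gn (index_cubes s (src (I s) (\<sigma> (0, 0))))) m"
    if "y \<in> cells (hocolim (I s) (TB Gv0 v0 n s)) m" for y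
    using that cells_hocolim_TB[OF s] by (metis surj_pair)
  have to: "TB_hocolim_to_CF Gv0 v0 n m y \<in> cells (hocolim (D_cat Gn s) (point_diagram h)) m"
    and decompose_to: "decompose (TB_hocolim_to_CF Gv0 v0 n m y) = y"
    if "y \<in> cells (hocolim (I s) (TB Gv0 v0 n s)) m" for y
  proof -
    from dest[OF that] obtain \<sigma> \<tau> u where y: "y = (\<sigma>, \<tau>, u)" and \<sigma>: "\<sigma> \<in> nerve (I s) m"
      and \<tau>: "\<tau> \<in> nerve (face_cat Gn (index_cubes s (src (I s) (\<sigma> (0, 0))))) m"
      by blast
    note im = image_cube[OF s \<sigma> \<tau>]
    have "(\<lambda>(j, k)\<in>tri m. (image_cube \<sigma> \<tau> j, image_cube \<sigma> \<tau> k)) \<in> nerve (face_cat Gn (cubes Gn s)) m"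
    proof (rule face_nerveI)
      show "image_cube \<sigma> \<tau> j \<in> cubes Gn s" if "j \<le> m" for j
        using im(1)[OF order_refl that] by (simp add: index_cubes_def)
    qed (rule im(2))
    then show "TB_hocolim_to_CF Gv0 v0 n m y \<in> cells (hocolim (D_cat Gn s) (point_diagram h)) m"
      by (simp add: y TB_hocolim_to_CF_apply cells_hocolim D_cat_def)
    have "(\<lambda>(j, k)\<in>tri m. cube_arrow (image_cube \<sigma> \<tau> j) (image_cube \<sigma> \<tau> k)) = \<sigma>"
      using im(3) by (intro extensionalityI[of _ "tri m"] nerve_extensional[OF \<sigma>]) auto
    moreover have "(\<lambda>(j, k)\<in>tri m. (cube_lift (fst (\<tau> (0, 0))) (image_cube \<sigma> \<tau> j),
        cube_lift (fst (\<tau> (0, 0))) (image_cube \<sigma> \<tau> k))) = \<tau>"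
    proof (subst (3) face_nerve_eq[OF \<tau>], rule restrict_ext, clarsimp)
      fix j k assume "j \<le> k" "k \<le> m"
      then show "cube_lift (fst (\<tau> (0, 0))) (image_cube \<sigma> \<tau> j) = fst (\<tau> (j, j)) \<and>
          cube_lift (fst (\<tau> (0, 0))) (image_cube \<sigma> \<tau> k) = fst (\<tau> (k, k))"
        using im(4)[of j k] im(4)[of k k] by simp
    qed
    moreover have "decompose (TB_hocolim_to_CF Gv0 v0 n m y) =
       (\<lambda>(j, k)\<in>tri m. cube_arrow (image_cube \<sigma> \<tau> j) (image_cube \<sigma> \<tau> k),
        \<lambda>(j, k)\<in>tri m. (cube_lift (fst (\<tau> (0, 0))) (image_cube \<sigma> \<tau> j),
          cube_lift (fst (\<tau> (0, 0))) (image_cube \<sigma> \<tau> k)), u)"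
      using image_cube_0[OF \<sigma>, of \<tau>]
      by (auto simp: decompose_def y TB_hocolim_to_CF_apply fun_eq_iff restrict_def)
    ultimately show "decompose (TB_hocolim_to_CF Gv0 v0 n m y) = y" by (simp add: y)
  qed
  have from_decompose: "decompose z \<in> cells (hocolim (I s) (TB Gv0 v0 n s)) m"
    and to_decompose: "TB_hocolim_to_CF Gv0 v0 n m (decompose z) = z"
    if "z \<in> cells (hocolim (D_cat Gn s) (point_diagram h)) m" for z
  proof -
    from that obtain \<kappa> u where z: "z = (\<kappa>, u)" and \<kappa>: "\<kappa> \<in> nerve (face_cat Gn (cubes Gn s)) m"
      by (cases z) (auto simp: cells_hocolim D_cat_def)
    define c where "c j = fst (\<kappa> (j, j))" for j
    have c: "c j \<in> cubes Gn s" if "j \<le> m" for j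
      using face_nerveD(2)[OF \<kappa> order_refl that] by (simp add: c_def)
    have face: "face_of Gn (c k) (c j)" if "j \<le> k" "k \<le> m" for j k
      using face_nerveD(4)[OF \<kappa> that] by (simp add: c_def)
    have al: "cube_arrow (c j) (c k) \<in> mor (I s)" "src (I s) (cube_arrow (c j) (c k)) = cube_index (c j)"
      "tgt (I s) (cube_arrow (c j) (c k)) = cube_index (c k)"
      "cube_lift (c j) (c k) \<in> index_cubes s (cube_index (c j))"
      "move (cube_arrow (c j) (c k)) (cube_lift (c j) (c k)) = c k"
      if "j \<le> k" "k \<le> m" for j k
      using arrow_lift[OF s c c face] that by auto
    define \<sigma> where "\<sigma> = (\<lambda>(j, k)\<in>tri m. cube_arrow (c j) (c k))"
    define \<tau> where "\<tau> = (\<lambda>(j, k)\<in>tri m. (cube_lift (c 0) (c j), cube_lift (c 0) (c k)))"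
    have decompose: "decompose z = (\<sigma>, \<tau>, u)" by (simp add: z decompose_def \<sigma>_def \<tau>_def c_def)
    have "\<sigma> \<in> nerve (I s) m"
      unfolding nerve_def mem_Collect_eq
    proof (intro conjI ballI allI impI)
      show "\<sigma> \<in> extensional (tri m)" by (simp add: \<sigma>_def)
      show "\<sigma> p \<in> mor (I s)" if "p \<in> tri m" for p
        using that al(1) by (cases p) (simp add: \<sigma>_def)
      show "\<sigma> (j, j) \<in> ide (I s) ` ob (I s)" if "j \<le> m" for j
      proof -
        have "cube_arrow (c j) (c j) = Ident (cube_index (c j))"
          by (cases "c j") (simp add: cube_arrow_def)
        moreover have "cube_index (c j) \<in> ob (I s)"
          using mor_ends(1)[OF s al(1)[OF order_refl that]] al(2)[OF order_refl that] by simp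
        ultimately show ?thesis using that by (simp add: \<sigma>_def I_eq)
      qed
      fix j k l assume jkl: "j \<le> k \<and> k \<le> l \<and> l \<le> m"
      then show "tgt (I s) (\<sigma> (j, k)) = src (I s) (\<sigma> (k, l))"
        using al(3)[of j k] al(2)[of k l] by (simp add: \<sigma>_def)
      show "\<sigma> (j, l) = cmp (I s) (\<sigma> (k, l)) (\<sigma> (j, k))"
        using arrow_cmp[OF face[of j k] face[of k l], of s] jkl by (simp add: \<sigma>_def)
    qed
    moreover have "\<tau> \<in> nerve (face_cat Gn (index_cubes s (cube_index (c 0)))) m"
      unfolding \<tau>_def
    proof (rule face_nerveI)
      show "face_of Gn (cube_lift (c 0) (c k)) (cube_lift (c 0) (c j))" if "j \<le> k" "k \<le> m" for j k
        using lift_mono[OF face[of 0 j] face[of j k]] that by simp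
    qed (use al(4) in auto)
    moreover have "src (I s) (\<sigma> (0, 0)) = cube_index (c 0)"
      using al(2)[of 0 0] by (simp add: \<sigma>_def)
    ultimately show "decompose z \<in> cells (hocolim (I s) (TB Gv0 v0 n s)) m"
      by (simp add: decompose cells_hocolim_TB[OF s])
    have im: "image_cube \<sigma> \<tau> j = c j" if "j \<le> m" for j
      using al(5)[OF le0 that] that by (simp add: \<sigma>_def \<tau>_def)
    have "(\<lambda>(j, k)\<in>tri m. (image_cube \<sigma> \<tau> j, image_cube \<sigma> \<tau> k)) = (\<lambda>(j, k)\<in>tri m. (c j, c k))"
      using im by (intro restrict_ext) auto
    also have "\<dots> = \<kappa>" using face_nerve_eq[OF \<kappa>] by (simp add: c_def)
    finally show "TB_hocolim_to_CF Gv0 v0 n m (decompose z) = z"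
      unfolding decompose TB_hocolim_to_CF_apply by (simp add: z)
  qed
  show ?thesis
    by (rule bij_betw_byWitness[of _ decompose]) (use to decompose_to from_decompose to_decompose in auto)
qed

text \<open>An operator that drops the first indices makes \<open>TB\<close> transport the cubes to
  index \<open>\<theta> 0\<close>. Moving on from there gives the same cubes as moving from the
  start, by functoriality of moves.\<close>

lemma TB_hocolim_to_CF_act:
  assumes s: "s \<in> Spinc Gn" and \<theta>: "\<theta> \<in> simplex_arrows l m"
    and y: "y \<in> cells (hocolim (I s) (TB Gv0 v0 n s)) m"
  shows "TB_hocolim_to_CF Gv0 v0 n l (act (hocolim (I s) (TB Gv0 v0 n s)) l m \<theta> y) =
    act (hocolim (D_cat Gn s) (point_diagram h)) l m \<theta> (TB_hocolim_to_CF Gv0 v0 n m y)"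
proof -
  obtain \<sigma> \<tau> u where y_eq: "y = (\<sigma>, \<tau>, u)" by (metis surj_pair)
  have \<sigma>: "\<sigma> \<in> nerve (I s) m"
    and \<tau>: "\<tau> \<in> nerve (face_cat Gn (index_cubes s (src (I s) (\<sigma> (0, 0))))) m"
    using y cells_hocolim_TB[OF s] by (auto simp: y_eq)
  have le: "\<theta> 0 \<le> \<theta> j" "\<theta> j \<le> m" if "j \<le> l" for j
    using simplex_arrowsD[OF \<theta> le0 that] by auto
  have le0m: "\<theta> 0 \<le> m" using le[OF le0] by simp
  have ob: "src (I s) (\<sigma> (0, 0)) \<in> ob (I s)" using mor_ends(1)[OF s nerveD(1)[OF \<sigma>]] by simp
  have mor: "\<sigma> (0, \<theta> 0) \<in> mor (I s)" by (rule nerveD(1)[OF \<sigma> le0 le0m])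
  have im: "move (\<sigma> (\<theta> 0, \<theta> j)) (move (\<sigma> (0, \<theta> 0)) c) = move (\<sigma> (0, \<theta> j)) c" if "j \<le> l" for j c
    using move_cmp[OF mor nerveD(1)[OF \<sigma> le(1,2)[OF that]] nerveD(6)[OF \<sigma> le0 le0m le(1,2)[OF that]], of c]
      nerveD(5)[OF \<sigma> le0 le0m le(1,2)[OF that]] by simp
  have fst_\<tau>: "fst (\<tau> (\<theta> j, \<theta> k)) = fst (\<tau> (\<theta> j, \<theta> j))" if "j \<le> k" "k \<le> l" for j k
    using face_nerveD(1)[OF \<tau> simplex_arrowsD[OF \<theta> that]] by (metis fst_conv)
  define \<sigma>' where "\<sigma>' = (\<lambda>(j, k)\<in>tri l. \<sigma> (\<theta> j, \<theta> k))"
  define \<tau>' where "\<tau>' = (\<lambda>p\<in>tri l. map_prod (move (\<sigma> (0, \<theta> 0))) (move (\<sigma> (0, \<theta> 0)))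
    ((\<lambda>(j, k)\<in>tri l. \<tau> (\<theta> j, \<theta> k)) p))"
  have "act (hocolim (I s) (TB Gv0 v0 n s)) l m \<theta> y = (\<sigma>', \<tau>', u)"
    by (simp add: y_eq act_hocolim \<sigma>'_def \<tau>'_def TB_simps(1)[OF s ob] TB_simps(2)[OF s mor] hocolim_map_apply)
  moreover have "image_cube \<sigma>' \<tau>' j = image_cube \<sigma> \<tau> (\<theta> j)" if "j \<le> l" for j
    using im[OF that] that by (simp add: \<sigma>'_def \<tau>'_def)
  then have "(\<lambda>(j, k)\<in>tri l. (image_cube \<sigma>' \<tau>' j, image_cube \<sigma>' \<tau>' k)) =
      (\<lambda>(j, k)\<in>tri l. (\<lambda>(j, k)\<in>tri m. (image_cube \<sigma> \<tau> j, image_cube \<sigma> \<tau> k)) (\<theta> j, \<theta> k))"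
    using simplex_arrowsD[OF \<theta>] by (intro restrict_ext) auto
  ultimately show ?thesis
    by (simp add: y_eq TB_hocolim_to_CF_apply act_hocolim)
qed

section \<open>The isomorphism\<close>

text \<open>The height of \<open>XD\<close> at index \<open>i\<close> and side \<open>z\<close>, as
  a function on the cubes of \<open>G\<close>; it presents the values of \<open>XD\<close> again as
  homotopy colimits of points.\<close>

definition surgery_height :: "rat \<Rightarrow> side \<Rightarrow> 'v cube \<Rightarrow> rat" where
  "surgery_height i z c = (case z of
     Side_a \<Rightarrow> min (h_U G c) (h_V Gv0 v0 c + 2 * i) | Side_b \<Rightarrow> h_U G c) + gr r i"

lemma Phi_cube_map_apply: "\<Phi>\<^sub>c (L, E) = (res L, E - {v0})"
  by (simp add: Phi_cube_map_def)

lemma h_U_Gn: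
  assumes "c \<in> index_cubes s (t, i, z)"
  shows "h_U Gn c = surgery_height i z (\<Phi>\<^sub>c c)"
proof -
  obtain L E where c: "c = (L, E)" by fastforce
  have "finite E" using assms cubes_finite[of Gn c s] by (simp add: index_cubes_def c)
  then show ?thesis
    using assms h_U_side_a[of E L] h_U_side_b[of E L]
    by (auto simp: c Phi_cube_map_apply index_cubes_def cube_index_def surgery_height_def split: if_splits)
qed

lemma XD_ob_eq:
  "XD_ob r X\<^sub>0 (t, i, z) = hocolim (D_cat G t) (point_diagram (surgery_height i z))"
  by (cases z) (simp_all add: XD_ob_def ht_shift_def A_star_def p1_def with_ht_def CFK_simps
      hocolim_def surgery_height_def point_diagram_def point_def fun_eq_iff split: prod.splits)

lemma p1_XKD: "p1 (dob (XKD r X\<^sub>0) (t, i, z)) = XD_ob r X\<^sub>0 (t, i, z)"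
  by (cases z) (simp_all add: XKD_def XD_def XD_ob_def p1_def with_ht_def ht_shift_def A_star_def)

text \<open>With \<open>i\<close> fixed, the restriction determines \<open>L\<close>, and each
  member of \<open>t\<close> lifts. With \<open>z\<close> fixed, it is known whether
  \<open>v0\<close> belongs to \<open>E\<close>.\<close>

lemma bij_betw_Phi_cube_map:
  assumes s: "s \<in> Spinc Gn" and ti: "(t, i) \<in> rp s"
  shows "bij_betw \<Phi>\<^sub>c (index_cubes s (t, i, z)) (cubes G t)"
  unfolding bij_betw_def
proof (intro conjI inj_onI)
  fix c c' assume c: "c \<in> index_cubes s (t, i, z)" and c': "c' \<in> index_cubes s (t, i, z)"
    and eq: "\<Phi>\<^sub>c c = \<Phi>\<^sub>c c'"
  obtain L E L' E' where LE: "c = (L, E)" "c' = (L', E')" by fastforce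
  have "L = L'"
    by (rule char_eq) (use c c' eq Spinc_subset[OF s] in \<open>auto simp: LE Phi_cube_map_apply
        index_cubes_def cube_index_def cubes_def\<close>)
  moreover have "E = E'"
    using c c' eq by (auto simp: LE Phi_cube_map_apply index_cubes_def cube_index_def split: if_splits)
  ultimately show "c = c'" by (simp add: LE)
next
  have t: "t \<in> Spinc G" using realized_shift(1)[OF s ti] by (simp add: CFK_simps)
  show "\<Phi>\<^sub>c ` index_cubes s (t, i, z) = cubes G t"
  proof (rule equalityI; rule subsetI)
    fix c assume "c \<in> \<Phi>\<^sub>c ` index_cubes s (t, i, z)"
    then obtain L E where "(L, E) \<in> index_cubes s (t, i, z)" "c = (res L, E - {v0})"
      by (auto simp: Phi_cube_map_apply)
    then show "c \<in> cubes G t"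
      using orbit_self by (auto simp: index_cubes_def cube_index_def cubes_def)
  next
    fix c assume c: "c \<in> cubes G t"
    obtain k E where kE: "c = (k, E)" by fastforce
    obtain L where L: "L \<in> s" "res L = k" "ah L = i"
      using lift_exists[OF s ti, of k] c by (auto simp: kE cubes_def)
    define E' where "E' = (case z of Side_a \<Rightarrow> insert v0 E | Side_b \<Rightarrow> E)"
    have "E \<subseteq> verts Gv0 - {v0}" using c by (auto simp: kE cubes_def)
    then have E': "E' \<subseteq> verts Gn" "E' - {v0} = E" "(if v0 \<in> E' then Side_a else Side_b) = z"
      using v0 by (cases z; auto simp: E'_def)+
    have "orbit G k = t" using orbit_Spinc[OF t] c by (simp add: kE cubes_def)
    then have "(L, E') \<in> index_cubes s (t, i, z)"
      using L E' by (simp add: index_cubes_def cube_index_def cubes_def)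
    moreover have "\<Phi>\<^sub>c (L, E') = c" using L E' by (simp add: Phi_cube_map_apply kE)
    ultimately show "c \<in> \<Phi>\<^sub>c ` index_cubes s (t, i, z)" by force
  qed
qed

text \<open>Within one class no displacement uses \<open>v0\<close>, so it is the same in
  \<open>G\<close> and in \<open>Gv0(n)\<close>; it is recovered from the restriction because
  \<open>A_hat\<close> is fixed.\<close>

lemma Phi_cube_map_face:
  assumes s: "s \<in> Spinc Gn"
    and c: "c \<in> index_cubes s (t, i, z)" "c' \<in> index_cubes s (t, i, z)"
  shows "face_of G (\<Phi>\<^sub>c c') (\<Phi>\<^sub>c c) \<longleftrightarrow> face_of Gn c' c"
proof -
  obtain L E L' E' where LE: "c = (L, E)" "c' = (L', E')" by fastforce
  have side: "v0 \<in> E \<longleftrightarrow> v0 \<in> E'" and ah: "ah L = i" "ah L' = i"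
    and mem: "L \<in> s" "L' \<in> s"
    using c by (auto simp: LE index_cubes_def cube_index_def cubes_def split: if_splits)
  have sub: "E' - {v0} \<subseteq> E - {v0} \<longleftrightarrow> E' \<subseteq> E" using side by blast
  have diff: "(E - {v0}) - (E' - {v0}) = E - E'" using side by blast
  have "res L' = cube_vertex G (res L) J \<longleftrightarrow> L' = cube_vertex Gn L J" if "J \<subseteq> E - E'" for J
  proof -
    have J: "v0 \<notin> J" using that side by blast
    show ?thesis
    proof
      assume eq: "res L' = cube_vertex G (res L) J"
      show "L' = cube_vertex Gn L J"
        by (rule char_eq) (use eq J ah mem Spinc_subset[OF s] Spinc_cube_vertex[OF s mem(1), of J] in
            \<open>auto simp: restrict_cube_vertex A_hat_cube_vertex\<close>)
    qed (simp add: restrict_cube_vertex J)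
  qed
  then show ?thesis
    unfolding LE Phi_cube_map_apply face_of_def prod.case sub diff by blast
qed

lemma Phi_eq:
  assumes "s \<in> Spinc Gn" "d \<in> ob (I s)"
  shows "Phi Gv0 v0 n s d =
    hocolim_map (face_cat Gn (index_cubes s d)) (map_prod \<Phi>\<^sub>c \<Phi>\<^sub>c) (\<lambda>c m x. x)"
  using TB_cat_eq[OF assms] by (simp add: Phi_def)

text \<open>Naturality of \<open>Phi\<close>: \<open>Lam\<close> disappears since \<open>v0\<close>
  is removed anyway, and adding the class of \<open>v0\<close> restricts on \<open>G\<close> to the
  translation that defines the flip map of \<open>CFK\<close>.\<close>

lemma Phi_move:
  assumes s: "s \<in> Spinc Gn" and f: "f \<in> mor (I s)"
    and x: "x \<in> cells (dob (TB Gv0 v0 n s) (src (I s) f)) m"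
  shows "dmor (XKD r X\<^sub>0) f m (Phi Gv0 v0 n s (src (I s) f) m x) =
    Phi Gv0 v0 n s (tgt (I s) f) m (dmor (TB Gv0 v0 n s) f m x)"
proof -
  obtain \<tau> u where x_eq: "x = (\<tau>, u)" by (rule prod.exhaust)
  note eqs = Phi_eq[OF s mor_ends(1)[OF s f]] Phi_eq[OF s mor_ends(2)[OF s f]] TB_simps(2)[OF s f]
  from f have "f \<in> mor (surgery_cat r (cshift X\<^sub>0) (rp s))" by (simp add: I_eq)
  then show ?thesis
  proof (cases rule: surgery_mor_cases)
    case (Ident t i z)
    then show ?thesis
      unfolding eqs by (auto simp: x_eq hocolim_map_apply prod.map_comp o_def intro!: restrict_ext)
  next
    case (Lam t i)
    have "(\<lambda>c. \<Phi>\<^sub>c (move (Lam t i) c)) = \<Phi>\<^sub>c"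
      by (auto simp: Phi_cube_map_apply)
    then show ?thesis
      unfolding eqs by (auto simp: Lam x_eq hocolim_map_apply prod.map_comp o_def intro!: restrict_ext)
  next
    case (Rho t i)
    have "(\<lambda>c. \<Phi>\<^sub>c (move (Rho t i) c)) = (\<lambda>c. map_prod addK id (\<Phi>\<^sub>c c))"
      by (auto simp: Phi_cube_map_apply restrict_v0)
    then show ?thesis
      unfolding eqs
      by (auto simp: Rho x_eq hocolim_map_apply prod.map_comp o_def CFK_simps intro!: restrict_ext)
  qed
qed

abbreviation "hocolim_Phi' s \<equiv> hocolim_map (I s) id (Phi Gv0 v0 n s)"

text \<open>Besides first heights this yields compatibility with the simplicial operators, which
  \<open>p1\<close> leaves unchanged.\<close>

lemma filtered_map_hocolim_Phi:
  assumes s: "s \<in> Spinc Gn"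
  shows "filtered_map (hocolim (I s) (TB Gv0 v0 n s)) (p1 (hocolim (I s) (XKD r X\<^sub>0))) (hocolim_Phi' s)"
  unfolding p1_hocolim
proof (rule filtered_map_hocolim[OF functor_on_id filtered_diagram_TB[OF s]])
  fix d assume d: "d \<in> ob (I s)"
  obtain t i z where d_eq: "d = (t, i, z)" and ti: "(t, i) \<in> rp s" using d by (auto simp: I_eq)
  show "filtered_map (dob (TB Gv0 v0 n s) d) (dob (map_diagram p1 (XKD r X\<^sub>0)) (id d)) (Phi Gv0 v0 n s d)"
    unfolding TB_simps(1)[OF s d] Phi_eq[OF s d] map_diagram_simps id_apply
    unfolding d_eq p1_XKD XD_ob_eq D_cat_def
  proof (rule filtered_map_face_hocolim)
    show "h_U Gn c \<le> h_U Gn c'" if "c \<in> index_cubes s (t, i, z)" "face_of Gn c' c" for c c'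
      using that by (rule h_U_index_cubes)
  qed (use bij_betwE[OF bij_betw_Phi_cube_map[OF s ti]] in \<open>auto simp: h_U_Gn Phi_cube_map_face[OF s]\<close>)
next
  fix f m x assume "f \<in> mor (I s)" "x \<in> cells (dob (TB Gv0 v0 n s) (src (I s) f)) m"
  then show "dmor (map_diagram p1 (XKD r X\<^sub>0)) (id f) m (Phi Gv0 v0 n s (src (I s) f) m x) =
      Phi Gv0 v0 n s (tgt (I s) f) m (dmor (TB Gv0 v0 n s) f m x)"
    using Phi_move[OF s] by simp
qed

lemma bij_betw_hocolim_Phi:
  assumes s: "s \<in> Spinc Gn"
  shows "bij_betw (hocolim_Phi' s m) (cells (hocolim (I s) (TB Gv0 v0 n s)) m)
    (cells (hocolim (I s) (XKD r X\<^sub>0)) m)"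
proof (rule bij_betw_hocolim_map[OF functor_on_id functor_on_id])
  fix d assume d: "d \<in> ob (I s)"
  obtain t i z where d_eq: "d = (t, i, z)" and ti: "(t, i) \<in> rp s" using d by (auto simp: I_eq)
  have cells: "cells (dob (XKD r X\<^sub>0) (id d)) m = cells (hocolim (D_cat G t) (point_diagram (h_U G))) m"
    by (simp add: d_eq CFK_simps hocolim_def)
  show "bij_betw (Phi Gv0 v0 n s d m) (cells (dob (TB Gv0 v0 n s) d) m)
      (cells (dob (XKD r X\<^sub>0) (id d)) m)"
    unfolding TB_simps(1)[OF s d] Phi_eq[OF s d] cells
    unfolding d_eq D_cat_def
    by (rule bij_betw_face_hocolim[OF bij_betw_Phi_cube_map[OF s ti]]) (rule Phi_cube_map_face[OF s])
qed (simp_all add: mor_ends(1)[OF s])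

lemma hocolim_Phi_apply:
  assumes s: "s \<in> Spinc Gn" and y: "y \<in> cells (hocolim (I s) (TB Gv0 v0 n s)) m"
  shows "hocolim_Phi Gv0 v0 n s m (TB_hocolim_to_CF Gv0 v0 n m y) = hocolim_Phi' s m y"
  using inv_into_f_f[OF bij_betw_imp_inj_on[OF bij_betw_TB_hocolim_to_CF[OF s]] y]
  by (simp add: hocolim_Phi_def)

text \<open>The cube translated by \<open>add_mu\<close> has the same image under
  \<open>\<Phi>\<^sub>c\<close> and an index larger by one, so \<open>h_U_Gn\<close>, applied to
  both cubes, gives both heights.\<close>

lemma ht_hocolim_Phi:
  assumes s: "s \<in> Spinc Gn" and y: "(\<sigma>, \<tau>, u) \<in> cells (hocolim (I s) (TB Gv0 v0 n s)) m"
  shows "ht (hocolim (I s) (XKD r X\<^sub>0)) m (hocolim_Phi' s m (\<sigma>, \<tau>, u)) =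
    (h_U Gn (fst (\<tau> (0, 0))), h_U Gn (map_prod add_mu id (fst (\<tau> (0, 0)))))"
proof -
  have \<sigma>: "\<sigma> \<in> nerve (I s) m"
    and \<tau>: "\<tau> \<in> nerve (face_cat Gn (index_cubes s (src (I s) (\<sigma> (0, 0))))) m"
    using y cells_hocolim_TB[OF s] by auto
  have ob: "src (I s) (\<sigma> (0, 0)) \<in> ob (I s)" using mor_ends(1)[OF s nerveD(1)[OF \<sigma>]] by simp
  then obtain t i z where d: "src (I s) (\<sigma> (0, 0)) = (t, i, z)" by (auto simp: I_eq)
  obtain L E where c: "fst (\<tau> (0, 0)) = (L, E)" by fastforce
  have mem: "(L, E) \<in> index_cubes s (t, i, z)"
    using face_nerveD(2)[OF \<tau>, of 0 0] by (simp add: d c)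
  then have mem': "(add_mu L, E) \<in> index_cubes (add_mu ` s) (t, i + 1, z)"
    by (auto simp: index_cubes_def cube_index_def cubes_def)
  have "ht (hocolim (I s) (XKD r X\<^sub>0)) m (hocolim_Phi' s m (\<sigma>, \<tau>, u)) =
      (surgery_height i z (\<Phi>\<^sub>c (L, E)), surgery_height (i + 1) z (\<Phi>\<^sub>c (L, E)))"
    using Phi_eq[OF s ob]
    by (simp add: hocolim_map_apply ht_hocolim d XD_ob_eq c map_prod_def case_prod_beta D_cat_def)
  moreover have "\<Phi>\<^sub>c (add_mu L, E) = \<Phi>\<^sub>c (L, E)" by (simp add: Phi_cube_map_apply)
  ultimately show ?thesis
    using h_U_Gn[OF mem] h_U_Gn[OF mem'] by (simp add: c)
qed

text \<open>The flip map lifted to the homotopy colimit of \<open>TB\<close>. It mediates between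
  the flip maps of the two collections, since \<open>hocolim_Phi\<close> can be evaluated only after
  undoing the identification with \<open>CF\<close>.\<close>

definition TB_flip where
  "TB_flip s = hocolim_map (I s) index_shift (\<lambda>d. hocolim_map (TB_cat Gv0 v0 n s d)
    (map_prod (map_prod add_mu id) (map_prod add_mu id)) (\<lambda>c m x. x))"

lemma move_add_mu: "move (index_shift f) (map_prod add_mu id c) = map_prod add_mu id (move f c)"
proof -
  have "plus_class Gn (add_mu L) S = add_mu (plus_class Gn L S)" for L S
    by (simp add: plus_class_def add_mu_def fun_eq_iff)
  then show ?thesis
    by (cases f; cases c) (auto simp: index_shift_def split: prod.splits)
qed

lemma cube_vertex_add_mu: "cube_vertex Gn (add_mu L) J = add_mu (cube_vertex Gn L J)"
  by (simp add: cube_vertex_def plus_class_def add_mu_def fun_eq_iff)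

lemma face_of_add_mu:
  assumes "face_of Gn c' c"
  shows "face_of Gn (map_prod add_mu id c') (map_prod add_mu id c)"
proof -
  obtain L E L' E' where LE: "c = (L, E)" "c' = (L', E')" by fastforce
  then obtain J where J: "E' \<subseteq> E" "J \<subseteq> E - E'" "L' = cube_vertex Gn L J"
    using assms by (auto simp: face_of_def)
  have "face_of Gn (add_mu L', E') (add_mu L, E)"
    by (rule face_ofI[OF J(1,2)]) (simp add: J(3) cube_vertex_add_mu)
  then show ?thesis by (simp add: LE)
qed

lemma TB_flip_mem:
  assumes s: "s \<in> Spinc Gn" and s': "add_mu ` s \<in> Spinc Gn"
    and y: "y \<in> cells (hocolim (I s) (TB Gv0 v0 n s)) m"
  shows "TB_flip s m y \<in> cells (hocolim (I (add_mu ` s)) (TB Gv0 v0 n (add_mu ` s))) m"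
proof -
  let ?S = "\<lambda>(t, i, z). (t, i + 1, z)"
  have I': "I (add_mu ` s) = surgery_cat r (cshift X\<^sub>0) (mu_shift (rp s))"
    by (simp add: I_eq realized_pairs_add_mu[OF s s'])
  have shift: "functor_on (I s) (I (add_mu ` s)) ?S index_shift"
    unfolding I' unfolding I_eq by (rule functor_on_index_shift)
  show ?thesis
    unfolding TB_flip_def
  proof (rule cells_hocolim_map[OF shift filtered_diagram_TB[OF s] _ y])
    fix d x assume d: "d \<in> ob (I s)" and x: "x \<in> cells (dob (TB Gv0 v0 n s) d) m"
    have d': "?S d \<in> ob (I (add_mu ` s))" by (rule functor_onD(1)[OF shift d])
    have shift_cubes: "functor_on (face_cat Gn (index_cubes s d)) (face_cat Gn (index_cubes (add_mu ` s) (?S d)))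
        (map_prod add_mu id) (map_prod (map_prod add_mu id) (map_prod add_mu id))"
      by (rule functor_on_face_cat)
        (auto simp: index_cubes_def cube_index_def cubes_def intro: face_of_add_mu)
    have F: "filtered_diagram (face_cat Gn (index_cubes s d)) (CFD Gn)"
      by (rule filtered_diagram_point) (rule h_U_index_cubes)
    show "hocolim_map (TB_cat Gv0 v0 n s d) (map_prod (map_prod add_mu id) (map_prod add_mu id))
        (\<lambda>c m x. x) m x \<in> cells (dob (TB Gv0 v0 n (add_mu ` s)) (?S d)) m"
      unfolding TB_simps(1)[OF s' d'] TB_cat_eq[OF s d]
      by (rule cells_hocolim_map[OF shift_cubes F]) (use x in \<open>simp_all add: TB_simps(1)[OF s d]\<close>)
  qed
qed

lemma TB_hocolim_to_CF_flip:
  assumes s: "s \<in> Spinc Gn" and y: "y \<in> cells (hocolim (I s) (TB Gv0 v0 n s)) m"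
  shows "TB_hocolim_to_CF Gv0 v0 n m (TB_flip s m y) =
    hocolim_map (D_cat Gn s) (map_prod (map_prod add_mu id) (map_prod add_mu id)) (\<lambda>c m x. x) m
      (TB_hocolim_to_CF Gv0 v0 n m y)"
proof -
  obtain \<sigma> \<tau> u where y_eq: "y = (\<sigma>, \<tau>, u)" by (metis surj_pair)
  show ?thesis
    by (auto simp: y_eq TB_flip_def hocolim_map_apply TB_hocolim_to_CF_apply move_add_mu intro!: restrict_ext)
qed

text \<open>\<open>\<Phi>\<^sub>c\<close> does not see \<open>add_mu\<close>, so only the shift of
  the index remains of the lifted flip.\<close>

lemma hocolim_Phi_flip:
  assumes s: "s \<in> Spinc Gn" and s': "add_mu ` s \<in> Spinc Gn"
    and y: "y \<in> cells (hocolim (I s) (TB Gv0 v0 n s)) m"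
  shows "hocolim_Phi' (add_mu ` s) m (TB_flip s m y) =
    hocolim_map (I s) index_shift (\<lambda>d n x. x) m (hocolim_Phi' s m y)"
proof -
  obtain \<sigma> \<tau> u where y_eq: "y = (\<sigma>, \<tau>, u)" by (metis surj_pair)
  have "(\<lambda>c. \<Phi>\<^sub>c (map_prod add_mu id c)) = \<Phi>\<^sub>c"
    by (auto simp: Phi_cube_map_apply)
  then show ?thesis
    by (auto simp: y_eq TB_flip_def hocolim_map_apply Phi_def prod.map_comp o_def intro!: restrict_ext)
qed

lemma flip_collection_XK_CFK:
  assumes "\<And>s. s \<in> Spinc Gn \<Longrightarrow> add_mu ` s \<in> Spinc Gn"
  shows "flip_collection (XK (surgery_pairs Gv0 v0 n) r X\<^sub>0)"
proof (rule flip_collection_XK)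
  show "flip_collection X\<^sub>0" by (rule flip_collection_CFK) simp
  show "r \<noteq> 0" by (rule r_nonzero)
  fix c assume "c \<in> surgery_pairs Gv0 v0 n // rel"
  then obtain s where s: "s \<in> Spinc Gn" "c = rp s"
    using bij_betw_imp_surj_on[OF bij_betw_realized_pairs] by blast
  show "t \<in> cidx X\<^sub>0 \<and> (cshift X\<^sub>0 t, i + r) \<in> c" if "(t, i) \<in> c" for t i
    using realized_shift[OF s(1)] that by (simp add: s(2))
  show "mu_shift c \<in> surgery_pairs Gv0 v0 n // rel"
    using realized_pairs_quotient[OF assms[OF s(1)]] realized_pairs_add_mu[OF s(1) assms[OF s(1)]]
    by (simp add: s(2))
qed

end

theorem proposition7p3:
  fixes Gv0 :: "'v wgraph" and v0 u0 :: 'v and n :: int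
  assumes "forest Gv0"
    and "v0 \<in> verts Gv0"
    and "dom (wt Gv0) = verts Gv0 - {v0}"
    and "u0 \<notin> verts Gv0"
    and "neg_def (set_weight Gv0 v0 n)"
  shows "flip_collection_iso
    (CFK (attach_vertex (set_weight Gv0 v0 n) v0 u0) u0)
    (XK (surgery_pairs Gv0 v0 n) (seifert_framing Gv0 v0 n) (CFK Gv0 v0))
    (realized_pairs Gv0 v0 n)
    (hocolim_Phi Gv0 v0 n)"
proof -
  interpret surgery Gv0 v0 n
    by unfold_locales (use assms in auto)
  define Gu where "Gu = attach_vertex Gn v0 u0"
  have edges: "e \<subseteq> verts Gv0" if "e \<in> edges Gv0" for e
    using assms(1) that by (auto simp: forest_def)
  \<comment> \<open>Deleting a vertex also erases its weight, so recovering \<open>Gv0(n)\<close>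
    requires that \<open>u0\<close> has none.\<close>
  have "u0 \<notin> dom (wt Gn)" using assms(2-4) by (auto simp: set_weight_def)
  then have "wt Gn |` (- {u0}) = wt Gn"
    by (auto simp: restrict_map_def fun_eq_iff domIff)
  moreover have "{e \<in> insert {u0, v0} (edges Gv0). u0 \<notin> e} = edges Gv0"
    using edges assms(4) by auto
  ultimately have delete: "delete_vertex Gu u0 = Gn"
    using assms(4) by (simp add: Gu_def delete_vertex_def attach_vertex_def set_weight_def)
  have "{u0, v} \<in> edges Gu \<longleftrightarrow> v = v0" if "v \<noteq> u0" for v
    using edges[of "{u0, v}"] assms(2,4) that
    by (auto simp: Gu_def attach_vertex_def set_weight_def doubleton_eq_iff)
  moreover have "verts Gu = insert u0 (verts Gv0)" by (simp add: Gu_def attach_vertex_def)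
  ultimately have "PD_attached Gu u0 v = vertex_class v0 v" for v
    using assms(2,4) by (cases "v = u0") (auto simp: PD_attached_def vertex_class_def)
  then have attached: "plus_attached Gu u0 = add_mu"
    by (simp add: plus_attached_def add_mu_def fun_eq_iff)
  have fc: "flip_collection (CFK Gu u0)"
    by (rule flip_collection_CFK) (simp add: Gu_def attach_vertex_def)
  have CFK: "cidx (CFK Gu u0) = Spinc Gn" "cshift (CFK Gu u0) s = add_mu ` s"
    "cob (CFK Gu u0) s = hocolim (D_cat Gn s) (point_diagram (\<lambda>c. (h_U Gn c, h_V Gu u0 c)))"
    "cflip (CFK Gu u0) s = hocolim_map (D_cat Gn s)
      (map_prod (map_prod add_mu id) (map_prod add_mu id)) (\<lambda>c n x. x)" for s
    by (simp_all add: CFK_simps delete attached)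
  have h_V: "h_V Gu u0 c = h_U Gn (map_prod add_mu id c)" for c
    by (simp add: h_V_map delete attached)
  have add_mu: "add_mu ` s \<in> Spinc Gn" if "s \<in> Spinc Gn" for s
    using plus_attached_Spinc[of s Gu u0] that by (simp add: delete attached)
  have fx: "flip_collection (XK (surgery_pairs Gv0 v0 n) r X\<^sub>0)"
    by (rule flip_collection_XK_CFK[OF add_mu])
  show ?thesis
    unfolding flip_collection_iso_def Gu_def[symmetric]
  proof (intro conjI ballI allI)
    show "flip_collection (CFK Gu u0)" by (rule fc)
    show "flip_collection (XK (surgery_pairs Gv0 v0 n) r X\<^sub>0)" by (rule fx)
    show "bij_betw rp (cidx (CFK Gu u0)) (cidx (XK (surgery_pairs Gv0 v0 n) r X\<^sub>0))"
      using bij_betw_realized_pairs by (simp add: CFK)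
    fix s assume "s \<in> cidx (CFK Gu u0)"
    then have s: "s \<in> Spinc Gn" by (simp add: CFK)
    show "rp (cshift (CFK Gu u0) s) = cshift (XK (surgery_pairs Gv0 v0 n) r X\<^sub>0) (rp s)"
      using realized_pairs_add_mu[OF s add_mu[OF s]] by (simp add: CFK)
    let ?T = "TB_hocolim_to_CF Gv0 v0 n"
    let ?Z = "hocolim (I s) (TB Gv0 v0 n s)"
    have cob_XK: "cob (XK (surgery_pairs Gv0 v0 n) r X\<^sub>0) (rp s) = hocolim (I s) (XKD r X\<^sub>0)"
      by (simp add: I_eq)
    have bijT: "bij_betw (?T m) (cells ?Z m) (cells (cob (CFK Gu u0) s) m)" for m
      unfolding CFK by (rule bij_betw_TB_hocolim_to_CF[OF s])
    \<comment> \<open>All remaining claims are checked on cells \<open>?T m y\<close>, where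
      \<open>hocolim_Phi_apply\<close> cancels the \<open>inv_into\<close>.\<close>
    have cell: "\<exists>y \<in> cells ?Z m. x = ?T m y" if "x \<in> cells (cob (CFK Gu u0) s) m" for m x
      using bij_betw_imp_surj_on[OF bijT] that by blast
    have Z: "filtered_sset ?Z" by (rule filtered_sset_hocolim[OF filtered_diagram_TB[OF s]])
    show "filtered_iso (cob (CFK Gu u0) s) (cob (XK (surgery_pairs Gv0 v0 n) r X\<^sub>0) (rp s))
        (hocolim_Phi Gv0 v0 n s)"
    proof (rule filtered_isoI)
      show "filtered_sset (cob (CFK Gu u0) s)"
        using fc s by (simp add: flip_collection_def CFK(1))
      show "filtered_sset (cob (XK (surgery_pairs Gv0 v0 n) r X\<^sub>0) (rp s))"
        using fx realized_pairs_quotient[OF s] by (simp add: flip_collection_def)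
      fix m
      have "bij_betw (hocolim_Phi' s m \<circ> inv_into (cells ?Z m) (?T m))
          (cells (cob (CFK Gu u0) s) m) (cells (hocolim (I s) (XKD r X\<^sub>0)) m)"
        by (rule bij_betw_trans[OF bij_betw_inv_into[OF bijT] bij_betw_hocolim_Phi[OF s]])
      then show "bij_betw (hocolim_Phi Gv0 v0 n s m) (cells (cob (CFK Gu u0) s) m)
          (cells (cob (XK (surgery_pairs Gv0 v0 n) r X\<^sub>0) (rp s)) m)"
        unfolding cob_XK by (simp add: o_def hocolim_Phi_def[abs_def])
    next
      fix m x assume "x \<in> cells (cob (CFK Gu u0) s) m"
      then obtain y where y: "y \<in> cells ?Z m" "x = ?T m y" using cell by blast
      obtain \<sigma> \<tau> u where y_eq: "y = (\<sigma>, \<tau>, u)" by (metis surj_pair)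
      have "\<sigma> \<in> nerve (I s) m" using y(1) by (simp add: y_eq cells_hocolim)
      then have "ht (cob (CFK Gu u0) s) m x =
          (h_U Gn (fst (\<tau> (0, 0))), h_U Gn (map_prod add_mu id (fst (\<tau> (0, 0)))))"
        using image_cube_0[of \<sigma> s m \<tau>]
        by (simp add: y y_eq CFK TB_hocolim_to_CF_apply ht_hocolim D_cat_def h_V)
      then show "ht (cob (XK (surgery_pairs Gv0 v0 n) r X\<^sub>0) (rp s)) m (hocolim_Phi Gv0 v0 n s m x) =
          ht (cob (CFK Gu u0) s) m x"
        unfolding cob_XK
        using ht_hocolim_Phi[OF s, of \<sigma> \<tau> u m] y hocolim_Phi_apply[OF s y(1)] by (simp add: y_eq)
    next
      fix l m \<theta> x assume \<theta>: "\<theta> \<in> simplex_arrows l m" and "x \<in> cells (cob (CFK Gu u0) s) m"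
      then obtain y where y: "y \<in> cells ?Z m" "x = ?T m y" using cell by blast
      \<comment> \<open>The operator is carried over to \<open>?Z\<close> before
        \<open>hocolim_Phi\<close> is evaluated, so that its argument is again of the form
        \<open>?T l y\<close>.\<close>
      have "hocolim_Phi Gv0 v0 n s l (act (cob (CFK Gu u0) s) l m \<theta> x) =
          hocolim_Phi Gv0 v0 n s l (?T l (act ?Z l m \<theta> y))"
        unfolding y(2) CFK TB_hocolim_to_CF_act[OF s \<theta> y(1), symmetric] ..
      also have "\<dots> = hocolim_Phi' s l (act ?Z l m \<theta> y)"
        by (rule hocolim_Phi_apply[OF s filtered_ssetD(1)[OF Z \<theta> y(1)]])
      also have "\<dots> = act (hocolim (I s) (XKD r X\<^sub>0)) l m \<theta> (hocolim_Phi' s m y)"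
        using filtered_mapD(3)[OF filtered_map_hocolim_Phi[OF s] \<theta> y(1)] by simp
      finally show "hocolim_Phi Gv0 v0 n s l (act (cob (CFK Gu u0) s) l m \<theta> x) =
          act (cob (XK (surgery_pairs Gv0 v0 n) r X\<^sub>0) (rp s)) l m \<theta> (hocolim_Phi Gv0 v0 n s m x)"
        unfolding cob_XK y(2) hocolim_Phi_apply[OF s y(1)] .
    qed
    fix m x assume "x \<in> cells (cob (CFK Gu u0) s) m"
    then obtain y where y: "y \<in> cells ?Z m" "x = ?T m y" using cell by blast
    have "cflip (CFK Gu u0) s m x = ?T m (TB_flip s m y)"
      using TB_hocolim_to_CF_flip[OF s y(1)] by (simp add: CFK y(2))
    then have "hocolim_Phi Gv0 v0 n (add_mu ` s) m (cflip (CFK Gu u0) s m x) =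
        hocolim_Phi' (add_mu ` s) m (TB_flip s m y)"
      using hocolim_Phi_apply[OF add_mu[OF s] TB_flip_mem[OF s add_mu[OF s] y(1)]] by simp
    also have "\<dots> = hocolim_map (I s) index_shift (\<lambda>d n x. x) m (hocolim_Phi Gv0 v0 n s m x)"
      using hocolim_Phi_flip[OF s add_mu[OF s] y(1)] hocolim_Phi_apply[OF s y(1)] y(2) by simp
    finally show "cflip (XK (surgery_pairs Gv0 v0 n) r X\<^sub>0) (rp s) m (hocolim_Phi Gv0 v0 n s m x) =
        hocolim_Phi Gv0 v0 n (cshift (CFK Gu u0) s) m (cflip (CFK Gu u0) s m x)"
      by (simp add: CFK(2) I_eq)
  qed
qed

end
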